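(* Consider the Riemannian metric $$\bar G_{(r,\varphi)} = g_1(r)\,\langle d\varphi,d\varphi\rangle + g_2(r)\,dr^2$$ on $\mathbb{R}_{>0}\times (S\cap C^\infty)$ (under the maps $R$ and $\Phi$ of the context, this is the representation in polar coordinates of the metric $G$ on $\mathrm{Dens}_+(M)$). A smooth curve $t\mapsto (r(t),\varphi(t))$ in $\mathbb{R}_{>0}\times (S\cap C^\infty)$, defined on an interval containing $0$, is a geodesic of $\bar G$ if and only if $$\nabla^S_{\partial_t}\varphi_t = -\,\partial_t\big(\log g_1(r)\big)\,\varphi_t,\qquad r_{tt} = \frac12\,\frac{g_1'(r)}{g_2(r)}\,\langle\varphi_t,\varphi_t\rangle - \frac12\,\partial_t\big(\log g_2(r)\big)\,r_t .$$ Moreover, along every geodesic the following hold. (i) The quantity $A_0 = g_1(r)\,\|\varphi_t\|$ is constant in $t$, and $$r_{tt} = \frac{A_0^2}{2}\,\frac{g_1'(r)}{g_1(r)^2 g_2(r)} - \frac12\,\partial_t\big(\log g_2(r)\big)\,r_t .$$ (ii) If $\varphi(0)=\varphi_0$ and $\varphi_t(0)=\psi_0\neq 0$, then $$\varphi(t) = \cos\big(\|\psi_0\|\,\alpha(t)\big)\,\varphi_0 + \sin\big(\|\psi_0\|\,\alpha(t)\big)\,\frac{\psi_0}{\|\psi_0\|},\qquad \alpha(t) = g_1(r(0))\int_0^t \frac{1}{g_1(r(\tau))}\,d\tau .$$ (iii) In the coordinate $s = W(r)=\int_1^r\sqrt{g_2(\rho)}\,d\rho$, in which $\bar G = a(s)\langle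 d\varphi,d\varphi\rangle + ds^2$, the geodesic satisfies, with $A_0=a(s)\|\varphi_t\|$, $$s_{tt} = \frac{A_0^2}{2}\,\frac{a'(s)}{a(s)^2}\qquad\text{and}\qquad s_t^2 = -\frac{A_0^2}{a(s)} + A_1$$ for some constant $A_1$.
   Context: $M$ is a smooth compact manifold (possibly with boundary or corners) of dimension at least $1$. $\mathrm{Dens}_+(M)$ is the Fréchet manifold of smooth positive densities on $M$; its tangent space at $\mu$ is the space of all smooth densities. $C_1,C_2:(0,\infty)\to\mathbb{R}$ are smooth functions with $C_1(m)>0$ and $C_2(m)>-\frac1m C_1(m)$ for all $m>0$, so that $$G_\mu(\alpha,\beta)=C_1(\mu(M))\int_M\frac{\alpha}{\mu}\frac{\beta}{\mu}\,\mu + C_2(\mu(M))\int_M\alpha\cdot\int_M\beta$$ is a Riemannian metric on $\mathrm{Dens}_+(M)$, where $\mu(M)=\int_M\mu$. Fix a smooth positive density $\mu_0$ with $\int_M\mu_0=1$. Let $\langle f,h\rangle=\int_M fh\,\mu_0$ and $\|f\|^2=\langle f,f\rangle$ be the $L^2(\mu_0)$ inner product and norm. $S=\{\varphi\in L^2(M,\mathbb{R}):\int_M\varphi^2\mu_0=1\}$ is the $L^2$-sphere, $S\cap C^\infty$ its intersection with $C^\infty(M,\mathbb{R})$, and $\nabla^S$ is the Levi-Civita covariant derivative of the standard metric $\langle d\varphi,d\varphi\rangle$ on $S$ (the orthogonal projection to the tangent space of $S$ of the derivative in $L^2$). The diffeomorphism $R:\mathrm{Dens}_+(M)\to C^\infty(M,\mathbb{R}_{>0})$,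 $R(\mu)=\sqrt{\mu/\mu_0}$, followed by $\Phi(f)=(r,\varphi)=(\|f\|,f/\|f\|)$, identifies $(\mathrm{Dens}_+(M),G)$ isometrically with the open subset of $\mathbb{R}_{>0}\times(S\cap C^\infty)$ where $\varphi>0$, equipped with $\bar G$, where $$g_1(r)=4C_1(r^2)r^2,\qquad g_2(r)=4\big(C_1(r^2)+C_2(r^2)r^2\big).$$ With $r(s)$ the inverse of $s=W(r)$, put $a(s)=4C_1(r(s)^2)r(s)^2$. Subscripts $t$ denote derivatives in $t$. A geodesic is a smooth curve that is a critical point, on every compact subinterval and under smooth variations with fixed endpoints, of the energy $\int\big(\frac12 g_1(r)\langle\varphi_t,\varphi_t\rangle+\frac12 g_2(r)r_t^2\big)dt$. *)

theory Defs
  imports "HOL-Analysis.Analysis"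
begin

section \<open>Smooth functions\<close>

primrec Ck_on :: "nat \<Rightarrow> 'a::real_normed_vector set \<Rightarrow> ('a \<Rightarrow> 'b::real_normed_vector) \<Rightarrow> bool"
where
  "Ck_on 0 U f \<longleftrightarrow> continuous_on U f"
| "Ck_on (Suc k) U f \<longleftrightarrow>
     (\<exists>f'. (\<forall>x\<in>U. (f has_derivative f' x) (at x)) \<and> (\<forall>v. Ck_on k U (\<lambda>x. f' x v)))"

text \<open>
  On a set that need not be open (an interval with endpoints, an open piece of a quadrant),
  smooth means: locally the restriction of a smooth function on an open set.
\<close>

definition smooth_on :: "'a::euclidean_space set \<Rightarrow> ('a \<Rightarrow> 'b::euclidean_space) \<Rightarrow> bool" where
  "smooth_on S f \<longleftrightarrow>
     (\<forall>x\<in>S. \<exists>U g. open U \<and> x \<in> U \<and> (\<forall>k. Ck_on k U g) \<and> (\<forall>y\<in>S \<inter> U. g y = f y))"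

section \<open>Manifolds with corners\<close>

text \<open>
  The manifold is the whole type \<open>'m\<close>; being Hausdorff and second countable is imposed by its
  type classes. A chart is a pair of its domain and its map into the model space \<open>'e\<close>, whose
  dimension is that of the manifold (at least 1, as for every type of class
  \<open>euclidean_space\<close>).
\<close>

type_synonym ('m, 'e) chart = "'m set \<times> ('m \<Rightarrow> 'e)"

text \<open>
  The image of a chart is relatively open in a quadrant. With \<open>B\<close> empty the quadrant is the whole
  model space, with \<open>B\<close> a singleton it is a half space.
\<close>

definition corner_chart ::
  "('m::topological_space, 'e::euclidean_space) chart \<Rightarrow> bool" where
  "corner_chart = (\<lambda>(U, \<kappa>). open U \<and> homeomorphism U (\<kappa> ` U) \<kappa> (inv_into U \<kappa>) \<and>
     (\<exists>B\<subseteq>Basis. openin (top_of_set {u. \<forall>b\<in>B. 0 \<le> u \<bullet> b}) (\<kappa> ` U)))"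

definition compact_manifold_with_corners ::
  "('m::{t2_space,second_countable_topology}, 'e::euclidean_space) chart set \<Rightarrow> bool" where
  "compact_manifold_with_corners \<A> \<longleftrightarrow>
     compact (UNIV :: 'm set) \<and>
     (\<forall>c\<in>\<A>. corner_chart c) \<and>
     (\<Union>c\<in>\<A>. fst c) = UNIV \<and>
     (\<forall>(U, \<kappa>)\<in>\<A>. \<forall>(V, \<eta>)\<in>\<A>. smooth_on (\<kappa> ` (U \<inter> V)) (\<eta> \<circ> inv_into U \<kappa>))"

definition smooth_fun ::
  "('m, 'e::euclidean_space) chart set \<Rightarrow> ('m \<Rightarrow> real) \<Rightarrow> bool" where
  "smooth_fun \<A> f \<longleftrightarrow> (\<forall>(U, \<kappa>)\<in>\<A>. smooth_on (\<kappa> ` U) (f \<circ> inv_into U \<kappa>))"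

text \<open>
  Smooth maps from a parameter set \<open>T\<close> (an interval, or a rectangle) into the Frechet space of
  smooth functions on the compact manifold. By the exponential law these are the maps that are
  smooth jointly in the parameter and the point of the manifold.
\<close>

definition smooth_family ::
  "('m, 'e::euclidean_space) chart set \<Rightarrow> 'p::euclidean_space set \<Rightarrow> ('p \<Rightarrow> 'm \<Rightarrow> real) \<Rightarrow> bool"
where
  "smooth_family \<A> T \<phi> \<longleftrightarrow>
     (\<forall>(U, \<kappa>)\<in>\<A>. smooth_on (T \<times> \<kappa> ` U) (\<lambda>(p, u). \<phi> p (inv_into U \<kappa> u)))"

text \<open>
  A smooth positive density is identified with the Borel measure it defines: in every chart it is
  a smooth positive function times Lebesgue measure.
\<close>

definition smooth_positive_density ::
  "('m::topological_space, 'e::euclidean_space) chart set \<Rightarrow> 'm measure \<Rightarrow> bool" where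
  "smooth_positive_density \<A> \<mu> \<longleftrightarrow>
     sets \<mu> = sets borel \<and>
     (\<forall>(U, \<kappa>)\<in>\<A>. \<exists>\<rho>. smooth_on (\<kappa> ` U) \<rho> \<and> (\<forall>u\<in>\<kappa> ` U. 0 < \<rho> u) \<and>
        (\<forall>X\<in>sets borel. X \<subseteq> U \<longrightarrow>
           emeasure \<mu> X = (\<integral>\<^sup>+u\<in>\<kappa> ` X. ennreal (\<rho> u) \<partial>lborel)))"

section \<open>Time derivatives\<close>

text \<open>
  Derivatives within the interval of definition, hence one-sided at an endpoint that belongs to
  it. For smooth families the pointwise derivative is also the derivative in \<open>L\<^sup>2\<close>.
\<close>

definition ddt :: "real set \<Rightarrow> (real \<Rightarrow> real) \<Rightarrow> real \<Rightarrow> real" where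
  "ddt I f t = vector_derivative f (at t within I)"

definition ddtM :: "real set \<Rightarrow> (real \<Rightarrow> 'm \<Rightarrow> real) \<Rightarrow> real \<Rightarrow> 'm \<Rightarrow> real" where
  "ddtM I \<phi> t = (\<lambda>x. ddt I (\<lambda>\<tau>. \<phi> \<tau> x) t)"

section \<open>The \<open>L\<^sup>2\<close>-sphere and the polar metric\<close>

definition L2_ip :: "'m measure \<Rightarrow> ('m \<Rightarrow> real) \<Rightarrow> ('m \<Rightarrow> real) \<Rightarrow> real" where
  "L2_ip \<mu>0 f h = (\<integral>x. f x * h x \<partial>\<mu>0)"

definition L2_nrm :: "'m measure \<Rightarrow> ('m \<Rightarrow> real) \<Rightarrow> real" where
  "L2_nrm \<mu>0 f = sqrt (L2_ip \<mu>0 f f)"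

definition smooth_sphere ::
  "('m, 'e::euclidean_space) chart set \<Rightarrow> 'm measure \<Rightarrow> ('m \<Rightarrow> real) set" where
  "smooth_sphere \<A> \<mu>0 = {\<phi>. smooth_fun \<A> \<phi> \<and> (\<integral>x. (\<phi> x)\<^sup>2 \<partial>\<mu>0) = 1}"

text \<open>
  The tangent space of the sphere at \<open>\<phi>\<close> is the orthogonal complement of the unit vector \<open>\<phi>\<close>.
\<close>

definition sphere_proj :: "'m measure \<Rightarrow> ('m \<Rightarrow> real) \<Rightarrow> ('m \<Rightarrow> real) \<Rightarrow> 'm \<Rightarrow> real" where
  "sphere_proj \<mu>0 \<phi> \<psi> = (\<lambda>x. \<psi> x - L2_ip \<mu>0 \<phi> \<psi> * \<phi> x)"

definition sphere_cov_deriv ::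
  "'m measure \<Rightarrow> real set \<Rightarrow> (real \<Rightarrow> 'm \<Rightarrow> real) \<Rightarrow> (real \<Rightarrow> 'm \<Rightarrow> real) \<Rightarrow> real \<Rightarrow> 'm \<Rightarrow> real"
where
  "sphere_cov_deriv \<mu>0 I \<phi> X t = sphere_proj \<mu>0 (\<phi> t) (ddtM I X t)"

text \<open>
  The metric on densities. Tangent vectors \<open>\<alpha>\<close>, \<open>\<beta>\<close> at \<open>\<mu>\<close> are given by the functions
  \<open>a = \<alpha>/\<mu>\<close> and \<open>b = \<beta>/\<mu>\<close>, so that the integral of \<open>\<alpha>\<close> is that of \<open>a\<close> against \<open>\<mu>\<close>.
\<close>

definition G_metric ::
  "(real \<Rightarrow> real) \<Rightarrow> (real \<Rightarrow> real) \<Rightarrow> 'm measure \<Rightarrow> ('m \<Rightarrow> real) \<Rightarrow> ('m \<Rightarrow> real) \<Rightarrow> real" where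
  "G_metric C1 C2 \<mu> a b =
     C1 (measure \<mu> (space \<mu>)) * (\<integral>x. a x * b x \<partial>\<mu>) +
     C2 (measure \<mu> (space \<mu>)) * ((\<integral>x. a x \<partial>\<mu>) * (\<integral>x. b x \<partial>\<mu>))"

definition polar_metric ::
  "'m measure \<Rightarrow> (real \<Rightarrow> real) \<Rightarrow> (real \<Rightarrow> real) \<Rightarrow> real \<Rightarrow>
   real \<times> ('m \<Rightarrow> real) \<Rightarrow> real \<times> ('m \<Rightarrow> real) \<Rightarrow> real" where
  "polar_metric \<mu>0 g1 g2 r v w =
     g1 r * L2_ip \<mu>0 (snd v) (snd w) + g2 r * (fst v * fst w)"

text \<open>\<open>R_map\<close> acts on a positive density \<open>\<mu>\<close> through \<open>h = \<mu>/\<mu>\<^sub>0\<close>.\<close>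

definition R_map :: "('m \<Rightarrow> real) \<Rightarrow> 'm \<Rightarrow> real" where
  "R_map h = (\<lambda>x. sqrt (h x))"

definition Phi_map :: "'m measure \<Rightarrow> ('m \<Rightarrow> real) \<Rightarrow> real \<times> ('m \<Rightarrow> real)" where
  "Phi_map \<mu>0 f = (L2_nrm \<mu>0 f, \<lambda>x. f x / L2_nrm \<mu>0 f)"

section \<open>Geodesics\<close>

definition smooth_polar ::
  "('m, 'e::euclidean_space) chart set \<Rightarrow> 'm measure \<Rightarrow> 'p::euclidean_space set \<Rightarrow>
   ('p \<Rightarrow> real) \<Rightarrow> ('p \<Rightarrow> 'm \<Rightarrow> real) \<Rightarrow> bool" where
  "smooth_polar \<A> \<mu>0 T r \<phi> \<longleftrightarrow>
     smooth_on T r \<and> smooth_family \<A> T \<phi> \<and>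
     (\<forall>p\<in>T. 0 < r p \<and> \<phi> p \<in> smooth_sphere \<A> \<mu>0)"

definition energy ::
  "'m measure \<Rightarrow> (real \<Rightarrow> real) \<Rightarrow> (real \<Rightarrow> real) \<Rightarrow> real \<Rightarrow> real \<Rightarrow>
   (real \<Rightarrow> real) \<Rightarrow> (real \<Rightarrow> 'm \<Rightarrow> real) \<Rightarrow> real" where
  "energy \<mu>0 g1 g2 a b r \<phi> =
     integral {a..b} (\<lambda>t.
       1/2 * g1 (r t) * L2_ip \<mu>0 (ddtM {a..b} \<phi> t) (ddtM {a..b} \<phi> t) +
       1/2 * g2 (r t) * (ddt {a..b} r t)\<^sup>2)"

definition geodesic ::
  "('m, 'e::euclidean_space) chart set \<Rightarrow> 'm measure \<Rightarrow> (real \<Rightarrow> real) \<Rightarrow> (real \<Rightarrow> real) \<Rightarrow>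
   real set \<Rightarrow> (real \<Rightarrow> real) \<Rightarrow> (real \<Rightarrow> 'm \<Rightarrow> real) \<Rightarrow> bool" where
  "geodesic \<A> \<mu>0 g1 g2 I r \<phi> \<longleftrightarrow>
     smooth_polar \<A> \<mu>0 I r \<phi> \<and>
     (\<forall>a b. a < b \<and> {a..b} \<subseteq> I \<longrightarrow>
       (\<forall>\<delta>>0. \<forall>rv \<phi>v.
          smooth_polar \<A> \<mu>0 ({-\<delta><..<\<delta>} \<times> {a..b}) rv \<phi>v \<and>
          (\<forall>t\<in>{a..b}. rv (0, t) = r t \<and> \<phi>v (0, t) = \<phi> t) \<and>
          (\<forall>\<epsilon>\<in>{-\<delta><..<\<delta>}. \<forall>t\<in>{a, b}. rv (\<epsilon>, t) = r t \<and> \<phi>v (\<epsilon>, t) = \<phi> t) \<longrightarrow>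
          ((\<lambda>\<epsilon>. energy \<mu>0 g1 g2 a b (\<lambda>t. rv (\<epsilon>, t)) (\<lambda>t. \<phi>v (\<epsilon>, t)))
             has_real_derivative 0) (at 0)))"

end

theory Submission
  imports Defs
begin

text \<open>
  The energy of a variation \<open>(r + \<delta>r, \<phi> + \<delta>\<phi>)\<close> with fixed endpoints is differentiated under the
  integrals over \<open>M\<close> and over \<open>[a, b]\<close>. Mixed partial derivatives commute, so integration by parts in
  time gives the first variation \<open>\<integral> \<langle>P, \<delta>\<phi>\<rangle> + Q \<delta>r dt\<close> with
  \<open>P = - (g1(r) \<phi>\<^sub>t)\<^sub>t\<close> and \<open>Q = g1'(r) \<parallel>\<phi>\<^sub>t\<parallel>\<^sup>2 / 2 - g2'(r) r\<^sub>t\<^sup>2 / 2 - g2(r) r\<^sub>t\<^sub>t\<close>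
  (\<open>first_variation\<close>). A variation inside the sphere has \<open>\<delta>\<phi>\<close> orthogonal to \<open>\<phi>\<close>, so only the
  tangential part \<open>p\<close> of \<open>P\<close> enters, and \<open>p = 0\<close>, \<open>Q = 0\<close> is the asserted system
  (\<open>geodesic_equation\<close>); it is therefore sufficient. It is necessary because \<open>p\<close> and \<open>Q\<close> are themselves
  smooth and may serve as directions: with \<open>\<zeta>(t) = (t - a) (b - t)\<close> there is a variation through the sphere
  having \<open>\<delta>\<phi> = \<zeta> p\<close> and \<open>\<delta>r = \<zeta> Q\<close> (\<open>variation_in_direction\<close>), and the first
  variation becomes \<open>\<integral> \<zeta> (\<parallel>p\<parallel>\<^sup>2 + Q\<^sup>2) dt\<close>, which vanishes only if \<open>p\<close> and \<open>Q\<close> do.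

  Two analytic facts carry this. Smoothness up to the endpoints of an interval means local extendability to
  an open set, and integrals over \<open>M\<close> must preserve it: \<open>integral_family_smooth\<close> cuts the compact
  manifold into finitely many Borel pieces, each inside one chart, and integrates chart extensions over the
  pieces. And a smooth function with vanishing \<open>L\<^sup>2\<close> norm vanishes at every point, because a positive density
  charges every nonempty open set, also at corner points (\<open>emeasure_open_pos\<close>).

  The remaining assertions are consequences of the two equations. Pairing the first with \<open>\<phi>\<^sub>t\<close> shows
  that \<open>g1(r)\<^sup>2 \<parallel>\<phi>\<^sub>t\<parallel>\<^sup>2\<close> has derivative zero. For the great circle put \<open>w = g1(r) \<phi>\<^sub>t / A0\<close> and let
  \<open>\<theta>\<close> be the angle with \<open>\<theta>\<^sub>t = A0 / g1(r)\<close>; then \<open>\<phi>\<^sub>t = \<theta>\<^sub>t w\<close> and \<open>w\<^sub>t = - \<theta>\<^sub>t \<phi>\<close>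
  hold at every point of \<open>M\<close> separately, so \<open>(\<phi>, w)\<close> is the rotation by \<open>\<theta>\<close> of its initial value.
  In the coordinate \<open>s = W(r)\<close> with \<open>W' = sqrt g2\<close> the terms with \<open>g2'\<close> cancel, and \<open>s\<^sub>t\<^sup>2 + A0\<^sup>2 / a(s)\<close>
  is a first integral. Finally \<open>\<mu> / \<mu>0 = (r \<phi>)\<^sup>2\<close> in polar coordinates; substituting this into \<open>G\<close> and
  using \<open>\<parallel>\<phi>\<parallel> = 1\<close>, \<open>\<langle>\<phi>, \<phi>\<^sub>t\<rangle> = 0\<close> gives the two coefficients \<open>g1\<close> and \<open>g2\<close>.
\<close>

section \<open>Finitely and infinitely often differentiable functions\<close>

lemma Ck_on_subset:
  assumes "Ck_on k U f" "V \<subseteq> U"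
  shows "Ck_on k V f"
  using assms(1)
proof (induction k arbitrary: f)
  case 0
  then show ?case using assms(2) by (simp add: continuous_on_subset)
next
  case (Suc k)
  then obtain f' where "\<forall>x\<in>U. (f has_derivative f' x) (at x)" "\<And>v. Ck_on k U (\<lambda>x. f' x v)"
    by auto
  with Suc.IH assms(2) show ?case by (auto intro!: exI[of _ f'])
qed

lemma Ck_on_cong:
  assumes "open U" "\<And>x. x \<in> U \<Longrightarrow> f x = g x" "Ck_on k U f"
  shows "Ck_on k U g"
proof (cases k)
  case 0
  then show ?thesis using assms by (simp cong: continuous_on_cong)
next
  case (Suc j)
  then obtain f' where f': "\<forall>x\<in>U. (f has_derivative f' x) (at x)" "\<And>v. Ck_on j U (\<lambda>x. f' x v)"
    using assms(3) by auto
  have "\<forall>x\<in>U. (g has_derivative f' x) (at x)"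
    using f'(1) assms(1,2) by (meson has_derivative_transform_within_open)
  with f'(2) Suc show ?thesis by (auto intro!: exI[of _ f'])
qed

lemma Ck_on_SucD:
  assumes "Ck_on (Suc k) U f"
  shows "Ck_on k U f"
  using assms
proof (induction k arbitrary: f)
  case 0
  then show ?case
    using has_derivative_continuous by (auto intro!: continuous_at_imp_continuous_on) blast
next
  case (Suc k)
  from Suc.prems obtain f'
    where f': "\<forall>x\<in>U. (f has_derivative f' x) (at x)" "\<And>v. Ck_on (Suc k) U (\<lambda>x. f' x v)"
    by (subst (asm) Ck_on.simps) auto
  from Suc.IH[OF f'(2)] f'(1) show ?case by auto
qed

lemma Ck_on_continuous: "Ck_on k U f \<Longrightarrow> continuous_on U f"
  by (induction k) (auto dest: Ck_on_SucD simp del: Ck_on.simps(2))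

lemma Ck_on_const: "Ck_on k U (\<lambda>x. c)"
proof (induction k arbitrary: c)
  case (Suc k)
  then show ?case by (auto intro!: exI[of _ "\<lambda>x v. 0"])
qed auto

lemma Ck_on_bounded_linear:
  assumes "bounded_linear f"
  shows "Ck_on k U f"
proof (cases k)
  case 0
  then show ?thesis using assms by (simp add: linear_continuous_on)
next
  case (Suc j)
  then show ?thesis
    using bounded_linear_imp_has_derivative[OF assms] Ck_on_const
    by (auto intro!: exI[of _ "\<lambda>x. f"])
qed

lemma Ck_on_add:
  assumes "Ck_on k U f" "Ck_on k U g"
  shows "Ck_on k U (\<lambda>x. f x + g x)"
  using assms
proof (induction k arbitrary: f g)
  case 0
  then show ?case by (simp add: continuous_on_add)
next
  case (Suc k)
  from Suc.prems obtain f' g'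
    where "\<forall>x\<in>U. (f has_derivative f' x) (at x)" "\<And>v. Ck_on k U (\<lambda>x. f' x v)"
      "\<forall>x\<in>U. (g has_derivative g' x) (at x)" "\<And>v. Ck_on k U (\<lambda>x. g' x v)"
    by auto
  with Suc.IH show ?case
    by (auto intro!: exI[of _ "\<lambda>x v. f' x v + g' x v"] has_derivative_add)
qed

lemma Ck_on_mult:
  fixes f g :: "'a::real_normed_vector \<Rightarrow> real"
  assumes "Ck_on k U f" "Ck_on k U g"
  shows "Ck_on k U (\<lambda>x. f x * g x)"
  using assms
proof (induction k arbitrary: f g)
  case 0
  then show ?case by (simp add: continuous_on_mult)
next
  case (Suc k)
  from Suc.prems obtain f' g'
    where d: "\<forall>x\<in>U. (f has_derivative f' x) (at x)" "\<And>v. Ck_on k U (\<lambda>x. f' x v)"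
      "\<forall>x\<in>U. (g has_derivative g' x) (at x)" "\<And>v. Ck_on k U (\<lambda>x. g' x v)"
    by auto
  have c: "Ck_on k U f" "Ck_on k U g" using Suc.prems Ck_on_SucD by blast+
  have "Ck_on k U (\<lambda>x. f x * g' x v + f' x v * g x)" for v
    by (intro Ck_on_add Suc.IH c d)
  with d show ?case
    by (auto intro!: exI[of _ "\<lambda>x v. f x * g' x v + f' x v * g x"] has_derivative_mult)
qed

text \<open>
  By the chain rule the derivative in direction \<open>v\<close> is \<open>f' x v * F' (f x) 1\<close>, a product of functions of
  class one lower; this is why closure under products comes first.
\<close>

lemma Ck_on_compose:
  fixes f :: "'a::real_normed_vector \<Rightarrow> real" and F :: "real \<Rightarrow> real"
  assumes "Ck_on k V F" "Ck_on k U f" "\<And>x. x \<in> U \<Longrightarrow> f x \<in> V"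
  shows "Ck_on k U (\<lambda>x. F (f x))"
  using assms
proof (induction k arbitrary: F f)
  case 0
  then show ?case by (auto intro: continuous_on_compose2)
next
  case (Suc k)
  from Suc.prems obtain F' f'
    where d: "\<forall>x\<in>V. (F has_derivative F' x) (at x)" "\<And>v. Ck_on k V (\<lambda>x. F' x v)"
      "\<forall>x\<in>U. (f has_derivative f' x) (at x)" "\<And>v. Ck_on k U (\<lambda>x. f' x v)"
    by auto
  have lin: "F' (f x) v = v * F' (f x) 1" if "x \<in> U" for x v
  proof -
    have "linear (F' (f x))" using d(1) Suc.prems(3)[OF that] has_derivative_linear by blast
    from linear_cmul[OF this, of v 1] show ?thesis by (simp only: real_scaleR_def mult_1_right)
  qed
  have dd: "((\<lambda>x. F (f x)) has_derivative (\<lambda>v. f' x v * F' (f x) 1)) (at x)" if "x \<in> U" for x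
  proof -
    have "((\<lambda>x. F (f x)) has_derivative (\<lambda>v. F' (f x) (f' x v))) (at x)"
      using has_derivative_compose[of f "f' x" x UNIV F "F' (f x)"] d(1,3) Suc.prems(3) that
      by simp
    then show ?thesis unfolding lin[OF that, of "f' x _"] .
  qed
  have "Ck_on k U f" using Suc.prems Ck_on_SucD by blast
  then have "Ck_on k U (\<lambda>x. f' x v * F' (f x) 1)" for v
    using Suc.prems(3) by (intro Ck_on_mult d(4) Suc.IH[OF d(2)]) auto
  with dd show ?case
    by (auto intro!: exI[of _ "\<lambda>x v. f' x v * F' (f x) 1"])
qed

lemma Ck_on_affine:
  assumes "Ck_on k U f" "bounded_linear L" "\<And>x. x \<in> V \<Longrightarrow> L x + c \<in> U"
  shows "Ck_on k V (\<lambda>x. f (L x + c))"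
  using assms(1)
proof (induction k arbitrary: f)
  case 0
  then show ?case
    using continuous_on_compose2[of U f V "\<lambda>x. L x + c"] assms(3)
      continuous_on_add[OF linear_continuous_on[OF assms(2), of V] continuous_on_const[of V c]]
    by auto
next
  case (Suc k)
  from Suc.prems obtain f'
    where d: "\<forall>x\<in>U. (f has_derivative f' x) (at x)" "\<And>v. Ck_on k U (\<lambda>x. f' x v)"
    by auto
  have L: "((\<lambda>x. L x + c) has_derivative L) (at x)" for x
    using bounded_linear_imp_has_derivative[OF assms(2)] by (auto intro!: derivative_eq_intros)
  have "((\<lambda>x. f (L x + c)) has_derivative (\<lambda>v. f' (L x + c) (L v))) (at x)" if "x \<in> V" for x
    using has_derivative_compose[OF L, of f "f' (L x + c)"] d(1) assms(3)[OF that] by simp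
  moreover have "Ck_on k V (\<lambda>x. f' (L x + c) (L v))" for v
    using Suc.IH[OF d(2)] by simp
  ultimately show ?case by (auto intro!: exI[of _ "\<lambda>x v. f' (L x + c) (L v)"])
qed

lemma Ck_on_SucI_real:
  fixes f :: "real \<Rightarrow> real"
  assumes "\<And>x. x \<in> U \<Longrightarrow> (f has_real_derivative f' x) (at x)" "Ck_on k U f'"
  shows "Ck_on (Suc k) U f"
proof -
  have "Ck_on k U (\<lambda>x. f' x * v)" for v
    by (intro Ck_on_mult assms(2) Ck_on_const)
  with assms(1) show ?thesis
    by (auto intro!: exI[of _ "\<lambda>x. (*) (f' x)"] simp: has_field_derivative_def)
qed

lemma Ck_on_inverse: "Ck_on k {0<..} (inverse :: real \<Rightarrow> real)"
proof (induction k)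
  case 0
  then show ?case by (auto intro!: continuous_on_inverse)
next
  case (Suc k)
  have "Ck_on k {0<..} (\<lambda>x::real. - 1 * (inverse x * inverse x))"
    by (intro Ck_on_mult Suc Ck_on_const)
  then show ?case
    by (rule Ck_on_SucI_real[rotated])
       (auto intro!: derivative_eq_intros simp: power2_eq_square)
qed

lemma Ck_on_sqrt: "Ck_on k {0<..} sqrt"
proof (induction k)
  case 0
  then show ?case by (auto intro!: continuous_on_real_sqrt continuous_on_id)
next
  case (Suc k)
  have "Ck_on k {0<..} (\<lambda>x::real. inverse (sqrt x) * (1/2))"
    by (intro Ck_on_mult Ck_on_const Ck_on_compose[OF Ck_on_inverse Suc]) auto
  then show ?case
    by (rule Ck_on_SucI_real[rotated]) (auto intro!: DERIV_real_sqrt[THEN DERIV_cong])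
qed

text \<open>
  \<open>Ck_on\<close> chooses a derivative separately for every \<open>k\<close>. On an open set derivatives are unique, so one
  choice serves all orders, which makes the directional derivatives smooth again.
\<close>

lemma Cinf_deriv:
  assumes "open U" "\<And>k. Ck_on k U g"
  obtains g' where "\<And>x. x \<in> U \<Longrightarrow> (g has_derivative g' x) (at x)"
    "\<And>k v. Ck_on k U (\<lambda>x. g' x v)"
proof -
  define g' where "g' = (\<lambda>x. frechet_derivative g (at x))"
  have "(\<forall>x\<in>U. (g has_derivative g' x) (at x)) \<and> (\<forall>v. Ck_on k U (\<lambda>x. g' x v))" for k
  proof -
    obtain f' where f': "\<forall>x\<in>U. (g has_derivative f' x) (at x)" "\<And>v. Ck_on k U (\<lambda>x. f' x v)"
      using assms(2)[of "Suc k"] by auto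
    have e: "f' x = g' x" if "x \<in> U" for x
      using f'(1) that frechet_derivative_at unfolding g'_def by blast
    have "Ck_on k U (\<lambda>x. g' x v)" for v
      by (rule Ck_on_cong[OF assms(1) _ f'(2)[of v]]) (simp add: e)
    with f'(1) e show ?thesis by auto
  qed
  then show thesis using that by blast
qed

lemma smooth_onE:
  assumes "smooth_on S f" "x \<in> S"
  obtains U g where "open U" "x \<in> U" "\<And>k. Ck_on k U g" "\<And>y. y \<in> S \<Longrightarrow> y \<in> U \<Longrightarrow> g y = f y"
  using assms unfolding smooth_on_def by (metis IntI)

lemma smooth_onI:
  assumes "\<And>x. x \<in> S \<Longrightarrow> \<exists>U g. open U \<and> x \<in> U \<and> (\<forall>k. Ck_on k U g) \<and> (\<forall>y\<in>S \<inter> U. g y = f y)"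
  shows "smooth_on S f"
  using assms unfolding smooth_on_def by blast

lemma smooth_on_CkI: "open S \<Longrightarrow> (\<And>k. Ck_on k S f) \<Longrightarrow> smooth_on S f"
  by (rule smooth_onI) blast

lemma smooth_on_subset:
  assumes "smooth_on S f" "T \<subseteq> S"
  shows "smooth_on T f"
proof (rule smooth_onI)
  fix x assume "x \<in> T"
  then have "x \<in> S" using assms(2) by blast
  then obtain U g where "open U" "x \<in> U" "\<And>k. Ck_on k U g"
    "\<And>y. y \<in> S \<Longrightarrow> y \<in> U \<Longrightarrow> g y = f y"
    using smooth_onE[OF assms(1)] by blast
  then show "\<exists>U g. open U \<and> x \<in> U \<and> (\<forall>k. Ck_on k U g) \<and> (\<forall>y\<in>T \<inter> U. g y = f y)"
    using assms(2) by (intro exI[of _ U] exI[of _ g]) auto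
qed

lemma smooth_on_cong:
  assumes "\<And>x. x \<in> S \<Longrightarrow> f x = g x"
  shows "smooth_on S f \<longleftrightarrow> smooth_on S g"
  unfolding smooth_on_def using assms by simp

lemma smooth_on_continuous:
  assumes "smooth_on S f"
  shows "continuous_on S f"
  unfolding continuous_on_eq_continuous_within
proof
  fix x assume x: "x \<in> S"
  obtain U g where U: "open U" "x \<in> U" "\<And>k. Ck_on k U g" "\<And>y. y \<in> S \<Longrightarrow> y \<in> U \<Longrightarrow> g y = f y"
    using smooth_onE[OF assms x] by blast
  have "continuous_on (S \<inter> U) g"
    by (rule continuous_on_subset[OF Ck_on_continuous[OF U(3)[of 0]]]) auto
  then have "continuous_on (S \<inter> U) f"
    by (rule continuous_on_cong[THEN iffD1, rotated -1]) (auto simp: U(4))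
  then have "continuous (at x within S \<inter> U) f"
    using U(2) x by (simp add: continuous_on_eq_continuous_within)
  moreover have "at x within S \<inter> U = at x within S"
    by (rule at_within_nhd[OF U(2,1)]) auto
  ultimately show "continuous (at x within S) f" by simp
qed

lemma smooth_on_const: "smooth_on S (\<lambda>x. c)"
  using Ck_on_const by (intro smooth_onI exI[of _ UNIV]) blast

lemma smooth_on_bounded_linear: "bounded_linear f \<Longrightarrow> smooth_on S f"
  using Ck_on_bounded_linear by (intro smooth_onI exI[of _ UNIV]) blast

text \<open>
  Two local extensions live on different open sets; every pointwise operation is carried out on their
  intersection.
\<close>

lemma smooth_on_binary:
  fixes S :: "'a::euclidean_space set"
  assumes "smooth_on S f" "smooth_on S g"
    and "\<And>k (U :: 'a set) f g. Ck_on k U f \<Longrightarrow> Ck_on k U g \<Longrightarrow> Ck_on k U (\<lambda>x. b (f x) (g x))"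
  shows "smooth_on S (\<lambda>x. b (f x) (g x))"
proof (rule smooth_onI)
  fix x assume x: "x \<in> S"
  obtain U f1 where U: "open U" "x \<in> U" "\<And>k. Ck_on k U f1" "\<And>y. y \<in> S \<Longrightarrow> y \<in> U \<Longrightarrow> f1 y = f y"
    using smooth_onE[OF assms(1) x] by blast
  obtain V g1 where V: "open V" "x \<in> V" "\<And>k. Ck_on k V g1" "\<And>y. y \<in> S \<Longrightarrow> y \<in> V \<Longrightarrow> g1 y = g y"
    using smooth_onE[OF assms(2) x] by blast
  show "\<exists>U h. open U \<and> x \<in> U \<and> (\<forall>k. Ck_on k U h) \<and> (\<forall>y\<in>S \<inter> U. h y = b (f y) (g y))"
    using U V assms(3)[OF Ck_on_subset[OF U(3), of "U \<inter> V"] Ck_on_subset[OF V(3), of "U \<inter> V"]]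
    by (intro exI[of _ "U \<inter> V"] exI[of _ "\<lambda>x. b (f1 x) (g1 x)"]) auto
qed

lemma smooth_on_add: "smooth_on S f \<Longrightarrow> smooth_on S g \<Longrightarrow> smooth_on S (\<lambda>x. f x + g x)"
  using smooth_on_binary[of S f g "(+)"] Ck_on_add by blast

lemma smooth_on_mult:
  fixes f g :: "'a::euclidean_space \<Rightarrow> real"
  shows "smooth_on S f \<Longrightarrow> smooth_on S g \<Longrightarrow> smooth_on S (\<lambda>x. f x * g x)"
  using smooth_on_binary[of S f g "(*)"] Ck_on_mult by blast

lemma smooth_on_compose:
  fixes f :: "'a::euclidean_space \<Rightarrow> real" and F :: "real \<Rightarrow> real"
  assumes "smooth_on V F" "smooth_on S f" "\<And>x. x \<in> S \<Longrightarrow> f x \<in> V"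
  shows "smooth_on S (\<lambda>x. F (f x))"
proof (rule smooth_onI)
  fix x assume x: "x \<in> S"
  obtain U f1 where U: "open U" "x \<in> U" "\<And>k. Ck_on k U f1" "\<And>y. y \<in> S \<Longrightarrow> y \<in> U \<Longrightarrow> f1 y = f y"
    using smooth_onE[OF assms(2) x] by blast
  obtain W F1 where W: "open W" "f x \<in> W" "\<And>k. Ck_on k W F1" "\<And>y. y \<in> V \<Longrightarrow> y \<in> W \<Longrightarrow> F1 y = F y"
    using smooth_onE[OF assms(1) assms(3)[OF x]] by blast
  let ?O = "U \<inter> f1 -` W"
  have "open ?O"
    by (rule continuous_open_preimage[OF Ck_on_continuous[OF U(3)[of 0]] U(1) W(1)])
  moreover have "Ck_on k ?O (\<lambda>x. F1 (f1 x))" for k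
    by (rule Ck_on_compose[OF W(3) Ck_on_subset[OF U(3)]]) auto
  moreover have "x \<in> ?O" using U(2,4) W(2) x by simp
  ultimately show "\<exists>U h. open U \<and> x \<in> U \<and> (\<forall>k. Ck_on k U h) \<and> (\<forall>y\<in>S \<inter> U. h y = F (f y))"
    using U(4) W(4) assms(3)
    by (intro exI[of _ ?O] exI[of _ "\<lambda>x. F1 (f1 x)"]) auto
qed

lemma smooth_on_affine:
  assumes "smooth_on S f" "bounded_linear L" "\<And>x. x \<in> T \<Longrightarrow> L x + c \<in> S"
  shows "smooth_on T (\<lambda>x. f (L x + c))"
proof (rule smooth_onI)
  fix x assume x: "x \<in> T"
  obtain U g where U: "open U" "L x + c \<in> U" "\<And>k. Ck_on k U g"
    "\<And>y. y \<in> S \<Longrightarrow> y \<in> U \<Longrightarrow> g y = f y"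
    using smooth_onE[OF assms(1) assms(3)[OF x]] by blast
  let ?O = "(\<lambda>x. L x + c) -` U"
  have "open ?O"
    by (rule open_vimage[OF U(1)])
       (intro continuous_on_add linear_continuous_on assms continuous_on_const)
  moreover have "Ck_on k ?O (\<lambda>x. g (L x + c))" for k
    by (rule Ck_on_affine[OF U(3) assms(2)]) auto
  ultimately show "\<exists>U h. open U \<and> x \<in> U \<and> (\<forall>k. Ck_on k U h) \<and> (\<forall>y\<in>T \<inter> U. h y = f (L y + c))"
    using U(2,4) assms(3) by (intro exI[of _ ?O] exI[of _ "\<lambda>x. g (L x + c)"]) auto
qed

lemma smooth_on_inverse:
  fixes f :: "'a::euclidean_space \<Rightarrow> real"
  assumes "smooth_on S f" "\<And>x. x \<in> S \<Longrightarrow> 0 < f x"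
  shows "smooth_on S (\<lambda>x. inverse (f x))"
  by (rule smooth_on_compose[OF smooth_on_CkI[OF _ Ck_on_inverse] assms(1)])
     (use assms(2) in auto)

lemma smooth_on_sqrt:
  fixes f :: "'a::euclidean_space \<Rightarrow> real"
  assumes "smooth_on S f" "\<And>x. x \<in> S \<Longrightarrow> 0 < f x"
  shows "smooth_on S (\<lambda>x. sqrt (f x))"
  by (rule smooth_on_compose[OF smooth_on_CkI[OF _ Ck_on_sqrt] assms(1)])
     (use assms(2) in auto)

text \<open>
  Differentiation along \<open>v\<close> within \<open>S\<close> is one-sided at boundary points. It agrees with the directional
  derivative of any local extension as soon as the line through \<open>z\<close> accumulates at \<open>z\<close> inside \<open>S\<close>, and
  the latter is smooth on an open set. The function \<open>p\<close> records the coordinate along \<open>v\<close>, so that the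
  curve \<open>\<tau> \<mapsto> z + (\<tau> - p z) v\<close> simply replaces this coordinate of \<open>z\<close> by \<open>\<tau>\<close>.
\<close>

lemma smooth_on_directional:
  fixes S :: "'a::euclidean_space set" and f :: "'a \<Rightarrow> real" and p :: "'a \<Rightarrow> real"
  assumes f: "smooth_on S f"
    and nontriv: "\<And>z. z \<in> S \<Longrightarrow> at (p z) within {\<tau>. z + (\<tau> - p z) *\<^sub>R v \<in> S} \<noteq> bot"
  defines "D \<equiv> \<lambda>z. vector_derivative (\<lambda>\<tau>. f (z + (\<tau> - p z) *\<^sub>R v))
                 (at (p z) within {\<tau>. z + (\<tau> - p z) *\<^sub>R v \<in> S})"
  shows "smooth_on S D"
    and "\<And>z. z \<in> S \<Longrightarrow> ((\<lambda>\<tau>. f (z + (\<tau> - p z) *\<^sub>R v)) has_real_derivative D z)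
                 (at (p z) within {\<tau>. z + (\<tau> - p z) *\<^sub>R v \<in> S})"
proof -
  have loc: "\<exists>U g. open U \<and> x \<in> U \<and> (\<forall>k. Ck_on k U g) \<and> (\<forall>z\<in>S \<inter> U. g z = D z \<and>
     ((\<lambda>\<tau>. f (z + (\<tau> - p z) *\<^sub>R v)) has_vector_derivative D z)
                 (at (p z) within {\<tau>. z + (\<tau> - p z) *\<^sub>R v \<in> S}))" if x: "x \<in> S" for x
  proof -
    obtain U g where U: "open U" "x \<in> U" "\<And>k. Ck_on k U g" "\<And>y. y \<in> S \<Longrightarrow> y \<in> U \<Longrightarrow> g y = f y"
      using smooth_onE[OF f x] by blast
    obtain g' where g': "\<And>x. x \<in> U \<Longrightarrow> (g has_derivative g' x) (at x)"
      "\<And>k v. Ck_on k U (\<lambda>x. g' x v)"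
      using Cinf_deriv[OF U(1,3)] by blast
    have *: "((\<lambda>\<tau>. f (z + (\<tau> - p z) *\<^sub>R v)) has_vector_derivative g' z v)
                 (at (p z) within {\<tau>. z + (\<tau> - p z) *\<^sub>R v \<in> S})" (is "(_ has_vector_derivative _) (at _ within ?J)")
      if z: "z \<in> S" "z \<in> U" for z
    proof -
      let ?\<gamma> = "\<lambda>\<tau>. z + (\<tau> - p z) *\<^sub>R v"
      have "(?\<gamma> has_derivative (\<lambda>h. h *\<^sub>R v)) (at (p z))"
        by (auto intro!: derivative_eq_intros)
      then have "((\<lambda>\<tau>. g (?\<gamma> \<tau>)) has_derivative (\<lambda>h. g' z (h *\<^sub>R v))) (at (p z))"
        using has_derivative_compose[of ?\<gamma> "\<lambda>h. h *\<^sub>R v" "p z" UNIV g "g' z"] g'(1)[OF z(2)] by simp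
      moreover have "linear (g' z)" using g'(1)[OF z(2)] has_derivative_linear by blast
      ultimately have "((\<lambda>\<tau>. g (?\<gamma> \<tau>)) has_vector_derivative g' z v) (at (p z))"
        by (simp add: has_vector_derivative_def linear_cmul)
      then have 1: "((\<lambda>\<tau>. g (?\<gamma> \<tau>)) has_vector_derivative g' z v) (at (p z) within ?J)"
        by (rule has_vector_derivative_at_within)
      have "open (?\<gamma> -` U)"
        by (rule open_vimage[OF U(1)]) (intro continuous_intros)
      then obtain d where d: "d > 0" "ball (p z) d \<subseteq> ?\<gamma> -` U"
        using z(2) openE[of "?\<gamma> -` U" "p z"] by auto
      show ?thesis
        by (rule has_vector_derivative_transform_within[OF 1 d(1)])
           (use z U(4) d(2) in \<open>auto simp: dist_commute mem_ball subset_iff\<close>)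
    qed
    have "g' z v = D z" if "z \<in> S" "z \<in> U" for z
      unfolding D_def by (rule vector_derivative_within[OF nontriv *, symmetric]) (fact that)+
    with * U g'(2) show ?thesis by (intro exI[of _ U] exI[of _ "\<lambda>x. g' x v"]) auto
  qed
  show "smooth_on S D"
  proof (rule smooth_onI)
    fix x assume "x \<in> S"
    from loc[OF this] obtain U g where "open U" "x \<in> U" "\<forall>k. Ck_on k U g" "\<forall>z\<in>S \<inter> U. g z = D z"
      by auto
    then show "\<exists>U g. open U \<and> x \<in> U \<and> (\<forall>k. Ck_on k U g) \<and> (\<forall>z\<in>S \<inter> U. g z = D z)"
      by (intro exI[of _ U] exI[of _ g]) simp
  qed
  show "((\<lambda>\<tau>. f (z + (\<tau> - p z) *\<^sub>R v)) has_real_derivative D z)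
                 (at (p z) within {\<tau>. z + (\<tau> - p z) *\<^sub>R v \<in> S})" if "z \<in> S" for z
    using loc[OF that] that unfolding has_real_derivative_iff_has_vector_derivative by blast
qed

lemma smooth_on_deriv:
  fixes f :: "real \<Rightarrow> real"
  assumes "smooth_on S f" "open S"
  shows "smooth_on S (deriv f)" and "\<And>x. x \<in> S \<Longrightarrow> (f has_real_derivative deriv f x) (at x)"
proof -
  have *: "at x within S = at x" if "x \<in> S" for x using assms(2) that by (rule at_within_open[rotated])
  note D = smooth_on_directional[OF assms(1), of "\<lambda>x. x" 1]
  have d: "(f has_real_derivative vector_derivative f (at x)) (at x)" if "x \<in> S" for x
    using D(2) that * by simp
  then have e: "vector_derivative f (at x) = deriv f x" if "x \<in> S" for x
    using that DERIV_imp_deriv by fastforce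
  show "(f has_real_derivative deriv f x) (at x)" if "x \<in> S" for x
    using d e that by metis
  have "smooth_on S (\<lambda>x. vector_derivative f (at x within S))"
    using D(1) * by simp
  then show "smooth_on S (deriv f)"
    by (rule smooth_on_cong[THEN iffD1, rotated]) (simp add: * e)
qed

section \<open>Intervals, partial derivatives and parameter integrals\<close>

text \<open>
  These are the parameter domains on which one-sided derivatives are unique.
\<close>

definition nontrivial_interval :: "real set \<Rightarrow> bool" where
  "nontrivial_interval J \<longleftrightarrow> is_interval J \<and> interior J \<noteq> {}"

lemma nontrivial_interval_Icc: "a < b \<Longrightarrow> nontrivial_interval {a..b}"
  by (simp add: nontrivial_interval_def is_interval_cc)

lemma nontrivial_interval_Ioo: "a < b \<Longrightarrow> nontrivial_interval {a<..<b}"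
  by (simp add: nontrivial_interval_def is_interval_oo interior_open)

lemma nontrivial_interval_convex: "nontrivial_interval J \<Longrightarrow> convex J"
  by (simp add: nontrivial_interval_def is_interval_convex)

lemma at_within_nontrivial_interval:
  assumes "nontrivial_interval J" "t \<in> J"
  shows "at t within J \<noteq> bot"
proof -
  have "J \<noteq> {x}" for x using assms(1) by (auto simp: nontrivial_interval_def)
  then have "t islimpt J"
    using connected_imp_perfect[OF convex_connected[OF nontrivial_interval_convex[OF assms(1)]] assms(2)]
    by blast
  then show ?thesis by (simp add: trivial_limit_within)
qed

lemma ddt_eq:
  assumes "nontrivial_interval J" "t \<in> J" "(f has_real_derivative d) (at t within J)"
  shows "ddt J f t = d"
  unfolding ddt_def
  by (rule vector_derivative_within[OF at_within_nontrivial_interval[OF assms(1,2)]])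
     (use assms(3) in \<open>simp add: has_real_derivative_iff_has_vector_derivative\<close>)

lemma has_real_derivative_cong_on:
  assumes "t \<in> J" "\<And>\<tau>. \<tau> \<in> J \<Longrightarrow> f \<tau> = g \<tau>" "(g has_real_derivative d) (at t within J)"
  shows "(f has_real_derivative d) (at t within J)"
  by (rule has_field_derivative_transform_within[OF assms(3) zero_less_one assms(1)])
     (simp add: assms(2))

lemma ddt_cong:
  assumes "nontrivial_interval J" "t \<in> J" "(g has_real_derivative d) (at t within J)"
    "\<And>\<tau>. \<tau> \<in> J \<Longrightarrow> f \<tau> = g \<tau>"
  shows "ddt J f t = d"
proof (rule ddt_eq[OF assms(1,2)])
  show "(f has_real_derivative d) (at t within J)"
    by (rule has_real_derivative_cong_on[OF assms(2) _ assms(3)]) (simp add: assms(4))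
qed

lemma smooth_on_ddt_fst:
  fixes f :: "real \<times> 'e::euclidean_space \<Rightarrow> real"
  assumes "smooth_on (J \<times> X) f" "nontrivial_interval J"
  shows "smooth_on (J \<times> X) (\<lambda>z. ddt J (\<lambda>\<tau>. f (\<tau>, snd z)) (fst z))"
    and "\<And>t u. t \<in> J \<Longrightarrow> u \<in> X \<Longrightarrow>
      ((\<lambda>\<tau>. f (\<tau>, u)) has_real_derivative ddt J (\<lambda>\<tau>. f (\<tau>, u)) t) (at t within J)"
proof -
  have e: "z + (\<tau> - fst z) *\<^sub>R (1, 0) = (\<tau>, snd z)" for z :: "real \<times> 'e" and \<tau>
    by (simp add: prod_eq_iff)
  have s: "{\<tau>. (\<tau>, snd z) \<in> J \<times> X} = J" if "z \<in> J \<times> X" for z using that by auto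
  note D = smooth_on_directional[OF assms(1), of fst "(1, 0)", unfolded e]
  have n: "at (fst z) within {\<tau>. (\<tau>, snd z) \<in> J \<times> X} \<noteq> bot" if "z \<in> J \<times> X" for z
    unfolding s[OF that] by (rule at_within_nontrivial_interval[OF assms(2)]) (use that in auto)
  show "smooth_on (J \<times> X) (\<lambda>z. ddt J (\<lambda>\<tau>. f (\<tau>, snd z)) (fst z))"
    by (rule smooth_on_cong[THEN iffD1, OF _ D(1)[OF n]]) (simp_all only: s ddt_def)
  show "((\<lambda>\<tau>. f (\<tau>, u)) has_real_derivative ddt J (\<lambda>\<tau>. f (\<tau>, u)) t) (at t within J)"
    if "t \<in> J" "u \<in> X" for t u
  proof -
    have z: "(t, u) \<in> J \<times> X" using that by simp
    from D(2)[OF n z] show ?thesis unfolding s[OF z] ddt_def by simp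
  qed
qed

lemma smooth_on_real_ddt:
  fixes f :: "real \<Rightarrow> real"
  assumes "smooth_on J f" "nontrivial_interval J"
  shows "smooth_on J (ddt J f)"
    and "\<And>t. t \<in> J \<Longrightarrow> (f has_real_derivative ddt J f t) (at t within J)"
proof -
  have "smooth_on (J \<times> (UNIV::real set)) (\<lambda>z. f (fst z))"
    using smooth_on_affine[OF assms(1) bounded_linear_fst, of "J \<times> UNIV" 0] by auto
  note D = smooth_on_ddt_fst[OF this assms(2), simplified]
  show "smooth_on J (ddt J f)"
    using smooth_on_affine[OF D(1), of "\<lambda>t. (t, 0)" J 0]
    by (simp add: bounded_linear_Pair bounded_linear_ident)
  show "(f has_real_derivative ddt J f t) (at t within J)" if "t \<in> J" for t
    using D(2) that by simp
qed

lemma smooth_on_rectangle: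
  fixes f :: "(real \<times> real) \<times> 'e::euclidean_space \<Rightarrow> real"
  assumes "smooth_on ((D \<times> E) \<times> X) f"
  shows "nontrivial_interval D \<Longrightarrow>
           smooth_on ((D \<times> E) \<times> X) (\<lambda>z. ddt D (\<lambda>e. f ((e, snd (fst z)), snd z)) (fst (fst z)))"
    and "nontrivial_interval E \<Longrightarrow>
           smooth_on ((D \<times> E) \<times> X) (\<lambda>z. ddt E (\<lambda>t. f ((fst (fst z), t), snd z)) (snd (fst z)))"
proof -
  assume D: "nontrivial_interval D"
  have e: "z + (\<tau> - fst (fst z)) *\<^sub>R ((1, 0), 0) = ((\<tau>, snd (fst z)), snd z)"
    for z :: "(real \<times> real) \<times> 'e" and \<tau>
    by (simp add: prod_eq_iff)
  have s: "{\<tau>. ((\<tau>, snd (fst z)), snd z) \<in> (D \<times> E) \<times> X} = D" if "z \<in> (D \<times> E) \<times> X" for z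
    using that by auto
  note DD = smooth_on_directional[OF assms(1), of "\<lambda>z. fst (fst z)" "((1, 0), 0)", unfolded e]
  have n: "at (fst (fst z)) within {\<tau>. ((\<tau>, snd (fst z)), snd z) \<in> (D \<times> E) \<times> X} \<noteq> bot"
    if "z \<in> (D \<times> E) \<times> X" for z
    unfolding s[OF that] by (rule at_within_nontrivial_interval[OF D]) (use that in auto)
  show "smooth_on ((D \<times> E) \<times> X) (\<lambda>z. ddt D (\<lambda>e. f ((e, snd (fst z)), snd z)) (fst (fst z)))"
    by (rule smooth_on_cong[THEN iffD1, OF _ DD(1)[OF n]]) (simp_all only: s ddt_def)
next
  assume E: "nontrivial_interval E"
  have e: "z + (\<tau> - snd (fst z)) *\<^sub>R ((0, 1), 0) = ((fst (fst z), \<tau>), snd z)"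
    for z :: "(real \<times> real) \<times> 'e" and \<tau>
    by (simp add: prod_eq_iff)
  have s: "{\<tau>. ((fst (fst z), \<tau>), snd z) \<in> (D \<times> E) \<times> X} = E" if "z \<in> (D \<times> E) \<times> X" for z
    using that by auto
  note DD = smooth_on_directional[OF assms(1), of "\<lambda>z. snd (fst z)" "((0, 1), 0)", unfolded e]
  have n: "at (snd (fst z)) within {\<tau>. ((fst (fst z), \<tau>), snd z) \<in> (D \<times> E) \<times> X} \<noteq> bot"
    if "z \<in> (D \<times> E) \<times> X" for z
    unfolding s[OF that] by (rule at_within_nontrivial_interval[OF E]) (use that in auto)
  show "smooth_on ((D \<times> E) \<times> X) (\<lambda>z. ddt E (\<lambda>t. f ((fst (fst z), t), snd z)) (snd (fst z)))"
    by (rule smooth_on_cong[THEN iffD1, OF _ DD(1)[OF n]]) (simp_all only: s ddt_def)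
qed

lemma smooth_on_real_rectangle:
  fixes f :: "real \<times> real \<Rightarrow> real"
  assumes "smooth_on (D \<times> E) f"
  shows "nontrivial_interval D \<Longrightarrow> smooth_on (D \<times> E) (\<lambda>z. ddt D (\<lambda>e. f (e, snd z)) (fst z))"
    and "nontrivial_interval E \<Longrightarrow> smooth_on (D \<times> E) (\<lambda>z. ddt E (\<lambda>t. f (fst z, t)) (snd z))"
proof -
  have *: "smooth_on ((D \<times> E) \<times> (UNIV::real set)) (\<lambda>z. f (fst z))"
    using smooth_on_affine[OF assms(1) bounded_linear_fst, of "(D \<times> E) \<times> UNIV" 0] by auto
  have l: "bounded_linear (\<lambda>z::real \<times> real. (z, 0::real))"
    by (simp add: bounded_linear_Pair bounded_linear_ident)
  show "nontrivial_interval D \<Longrightarrow> smooth_on (D \<times> E) (\<lambda>z. ddt D (\<lambda>e. f (e, snd z)) (fst z))"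
    using smooth_on_affine[OF smooth_on_rectangle(1)[OF *] l, of "D \<times> E" 0] by auto
  show "nontrivial_interval E \<Longrightarrow> smooth_on (D \<times> E) (\<lambda>z. ddt E (\<lambda>t. f (fst z, t)) (snd z))"
    using smooth_on_affine[OF smooth_on_rectangle(2)[OF *] l, of "D \<times> E" 0] by auto
qed

lemma smooth_on_rectangle_slice:
  assumes "smooth_on (D \<times> E) (f :: real \<times> real \<Rightarrow> real)"
  shows "t \<in> E \<Longrightarrow> smooth_on D (\<lambda>\<epsilon>. f (\<epsilon>, t))" "\<epsilon> \<in> D \<Longrightarrow> smooth_on E (\<lambda>t. f (\<epsilon>, t))"
  using smooth_on_affine[OF assms, of "\<lambda>\<epsilon>. (\<epsilon>, 0)" D "(0, t)"]
    smooth_on_affine[OF assms, of "\<lambda>t. (0, t)" E "(\<epsilon>, 0)"]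
  by (auto simp: bounded_linear_Pair bounded_linear_ident)

text \<open>
  By the fundamental theorem \<open>f(e, t) - f(e, a)\<close> is the integral of \<open>f\<^sub>t(e, \<cdot>)\<close> over \<open>[a, t]\<close>.
  Differentiating in \<open>e\<close> under the integral and then in \<open>t\<close> by the fundamental theorem again yields
  \<open>f\<^sub>e\<^sub>t = f\<^sub>t\<^sub>e\<close>. All derivatives may be one-sided, so the endpoints of the intervals are covered.
\<close>

lemma mixed_partials:
  fixes f :: "real \<times> real \<Rightarrow> real"
  assumes f: "smooth_on (D \<times> {a..b}) f" and D: "nontrivial_interval D" and "a < b"
    and \<epsilon>: "\<epsilon> \<in> D" and t: "t \<in> {a..b}"
  shows "ddt D (\<lambda>e. ddt {a..b} (\<lambda>\<tau>. f (e, \<tau>)) t) \<epsilon> = ddt {a..b} (\<lambda>\<tau>. ddt D (\<lambda>e. f (e, \<tau>)) \<epsilon>) t"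
proof -
  define ft where "ft = (\<lambda>z. ddt {a..b} (\<lambda>\<tau>. f (fst z, \<tau>)) (snd z))"
  define fte where "fte = (\<lambda>z. ddt D (\<lambda>e. ft (e, snd z)) (fst z))"
  have E: "nontrivial_interval {a..b}" using \<open>a < b\<close> by (rule nontrivial_interval_Icc)
  have sft: "smooth_on (D \<times> {a..b}) ft"
    unfolding ft_def by (rule smooth_on_real_rectangle(2)[OF f E])
  have sfte: "smooth_on (D \<times> {a..b}) fte"
    unfolding fte_def by (rule smooth_on_real_rectangle(1)[OF sft D])
  have dt: "((\<lambda>\<tau>. f (e, \<tau>)) has_real_derivative ft (e, \<tau>)) (at \<tau> within {a..b})"
    if "e \<in> D" "\<tau> \<in> {a..b}" for e \<tau>
    using smooth_on_real_ddt(2)[OF smooth_on_rectangle_slice(2)[OF f that(1)] E that(2)]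
    by (simp add: ft_def)
  have dte: "((\<lambda>e. ft (e, \<tau>)) has_real_derivative fte (e, \<tau>)) (at e within D)"
    if "e \<in> D" "\<tau> \<in> {a..b}" for e \<tau>
    using smooth_on_real_ddt(2)[OF smooth_on_rectangle_slice(1)[OF sft that(2)] D that(1)]
    by (simp add: fte_def)
  have ftc: "integral {a..\<tau>} (\<lambda>s. ft (e, s)) = f (e, \<tau>) - f (e, a)" if "e \<in> D" "\<tau> \<in> {a..b}" for e \<tau>
  proof (rule integral_unique, rule fundamental_theorem_of_calculus)
    show "a \<le> \<tau>" using that by simp
    show "((\<lambda>s. f (e, s)) has_vector_derivative ft (e, s)) (at s within {a..\<tau>})"
      if "s \<in> {a..\<tau>}" for s
      unfolding has_real_derivative_iff_has_vector_derivative[symmetric]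
      by (rule has_field_derivative_subset[OF dt]) (use that \<open>e \<in> D\<close> \<open>\<tau> \<in> {a..b}\<close> in auto)
  qed
  have cfte: "continuous_on (D \<times> {a..b}) fte" by (rule smooth_on_continuous[OF sfte])
  have leib: "((\<lambda>e. f (e, \<tau>) - f (e, a)) has_real_derivative integral {a..\<tau>} (\<lambda>s. fte (\<epsilon>, s)))
      (at \<epsilon> within D)" if \<tau>: "\<tau> \<in> {a..b}" for \<tau>
  proof (rule has_real_derivative_cong_on[OF \<epsilon>])
    show "((\<lambda>e. integral (cbox a \<tau>) (\<lambda>s. ft (e, s))) has_real_derivative
        integral {a..\<tau>} (\<lambda>s. fte (\<epsilon>, s))) (at \<epsilon> within D)"
      unfolding cbox_interval[symmetric]
    proof (rule leibniz_rule_field_derivative[OF _ _ _ \<epsilon> nontrivial_interval_convex[OF D]])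
      show "((\<lambda>e. ft (e, s)) has_real_derivative fte (e, s)) (at e within D)"
        if "e \<in> D" "s \<in> cbox a \<tau>" for e s
        using dte that \<tau> by auto
      show "(\<lambda>s. ft (e, s)) integrable_on cbox a \<tau>" if "e \<in> D" for e
        using smooth_on_continuous[OF smooth_on_rectangle_slice(2)[OF sft that]] \<tau>
        by (intro integrable_continuous) (auto elim!: continuous_on_subset)
      show "continuous_on (D \<times> cbox a \<tau>) (\<lambda>(e, s). fte (e, s))"
        using continuous_on_subset[OF cfte, of "D \<times> cbox a \<tau>"] Sigma_mono[of D D "\<lambda>_. {a..\<tau>}" "\<lambda>_. {a..b}"] \<tau>
        by simp
    qed
    show "\<And>e. e \<in> D \<Longrightarrow> f (e, \<tau>) - f (e, a) = integral (cbox a \<tau>) (\<lambda>s. ft (e, s))"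
      using ftc \<tau> by simp
  qed
  have de: "((\<lambda>e. f (e, \<tau>)) has_real_derivative ddt D (\<lambda>e. f (e, \<tau>)) \<epsilon>) (at \<epsilon> within D)"
    if "\<tau> \<in> {a..b}" for \<tau>
    by (rule smooth_on_real_ddt(2)[OF smooth_on_rectangle_slice(1)[OF f that] D \<epsilon>])
  have eq: "ddt D (\<lambda>e. f (e, \<tau>)) \<epsilon> = integral {a..\<tau>} (\<lambda>s. fte (\<epsilon>, s)) + ddt D (\<lambda>e. f (e, a)) \<epsilon>"
    if "\<tau> \<in> {a..b}" for \<tau>
  proof -
    have "a \<in> {a..b}" using \<open>a < b\<close> by simp
    from DERIV_add[OF leib[OF that] de[OF this]] show ?thesis
      by (intro ddt_eq[OF D \<epsilon>]) simp
  qed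
  have cslice: "continuous_on {a..b} (\<lambda>s. fte (\<epsilon>, s))"
    by (rule smooth_on_continuous[OF smooth_on_rectangle_slice(2)[OF sfte \<epsilon>]])
  have "((\<lambda>\<tau>. integral {a..\<tau>} (\<lambda>s. fte (\<epsilon>, s)) + ddt D (\<lambda>e. f (e, a)) \<epsilon>)
      has_real_derivative fte (\<epsilon>, t)) (at t within {a..b})"
    using integral_has_real_derivative[OF cslice t] by (auto intro!: derivative_eq_intros)
  from ddt_cong[OF E t this eq] show ?thesis by (simp add: fte_def ft_def)
qed

lemma (in finite_measure) integral_continuous_uniform:
  fixes f :: "'p::metric_space \<Rightarrow> 'a \<Rightarrow> real"
  assumes int: "\<And>t. t \<in> T \<Longrightarrow> integrable M (f t)" and t0: "t0 \<in> T"
    and unif: "\<And>e. e > 0 \<Longrightarrow> \<exists>d>0. \<forall>t\<in>T. dist t t0 < d \<longrightarrow> (\<forall>x\<in>space M. \<bar>f t x - f t0 x\<bar> \<le> e)"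
  shows "continuous (at t0 within T) (\<lambda>t. \<integral>x. f t x \<partial>M)"
  unfolding continuous_within_eps_delta
proof (intro allI impI)
  fix e :: real assume "e > 0"
  define m where "m = measure M (space M)"
  have m: "0 \<le> m" by (simp add: m_def)
  define e' where "e' = e / (m + 1)"
  have e': "e' > 0" "e' * m < e" using \<open>e > 0\<close> m by (auto simp: e'_def field_simps)
  obtain d where d: "d > 0" "\<And>t x. t \<in> T \<Longrightarrow> dist t t0 < d \<Longrightarrow> x \<in> space M \<Longrightarrow> \<bar>f t x - f t0 x\<bar> \<le> e'"
    using unif[OF e'(1)] by blast
  have "dist (\<integral>x. f t x \<partial>M) (\<integral>x. f t0 x \<partial>M) < e" if t: "t \<in> T" "dist t t0 < d" for t
  proof -
    have "\<bar>(\<integral>x. f t x \<partial>M) - (\<integral>x. f t0 x \<partial>M)\<bar> = \<bar>\<integral>x. f t x - f t0 x \<partial>M\<bar>"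
      using int t t0 by simp
    also have "\<dots> \<le> (\<integral>x. \<bar>f t x - f t0 x\<bar> \<partial>M)" by (rule integral_abs_bound)
    also have "\<dots> \<le> (\<integral>x. e' \<partial>M)"
      by (rule integral_mono) (use int t t0 d in auto)
    also have "\<dots> = e' * m" by (simp add: m_def)
    finally show ?thesis using e'(2) by (simp add: dist_real_def)
  qed
  with d(1) show "\<exists>d>0. \<forall>x'\<in>T. dist x' t0 < d \<longrightarrow>
      dist (\<integral>x. f x' x \<partial>M) (\<integral>x. f t0 x \<partial>M) < e" by blast
qed

text \<open>
  The mean value theorem bounds the error of the linear approximation of \<open>f \<cdot> x\<close> at \<open>t0\<close> by
  \<open>\<bar>t - t0\<bar>\<close> times the oscillation of \<open>f'\<close>, which is small uniformly in \<open>x\<close>; a finite measure preserves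
  the bound. The hypotheses avoid a topology on the measure space, so that the result applies both on the
  manifold and on a Borel piece of it.
\<close>

lemma (in finite_measure) integral_has_derivative_uniform:
  fixes f f' :: "real \<Rightarrow> 'a \<Rightarrow> real"
  assumes J: "convex J" "t0 \<in> J"
    and int: "\<And>t. t \<in> J \<Longrightarrow> integrable M (f t)" "integrable M (f' t0)"
    and deriv: "\<And>t x. t \<in> J \<Longrightarrow> x \<in> space M \<Longrightarrow>
      ((\<lambda>\<tau>. f \<tau> x) has_real_derivative f' t x) (at t within J)"
    and unif: "\<And>e. e > 0 \<Longrightarrow> \<exists>d>0. \<forall>t\<in>J. dist t t0 < d \<longrightarrow> (\<forall>x\<in>space M. \<bar>f' t x - f' t0 x\<bar> \<le> e)"
  shows "((\<lambda>t. \<integral>x. f t x \<partial>M) has_real_derivative (\<integral>x. f' t0 x \<partial>M)) (at t0 within J)"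
  unfolding has_field_derivative_def has_derivative_within_alt
proof (intro conjI allI impI)
  show "bounded_linear ((*) (\<integral>x. f' t0 x \<partial>M))" by (rule bounded_linear_mult_right)
  fix e :: real assume "e > 0"
  define m where "m = measure M (space M)"
  have m: "0 \<le> m" by (simp add: m_def)
  define e' where "e' = e / (m + 1)"
  have e': "e' > 0" "e' * m \<le> e" using \<open>e > 0\<close> m by (auto simp: e'_def field_simps)
  obtain d where d: "d > 0" "\<And>t x. t \<in> J \<Longrightarrow> dist t t0 < d \<Longrightarrow> x \<in> space M \<Longrightarrow> \<bar>f' t x - f' t0 x\<bar> \<le> e'"
    using unif[OF e'(1)] by blast
  have "norm ((\<integral>x. f y x \<partial>M) - (\<integral>x. f t0 x \<partial>M) - (\<integral>x. f' t0 x \<partial>M) * (y - t0)) \<le> e * norm (y - t0)"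
    if y: "y \<in> J" "norm (y - t0) < d" for y
  proof -
    have cv: "convex (J \<inter> ball t0 d)" using J by (simp add: convex_Int)
    have bd: "\<bar>f y x - f t0 x - (y - t0) * f' t0 x\<bar> \<le> \<bar>y - t0\<bar> * e'" if x: "x \<in> space M" for x
    proof -
      have "norm (f y x - f t0 x - (y - t0) *\<^sub>R f' t0 x) \<le> norm (y - t0) * e'"
      proof (rule vector_differentiable_bound_linearization[where S = "J \<inter> ball t0 d" and f' = "\<lambda>t. f' t x"])
        show "((\<lambda>\<tau>. f \<tau> x) has_vector_derivative f' t x) (at t within J \<inter> ball t0 d)"
          if "t \<in> J \<inter> ball t0 d" for t
          unfolding has_real_derivative_iff_has_vector_derivative[symmetric]
          by (rule has_field_derivative_subset[OF deriv]) (use that x in auto)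
        show "closed_segment t0 y \<subseteq> J \<inter> ball t0 d"
          using cv J(2) y d(1) by (intro closed_segment_subset) (auto simp: dist_norm norm_minus_commute)
        show "norm (f' t x - f' t0 x) \<le> e'" if "t \<in> J \<inter> ball t0 d" for t
          using d(2)[of t x] that x by (auto simp: dist_commute)
        show "t0 \<in> J \<inter> ball t0 d" using J(2) d(1) by simp
      qed
      then show ?thesis by simp
    qed
    have "\<bar>(\<integral>x. f y x \<partial>M) - (\<integral>x. f t0 x \<partial>M) - (\<integral>x. f' t0 x \<partial>M) * (y - t0)\<bar>
        = \<bar>\<integral>x. f y x - f t0 x - (y - t0) * f' t0 x \<partial>M\<bar>"
      using int y J by (simp add: mult.commute)
    also have "\<dots> \<le> (\<integral>x. \<bar>f y x - f t0 x - (y - t0) * f' t0 x\<bar> \<partial>M)" by (rule integral_abs_bound)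
    also have "\<dots> \<le> (\<integral>x. \<bar>y - t0\<bar> * e' \<partial>M)"
      by (rule integral_mono) (use int y J bd in auto)
    also have "\<dots> = \<bar>y - t0\<bar> * (e' * m)" by (simp add: m_def)
    also have "\<dots> \<le> \<bar>y - t0\<bar> * e" using e'(2) by (intro mult_left_mono) auto
    finally show ?thesis by (simp add: mult.commute)
  qed
  with d(1) show "\<exists>d>0. \<forall>y\<in>J. norm (y - t0) < d \<longrightarrow>
      norm ((\<integral>x. f y x \<partial>M) - (\<integral>x. f t0 x \<partial>M) - (\<integral>x. f' t0 x \<partial>M) * (y - t0)) \<le> e * norm (y - t0)"
    by blast
qed

text \<open>
  Every order of differentiation replaces \<open>g\<close> by its partial derivative in the parameter, which satisfies
  the same hypotheses.
\<close>

lemma (in finite_measure) Ck_on_integral: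
  fixes g :: "real \<times> 'e::euclidean_space \<Rightarrow> real" and \<kappa> :: "'a \<Rightarrow> 'e"
  assumes O: "open O'" "\<And>k. Ck_on k O' g" and B: "open B" "convex B" "B \<times> K \<subseteq> O'" and K: "compact K"
    and Y: "Y \<in> sets M" "\<kappa> ` Y \<subseteq> K"
    and meas: "\<And>h. continuous_on K h \<Longrightarrow> (\<lambda>y. indicator Y y * h (\<kappa> y) :: real) \<in> borel_measurable M"
  shows "Ck_on k B (\<lambda>t. \<integral>y. indicator Y y * g (t, \<kappa> y) \<partial>M)"
  using O(2)
proof (induction k arbitrary: g)
  have cont: "continuous_on (B \<times> K) g" if "\<And>k. Ck_on k O' g" for g :: "real \<times> 'e \<Rightarrow> real"
    by (rule continuous_on_subset[OF Ck_on_continuous[OF that[of 0]] B(3)])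
  have int: "integrable M (\<lambda>y. indicator Y y * g (t, \<kappa> y))"
    if g: "\<And>k. Ck_on k O' g" and t: "t \<in> B" for g :: "real \<times> 'e \<Rightarrow> real" and t
  proof -
    have c: "continuous_on K (\<lambda>u. g (t, u))"
      by (rule continuous_on_compose2[OF cont[OF g]]) (use t in \<open>auto intro!: continuous_intros\<close>)
    obtain b0 where b0: "\<And>u. u \<in> K \<Longrightarrow> \<bar>g (t, u)\<bar> \<le> b0"
      using compact_imp_bounded[OF compact_continuous_image[OF c K]] unfolding bounded_iff by auto
    define b where "b = max b0 0"
    have b: "\<And>u. u \<in> K \<Longrightarrow> \<bar>g (t, u)\<bar> \<le> b" "0 \<le> b"
      using b0 by (auto simp: b_def intro: max.coboundedI1)
    show ?thesis
      by (rule integrable_const_bound[where B = b])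
         (use b Y meas[OF c] in \<open>auto simp: indicator_def\<close>)
  qed
  have unif: "\<exists>d>0. \<forall>t\<in>B. dist t t0 < d \<longrightarrow>
      (\<forall>y\<in>space M. \<bar>indicator Y y * g (t, \<kappa> y) - indicator Y y * g (t0, \<kappa> y)\<bar> \<le> e)"
    if g: "\<And>k. Ck_on k O' g" and t0: "t0 \<in> B" and e: "e > 0"
    for g :: "real \<times> 'e \<Rightarrow> real" and t0 e
  proof -
    obtain X0 where X0: "t0 \<in> X0" "open X0"
      "\<forall>x\<in>X0 \<inter> B. \<forall>u\<in>K. dist (g (x, u)) (g (t0, u)) \<le> e"
      using continuous_on_prod_compactE[OF cont[OF g] K t0 e] by blast
    obtain d where d: "d > 0" "\<And>t. dist t t0 < d \<Longrightarrow> t \<in> X0"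
      using X0(1,2) unfolding open_dist by blast
    show ?thesis
      using d X0(3) Y(2) e by (intro exI[of _ d]) (auto simp: indicator_def dist_real_def)
  qed
  {
    case 0
    show ?case unfolding Ck_on.simps continuous_on_eq_continuous_within
      by (intro ballI integral_continuous_uniform int[OF 0] unif[OF 0])
  next
    case (Suc k)
    obtain g' where g': "\<And>x. x \<in> O' \<Longrightarrow> (g has_derivative g' x) (at x)"
      "\<And>k v. Ck_on k O' (\<lambda>x. g' x v)"
      using Cinf_deriv[OF O(1) Suc.prems] by blast
    let ?h = "\<lambda>z. g' z (1, 0)"
    have d: "((\<lambda>t. indicator Y y * g (t, \<kappa> y)) has_real_derivative indicator Y y * ?h (t, \<kappa> y))
        (at t within B)" if "t \<in> B" for t y
    proof (cases "y \<in> Y")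
      case True
      then have "(t, \<kappa> y) \<in> O'" using that Y(2) B(3) by auto
      note gd = g'(1)[OF this]
      have "((\<lambda>t. g (t, \<kappa> y)) has_derivative (\<lambda>h. g' (t, \<kappa> y) (h, 0))) (at t)"
        by (rule has_derivative_compose[of "\<lambda>t. (t, \<kappa> y)" "\<lambda>h. (h, 0)" t UNIV g, OF _ gd])
           (auto intro!: derivative_eq_intros)
      moreover have "(\<lambda>h. g' (t, \<kappa> y) (h, 0)) = (*) (?h (t, \<kappa> y))"
      proof
        show "g' (t, \<kappa> y) (h, 0) = ?h (t, \<kappa> y) * h" for h
          using linear_cmul[OF has_derivative_linear[OF gd], of h "(1, 0)"] by simp
      qed
      ultimately have "((\<lambda>t. g (t, \<kappa> y)) has_real_derivative ?h (t, \<kappa> y)) (at t)"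
        by (simp only: has_field_derivative_def)
      then show ?thesis using True by (simp add: has_field_derivative_at_within)
    qed simp
    show ?case
    proof (rule Ck_on_SucI_real)
      show "Ck_on k B (\<lambda>t. \<integral>y. indicator Y y * ?h (t, \<kappa> y) \<partial>M)"
        by (rule Suc.IH[OF g'(2)])
      show "((\<lambda>t. \<integral>y. indicator Y y * g (t, \<kappa> y) \<partial>M) has_real_derivative
          (\<integral>y. indicator Y y * ?h (t, \<kappa> y) \<partial>M)) (at t)" if t: "t \<in> B" for t
        unfolding at_within_open[OF t B(1), symmetric]
        by (rule integral_has_derivative_uniform[OF B(2) t int[OF Suc.prems] int[OF g'(2) t] d
              unif[OF g'(2) t]])
    qed
  }
qed

section \<open>Smooth families on a compact manifold with a density\<close>

lemma smooth_family_iff: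
  "smooth_family \<A> T \<phi> \<longleftrightarrow> (\<forall>U \<kappa>. (U, \<kappa>) \<in> \<A> \<longrightarrow>
     smooth_on (T \<times> \<kappa> ` U) (\<lambda>z. \<phi> (fst z) (inv_into U \<kappa> (snd z))))"
  by (auto simp: smooth_family_def case_prod_beta')

lemma smooth_family_cong:
  assumes "\<And>p x. p \<in> T \<Longrightarrow> \<phi> p x = \<psi> p x" "smooth_family \<A> T \<psi>"
  shows "smooth_family \<A> T \<phi>"
  unfolding smooth_family_iff
proof (intro allI impI)
  fix U \<kappa> assume "(U, \<kappa>) \<in> \<A>"
  then have "smooth_on (T \<times> \<kappa> ` U) (\<lambda>z. \<psi> (fst z) (inv_into U \<kappa> (snd z)))"
    using assms(2) by (simp add: smooth_family_iff)
  then show "smooth_on (T \<times> \<kappa> ` U) (\<lambda>z. \<phi> (fst z) (inv_into U \<kappa> (snd z)))"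
    by (rule smooth_on_cong[THEN iffD1, rotated]) (auto simp: assms(1))
qed

lemma smooth_family_add:
  "smooth_family \<A> T \<phi> \<Longrightarrow> smooth_family \<A> T \<psi> \<Longrightarrow> smooth_family \<A> T (\<lambda>p x. \<phi> p x + \<psi> p x)"
  by (simp add: smooth_family_iff smooth_on_add)

lemma smooth_family_mult:
  "smooth_family \<A> T \<phi> \<Longrightarrow> smooth_family \<A> T \<psi> \<Longrightarrow> smooth_family \<A> T (\<lambda>p x. \<phi> p x * \<psi> p x)"
  by (simp add: smooth_family_iff smooth_on_mult)

lemma smooth_family_param:
  assumes "smooth_on T r"
  shows "smooth_family \<A> T (\<lambda>p x. r p)"
  unfolding smooth_family_iff
proof (intro allI impI)
  fix U and \<kappa> :: "'b \<Rightarrow> 'c"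
  show "smooth_on (T \<times> \<kappa> ` U) (\<lambda>z. r (fst z))"
    using smooth_on_affine[OF assms bounded_linear_fst, of "T \<times> \<kappa> ` U" 0] by auto
qed

lemma smooth_family_sqrt:
  assumes "smooth_family \<A> T \<phi>" "\<And>p x. p \<in> T \<Longrightarrow> 0 < \<phi> p x"
  shows "smooth_family \<A> T (\<lambda>p x. sqrt (\<phi> p x))"
  using assms by (auto simp: smooth_family_iff intro!: smooth_on_sqrt)

lemma smooth_family_affine:
  assumes "smooth_family \<A> S \<phi>" "bounded_linear L" "\<And>p. p \<in> T \<Longrightarrow> L p + c \<in> S"
  shows "smooth_family \<A> T (\<lambda>p. \<phi> (L p + c))"
  unfolding smooth_family_iff
proof (intro allI impI)
  fix U \<kappa> assume "(U, \<kappa>) \<in> \<A>"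
  then have s: "smooth_on (S \<times> \<kappa> ` U) (\<lambda>z. \<phi> (fst z) (inv_into U \<kappa> (snd z)))"
    using assms(1) by (simp add: smooth_family_iff)
  have "bounded_linear (\<lambda>z. (L (fst z), snd z))"
    by (intro bounded_linear_Pair bounded_linear_snd bounded_linear_compose[OF assms(2)] bounded_linear_fst)
  from smooth_on_affine[OF s this, of "T \<times> \<kappa> ` U" "(c, 0)"]
  show "smooth_on (T \<times> \<kappa> ` U) (\<lambda>z. \<phi> (L (fst z) + c) (inv_into U \<kappa> (snd z)))"
    using assms(3) by auto
qed

lemma smooth_family_subset:
  assumes "smooth_family \<A> S \<phi>" "T \<subseteq> S"
  shows "smooth_family \<A> T \<phi>"
  using smooth_family_affine[OF assms(1) bounded_linear_ident, of T 0] assms(2) by auto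

lemma smooth_family_rectangle_slice:
  assumes "smooth_family \<A> (D \<times> E) (\<phi> :: real \<times> real \<Rightarrow> _)"
  shows "t \<in> E \<Longrightarrow> smooth_family \<A> D (\<lambda>\<epsilon>. \<phi> (\<epsilon>, t))" "\<epsilon> \<in> D \<Longrightarrow> smooth_family \<A> E (\<lambda>t. \<phi> (\<epsilon>, t))"
  using smooth_family_affine[OF assms, of "\<lambda>\<epsilon>. (\<epsilon>, 0)" D "(0, t)"]
    smooth_family_affine[OF assms, of "\<lambda>t. (0, t)" E "(\<epsilon>, 0)"]
  by (auto simp: bounded_linear_Pair bounded_linear_ident)

lemma smooth_family_smooth_fun:
  assumes "smooth_family \<A> T \<phi>" "p \<in> T"
  shows "smooth_fun \<A> (\<phi> p)"
  unfolding smooth_fun_def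
proof safe
  fix U \<kappa> assume "(U, \<kappa>) \<in> \<A>"
  then have s: "smooth_on (T \<times> \<kappa> ` U) (\<lambda>z. \<phi> (fst z) (inv_into U \<kappa> (snd z)))"
    using assms(1) by (simp add: smooth_family_iff)
  show "smooth_on (\<kappa> ` U) (\<phi> p \<circ> inv_into U \<kappa>)"
    using smooth_on_affine[OF s, of "\<lambda>u. (0, u)" "\<kappa> ` U" "(p, 0)"] assms(2)
    by (simp add: bounded_linear_Pair bounded_linear_ident comp_def)
qed

lemma smooth_fun_family: "smooth_fun \<A> f \<Longrightarrow> smooth_family \<A> T (\<lambda>p. f)"
  unfolding smooth_fun_def smooth_family_iff
proof (intro allI impI)
  fix U \<kappa> assume "\<forall>(U, \<kappa>)\<in>\<A>. smooth_on (\<kappa> ` U) (f \<circ> inv_into U \<kappa>)" "(U, \<kappa>) \<in> \<A>"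
  then have "smooth_on (\<kappa> ` U) (f \<circ> inv_into U \<kappa>)" by blast
  from smooth_on_affine[OF this bounded_linear_snd, of "T \<times> \<kappa> ` U" 0]
  show "smooth_on (T \<times> \<kappa> ` U) (\<lambda>z. f (inv_into U \<kappa> (snd z)))"
    by (simp add: comp_def mem_Times_iff)
qed

text \<open>
  The time derivative is computed in each chart separately, where it is a derivative along the first factor.
\<close>

lemma smooth_family_ddtM:
  assumes "smooth_family \<A> J \<phi>" "nontrivial_interval J"
  shows "smooth_family \<A> J (ddtM J \<phi>)"
  unfolding smooth_family_iff
proof (intro allI impI)
  fix U \<kappa> assume "(U, \<kappa>) \<in> \<A>"
  then have s: "smooth_on (J \<times> \<kappa> ` U) (\<lambda>z. \<phi> (fst z) (inv_into U \<kappa> (snd z)))"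
    using assms(1) by (simp add: smooth_family_iff)
  show "smooth_on (J \<times> \<kappa> ` U) (\<lambda>z. ddtM J \<phi> (fst z) (inv_into U \<kappa> (snd z)))"
    using smooth_on_ddt_fst(1)[OF s assms(2)] by (simp add: ddtM_def)
qed

lemma smooth_family_rectangle:
  assumes "smooth_family \<A> (D \<times> E) (\<phi> :: real \<times> real \<Rightarrow> _)"
  shows "nontrivial_interval D \<Longrightarrow>
           smooth_family \<A> (D \<times> E) (\<lambda>p. ddtM D (\<lambda>e. \<phi> (e, snd p)) (fst p))"
    and "nontrivial_interval E \<Longrightarrow>
           smooth_family \<A> (D \<times> E) (\<lambda>p. ddtM E (\<lambda>t. \<phi> (fst p, t)) (snd p))"
proof -
  have s: "smooth_on ((D \<times> E) \<times> \<kappa> ` U) (\<lambda>z. \<phi> (fst z) (inv_into U \<kappa> (snd z)))"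
    if "(U, \<kappa>) \<in> \<A>" for U \<kappa>
    using assms that by (simp add: smooth_family_iff)
  show "nontrivial_interval D \<Longrightarrow>
           smooth_family \<A> (D \<times> E) (\<lambda>p. ddtM D (\<lambda>e. \<phi> (e, snd p)) (fst p))"
    using smooth_on_rectangle(1)[OF s] by (simp add: smooth_family_iff ddtM_def)
  show "nontrivial_interval E \<Longrightarrow>
           smooth_family \<A> (D \<times> E) (\<lambda>p. ddtM E (\<lambda>t. \<phi> (fst p, t)) (snd p))"
    using smooth_on_rectangle(2)[OF s] by (simp add: smooth_family_iff ddtM_def)
qed

text \<open>
  Moving a boundary point of a quadrant along the diagonal reaches its interior.
\<close>

lemma cball_in_quadrant:
  fixes q :: "'e::euclidean_space"
  assumes "\<forall>b\<in>B. 0 \<le> q \<bullet> b" "B \<subseteq> Basis" "r > 0"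
  obtains y s where "s > 0" "cball y s \<subseteq> ball q r" "cball y s \<subseteq> {u. \<forall>b\<in>B. 0 \<le> u \<bullet> b}"
proof -
  define n where "n = norm (One :: 'e)"
  have n: "0 \<le> n" by (simp add: n_def)
  \<comment> \<open>the diagonal shift has length \<open>\<eta> n\<close>, and \<open>\<eta> n + \<eta> = r / 2\<close>\<close>
  define \<eta> where "\<eta> = (r / 2) / (n + 1)"
  have "\<eta> * (n + 1) = r / 2"
    using n unfolding \<eta>_def by (intro nonzero_eq_divide_eq[THEN iffD1]) simp_all
  then have \<eta>: "\<eta> * n + \<eta> < r"
    using \<open>r > 0\<close> by (simp only: distrib_left mult_1_right)
  have \<eta>_pos: "\<eta> > 0"
    using n \<open>r > 0\<close> by (simp add: \<eta>_def)
  define y where "y = q + \<eta> *\<^sub>R (One :: 'e)"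
  show thesis
  proof (rule that[of \<eta> y])
    show "\<eta> > 0" by (rule \<eta>_pos)
    show "cball y \<eta> \<subseteq> ball q r"
    proof
      fix z assume "z \<in> cball y \<eta>"
      then have "dist q z \<le> dist q y + \<eta>"
        using dist_triangle[of q z y] by simp
      also have "dist q y = \<eta> * n"
        using \<eta>_pos by (simp add: y_def dist_norm n_def)
      finally show "z \<in> ball q r" using \<eta> by simp
    qed
    show "cball y \<eta> \<subseteq> {u. \<forall>b\<in>B. 0 \<le> u \<bullet> b}"
    proof safe
      fix z b assume z: "z \<in> cball y \<eta>" and b: "b \<in> B"
      then have "\<bar>(z - y) \<bullet> b\<bar> \<le> \<eta>"
        using Basis_le_norm[of b "z - y"] assms(2) by (auto simp: dist_norm norm_minus_commute)
      moreover have "y \<bullet> b = q \<bullet> b + \<eta>"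
        using b assms(2) by (auto simp: y_def inner_add_left inner_sum_left_Basis)
      ultimately show "0 \<le> z \<bullet> b"
        using assms(1) b by (auto simp: inner_diff_left)
    qed
  qed
qed

locale compact_density =
  fixes \<A> :: "('m::{t2_space,second_countable_topology}, 'e::euclidean_space) chart set"
    and \<mu> :: "'m measure"
  assumes manifold: "compact_manifold_with_corners \<A>"
    and density: "smooth_positive_density \<A> \<mu>"
    and mass: "emeasure \<mu> UNIV = 1"
begin

lemma sets_mu [measurable_cong]: "sets \<mu> = sets borel"
  using density by (simp add: smooth_positive_density_def)

lemma space_mu [simp]: "space \<mu> = UNIV"
  using sets_eq_imp_space_eq[OF sets_mu] by simp

sublocale finite_measure \<mu>
  by (rule finite_measureI) (simp add: mass)

lemma compact_M: "compact (UNIV :: 'm set)"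
  using manifold by (simp add: compact_manifold_with_corners_def)

lemma chartE:
  obtains U \<kappa> B where "(U, \<kappa>) \<in> \<A>" "x \<in> U" "open U" "continuous_on U \<kappa>"
    "\<And>y. y \<in> U \<Longrightarrow> inv_into U \<kappa> (\<kappa> y) = y"
    "homeomorphism U (\<kappa> ` U) \<kappa> (inv_into U \<kappa>)"
    "B \<subseteq> Basis" "openin (top_of_set {u. \<forall>b\<in>B. 0 \<le> u \<bullet> b}) (\<kappa> ` U)"
proof -
  have "x \<in> (\<Union>c\<in>\<A>. fst c)"
    using manifold unfolding compact_manifold_with_corners_def by simp
  then obtain U \<kappa> where c: "(U, \<kappa>) \<in> \<A>" "x \<in> U" by auto
  then have "corner_chart (U, \<kappa>)"
    using manifold by (auto simp: compact_manifold_with_corners_def)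
  then have h: "open U" "homeomorphism U (\<kappa> ` U) \<kappa> (inv_into U \<kappa>)"
    and "\<exists>B\<subseteq>Basis. openin (top_of_set {u. \<forall>b\<in>B. 0 \<le> u \<bullet> b}) (\<kappa> ` U)"
    by (auto simp: corner_chart_def)
  then obtain B where B: "B \<subseteq> Basis" "openin (top_of_set {u. \<forall>b\<in>B. 0 \<le> u \<bullet> b}) (\<kappa> ` U)"
    by blast
  show thesis
    by (rule that[OF c h(1) homeomorphism_cont1[OF h(2)] homeomorphism_apply1[OF h(2)] h(2) B])
qed

text \<open>
  Near any point the image of an open set in a chart contains a ball of positive Lebesgue measure, by
  \<open>cball_in_quadrant\<close> also at the boundary, and the continuous positive density is bounded below on it.
\<close>

lemma emeasure_open_pos:
  assumes N: "open N" "x \<in> N"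
  shows "0 < emeasure \<mu> N"
proof -
  obtain U \<kappa> B where c: "(U, \<kappa>) \<in> \<A>" "x \<in> U" "open U" "continuous_on U \<kappa>"
    "homeomorphism U (\<kappa> ` U) \<kappa> (inv_into U \<kappa>)"
    "B \<subseteq> Basis" "openin (top_of_set {u. \<forall>b\<in>B. 0 \<le> u \<bullet> b}) (\<kappa> ` U)"
    by (rule chartE[of x]) blast
  let ?Q = "{u. \<forall>b\<in>B. 0 \<le> u \<bullet> b}"
  define X where "X = N \<inter> U"
  have X: "open X" "X \<subseteq> U" "x \<in> X" using N c by (auto simp: X_def)
  have "openin (top_of_set (\<kappa> ` U)) (\<kappa> ` X)"
    by (rule homeomorphism_imp_open_map[OF c(5)]) (use X in \<open>simp add: open_subset\<close>)
  then have o: "openin (top_of_set ?Q) (\<kappa> ` X)" using c(7) openin_trans by blast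
  then obtain r where r: "r > 0" "ball (\<kappa> x) r \<inter> ?Q \<subseteq> \<kappa> ` X" "\<kappa> x \<in> ?Q"
    using X(3) unfolding openin_contains_ball by blast
  obtain y s where s: "s > 0" "cball y s \<subseteq> ball (\<kappa> x) r" "cball y s \<subseteq> ?Q"
  proof (rule cball_in_quadrant[OF _ c(6) r(1)])
    show "\<forall>b\<in>B. 0 \<le> \<kappa> x \<bullet> b" using r(3) by simp
  qed
  have sub: "cball y s \<subseteq> \<kappa> ` X" using s r by blast
  obtain \<rho> where \<rho>: "smooth_on (\<kappa> ` U) \<rho>" "\<forall>u\<in>\<kappa> ` U. 0 < \<rho> u"
    "\<forall>X\<in>sets borel. X \<subseteq> U \<longrightarrow> emeasure \<mu> X = (\<integral>\<^sup>+u\<in>\<kappa> ` X. ennreal (\<rho> u) \<partial>lborel)"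
    using density c(1) by (auto simp: smooth_positive_density_def)
  have sU: "cball y s \<subseteq> \<kappa> ` U" using sub X(2) by blast
  have "continuous_on (cball y s) \<rho>"
    using smooth_on_continuous[OF \<rho>(1)] sU by (rule continuous_on_subset)
  then obtain z where z: "z \<in> cball y s" "\<forall>u\<in>cball y s. \<rho> z \<le> \<rho> u"
    using continuous_attains_inf[of "cball y s" \<rho>] s(1) by auto
  have "0 < \<rho> z" using z(1) sU \<rho>(2) by blast
  moreover have "emeasure lborel (cball y s) \<noteq> 0"
  proof
    assume "emeasure lborel (cball y s) = 0"
    then have "measure lborel (cball y s) = 0" by (simp add: measure_def)
    then show False using content_cball_pos[OF s(1), of y] by simp
  qed
  ultimately have "0 < ennreal (\<rho> z) * emeasure lborel (cball y s)"
    by (simp add: ennreal_zero_less_mult_iff zero_less_iff_neq_zero)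
  also have "\<dots> = (\<integral>\<^sup>+u. ennreal (\<rho> z) * indicator (cball y s) u \<partial>lborel)"
    by (simp add: nn_integral_cmult_indicator)
  also have "\<dots> \<le> (\<integral>\<^sup>+u\<in>\<kappa> ` X. ennreal (\<rho> u) \<partial>lborel)"
    by (rule nn_integral_mono) (use sub z(2) in \<open>auto simp: indicator_def ennreal_leI\<close>)
  also have "\<dots> = emeasure \<mu> X" using \<rho>(3) X by (metis borel_open)
  also have "\<dots> \<le> emeasure \<mu> N"
    by (rule emeasure_mono) (use N in \<open>auto simp: X_def sets_mu\<close>)
  finally show ?thesis .
qed

lemma continuous_integrable [simp]:
  fixes f :: "'m \<Rightarrow> real"
  assumes "continuous_on UNIV f"
  shows "integrable \<mu> f"
proof -
  obtain b where "\<And>x. \<bar>f x\<bar> \<le> b"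
    using compact_imp_bounded[OF compact_continuous_image[OF assms compact_M]]
    unfolding bounded_iff by auto
  then show ?thesis
    by (intro integrable_const_bound[where B = b])
       (auto intro: borel_measurable_continuous_onI[OF assms] simp: measurable_cong_sets[OF sets_mu refl])
qed

lemma integral_nonneg_eq_0D:
  fixes f :: "'m \<Rightarrow> real"
  assumes "continuous_on UNIV f" "\<And>x. 0 \<le> f x" "(\<integral>x. f x \<partial>\<mu>) = 0"
  shows "f x = 0"
proof (rule ccontr)
  assume ne: "f x \<noteq> 0"
  have "AE x in \<mu>. f x = 0"
    using integral_nonneg_eq_0_iff_AE[OF continuous_integrable[OF assms(1)]] assms(2,3) by simp
  moreover have o: "open {x. f x \<noteq> 0}"
    by (rule open_Collect_neq[OF assms(1) continuous_on_const])
  ultimately have "emeasure \<mu> {x. f x \<noteq> 0} = 0"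
    by (subst (asm) AE_iff_measurable[of "{x. f x \<noteq> 0}"]) (auto simp: sets_mu)
  with emeasure_open_pos[OF o, of x] ne show False by simp
qed

lemma family_continuous:
  assumes "smooth_family \<A> T \<phi>"
  shows "continuous_on (T \<times> UNIV) (\<lambda>z. \<phi> (fst z) (snd z))"
  unfolding continuous_on_eq_continuous_within
proof safe
  fix p x assume p: "p \<in> T"
  obtain U \<kappa> B where c: "(U, \<kappa>) \<in> \<A>" "x \<in> U" "open U" "continuous_on U \<kappa>"
    "\<And>y. y \<in> U \<Longrightarrow> inv_into U \<kappa> (\<kappa> y) = y"
    by (rule chartE[of x]) blast
  have s: "continuous_on (T \<times> \<kappa> ` U) (\<lambda>z. \<phi> (fst z) (inv_into U \<kappa> (snd z)))"
    using assms c(1) by (intro smooth_on_continuous) (simp add: smooth_family_iff)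
  have "continuous_on (T \<times> U) (\<lambda>z. (fst z, \<kappa> (snd z)))"
    by (intro continuous_on_Pair continuous_on_fst continuous_on_id
        continuous_on_compose2[OF c(4)] continuous_on_snd) auto
  from continuous_on_compose2[OF s this]
  have "continuous_on (T \<times> U) (\<lambda>z. \<phi> (fst z) (inv_into U \<kappa> (\<kappa> (snd z))))"
    by force
  then have "continuous_on (T \<times> U) (\<lambda>z. \<phi> (fst z) (snd z))"
    by (rule continuous_on_cong[THEN iffD1, rotated -1]) (auto simp: c(5))
  then have "continuous (at (p, x) within T \<times> U) (\<lambda>z. \<phi> (fst z) (snd z))"
    using p c(2) by (auto simp: continuous_on_eq_continuous_within)
  moreover have "at (p, x) within T \<times> U = at (p, x) within T \<times> UNIV"
    by (rule at_within_nhd[of _ "UNIV \<times> U"]) (use c(2,3) in \<open>auto intro!: open_Times\<close>)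
  ultimately show "continuous (at (p, x) within T \<times> UNIV) (\<lambda>z. \<phi> (fst z) (snd z))" by simp
qed

lemma smooth_fun_continuous:
  assumes "smooth_fun \<A> f"
  shows "continuous_on UNIV f"
proof -
  have "continuous_on UNIV (\<lambda>x::'m. (0::real, x))"
    by (intro continuous_on_Pair continuous_on_const continuous_on_id)
  from continuous_on_compose2[OF family_continuous[OF smooth_fun_family[OF assms, of UNIV]] this]
  show ?thesis by simp
qed

lemma family_slice_continuous:
  "smooth_family \<A> T \<phi> \<Longrightarrow> p \<in> T \<Longrightarrow> continuous_on UNIV (\<phi> p)"
  by (rule smooth_fun_continuous[OF smooth_family_smooth_fun])

lemma family_point_smooth:
  assumes "smooth_family \<A> T \<phi>"
  shows "smooth_on T (\<lambda>p. \<phi> p x)"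
proof -
  obtain U \<kappa> B where c: "(U, \<kappa>) \<in> \<A>" "x \<in> U" "\<And>y. y \<in> U \<Longrightarrow> inv_into U \<kappa> (\<kappa> y) = y"
    by (rule chartE[of x]) blast
  have s: "smooth_on (T \<times> \<kappa> ` U) (\<lambda>z. \<phi> (fst z) (inv_into U \<kappa> (snd z)))"
    using assms c(1) by (simp add: smooth_family_iff)
  show ?thesis
    using smooth_on_affine[OF s, of "\<lambda>p. (p, 0)" T "(0, \<kappa> x)"] c(2,3)
    by (auto simp: bounded_linear_Pair bounded_linear_ident)
qed

lemma family_has_derivative:
  assumes "smooth_family \<A> J \<phi>" "nontrivial_interval J" "t \<in> J"
  shows "((\<lambda>\<tau>. \<phi> \<tau> x) has_real_derivative ddtM J \<phi> t x) (at t within J)"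
  using smooth_on_real_ddt(2)[OF family_point_smooth[OF assms(1)] assms(2,3)]
  by (simp add: ddtM_def)

lemma family_uniform:
  fixes \<phi> :: "'p::euclidean_space \<Rightarrow> 'm \<Rightarrow> real"
  assumes "smooth_family \<A> T \<phi>" "p0 \<in> T" "e > 0"
  shows "\<exists>d>0. \<forall>p\<in>T. dist p p0 < d \<longrightarrow> (\<forall>x\<in>space \<mu>. \<bar>\<phi> p x - \<phi> p0 x\<bar> \<le> e)"
proof -
  obtain X0 where X0: "p0 \<in> X0" "open X0"
    "\<forall>p\<in>X0 \<inter> T. \<forall>x\<in>UNIV. dist (\<phi> (fst (p, x)) (snd (p, x))) (\<phi> (fst (p0, x)) (snd (p0, x))) \<le> e"
    using continuous_on_prod_compactE[OF family_continuous[OF assms(1)] compact_M assms(2,3)] by blast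
  obtain d where d: "d > 0" "\<And>p. dist p p0 < d \<Longrightarrow> p \<in> X0"
    using X0(1,2) unfolding open_dist by blast
  then show ?thesis using X0(3) by (intro exI[of _ d]) (auto simp: dist_real_def)
qed

lemma integral_family_continuous:
  fixes \<phi> :: "'p::euclidean_space \<Rightarrow> 'm \<Rightarrow> real"
  assumes "smooth_family \<A> T \<phi>"
  shows "continuous_on T (\<lambda>p. \<integral>x. \<phi> p x \<partial>\<mu>)"
  unfolding continuous_on_eq_continuous_within
  by (intro ballI integral_continuous_uniform continuous_integrable family_slice_continuous[OF assms]
      family_uniform[OF assms])

lemma integral_family_has_derivative:
  assumes "smooth_family \<A> J \<phi>" "nontrivial_interval J" "t \<in> J"
  shows "((\<lambda>t. \<integral>x. \<phi> t x \<partial>\<mu>) has_real_derivative (\<integral>x. ddtM J \<phi> t x \<partial>\<mu>)) (at t within J)"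
proof -
  note D = smooth_family_ddtM[OF assms(1,2)]
  show ?thesis
    by (rule integral_has_derivative_uniform[OF nontrivial_interval_convex[OF assms(2)] assms(3)
        continuous_integrable[OF family_slice_continuous[OF assms(1)]]
        continuous_integrable[OF family_slice_continuous[OF D assms(3)]]
        family_has_derivative[OF assms(1,2)] family_uniform[OF D assms(3)]])
qed

text \<open>
  Smoothness at an endpoint of \<open>T\<close> requires an extension beyond \<open>T\<close>. Chart by chart the integrand has
  one, but extensions on overlapping charts need not agree. Splitting \<open>M\<close> into disjoint Borel pieces avoids
  gluing: property \<open>P\<close> of a Borel set says that the integral over it extends smoothly near \<open>t0\<close>. It
  holds for the Borel subsets of a small neighbourhood of each point and passes to disjoint unions, hence it
  holds for \<open>M\<close> by compactness.
\<close>

lemma integral_family_smooth: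
  fixes \<phi> :: "real \<Rightarrow> 'm \<Rightarrow> real"
  assumes "smooth_family \<A> T \<phi>"
  shows "smooth_on T (\<lambda>t. \<integral>x. \<phi> t x \<partial>\<mu>)"
proof (rule smooth_onI)
  fix t0 assume t0: "t0 \<in> T"
  define P where "P = (\<lambda>Y. Y \<in> sets borel \<and> (\<exists>d>0. \<exists>H. (\<forall>k. Ck_on k (ball t0 d) H) \<and>
    (\<forall>t\<in>T \<inter> ball t0 d. H t = (\<integral>x. indicator Y x * \<phi> t x \<partial>\<mu>))))"
  have int: "integrable \<mu> (\<lambda>x. indicator Y x * \<phi> t x)" if "Y \<in> sets borel" "t \<in> T" for Y t
    using integrable_mult_indicator[OF _ continuous_integrable[OF family_slice_continuous[OF assms that(2)]], of Y] that(1)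
    by (simp add: sets_mu)
  have P_un: "P (Y \<union> Z)" if "P Y" "P Z" "Y \<inter> Z = {}" for Y Z
  proof -
    obtain d H where Y: "Y \<in> sets borel" "d > 0" "\<And>k. Ck_on k (ball t0 d) H"
      "\<And>t. t \<in> T \<inter> ball t0 d \<Longrightarrow> H t = (\<integral>x. indicator Y x * \<phi> t x \<partial>\<mu>)"
      using \<open>P Y\<close> unfolding P_def by blast
    obtain d' H' where Z: "Z \<in> sets borel" "d' > 0" "\<And>k. Ck_on k (ball t0 d') H'"
      "\<And>t. t \<in> T \<inter> ball t0 d' \<Longrightarrow> H' t = (\<integral>x. indicator Z x * \<phi> t x \<partial>\<mu>)"
      using \<open>P Z\<close> unfolding P_def by blast
    let ?d = "min d d'"
    have "Ck_on k (ball t0 ?d) (\<lambda>t. H t + H' t)" for k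
      by (rule Ck_on_add; rule Ck_on_subset[OF Y(3)] Ck_on_subset[OF Z(3)]) auto
    moreover have "H t + H' t = (\<integral>x. indicator (Y \<union> Z) x * \<phi> t x \<partial>\<mu>)" if t: "t \<in> T \<inter> ball t0 ?d" for t
    proof -
      have "H t + H' t = (\<integral>x. indicator Y x * \<phi> t x + indicator Z x * \<phi> t x \<partial>\<mu>)"
        using Y Z t int by simp
      also have "\<dots> = (\<integral>x. indicator (Y \<union> Z) x * \<phi> t x \<partial>\<mu>)"
        using \<open>Y \<inter> Z = {}\<close> by (intro Bochner_Integration.integral_cong) (auto simp: indicator_def)
      finally show ?thesis .
    qed
    ultimately show ?thesis
      unfolding P_def using Y(1,2) Z(1,2)
      by (intro conjI exI[of _ ?d] exI[of _ "\<lambda>t. H t + H' t"]) auto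
  qed
  have loc: "\<exists>N. open N \<and> x \<in> N \<and> (\<forall>Y\<in>sets borel. Y \<subseteq> N \<longrightarrow> P Y)" for x
  proof -
    obtain U \<kappa> B where c: "(U, \<kappa>) \<in> \<A>" "x \<in> U" "open U" "continuous_on U \<kappa>"
      "\<And>y. y \<in> U \<Longrightarrow> inv_into U \<kappa> (\<kappa> y) = y"
      by (rule chartE[of x]) blast
    have s: "smooth_on (T \<times> \<kappa> ` U) (\<lambda>z. \<phi> (fst z) (inv_into U \<kappa> (snd z)))"
      using assms c(1) by (simp add: smooth_family_iff)
    have "(t0, \<kappa> x) \<in> T \<times> \<kappa> ` U" using t0 c(2) by simp
    from smooth_onE[OF s this] obtain O' g where O': "open O'" "(t0, \<kappa> x) \<in> O'" "\<And>k. Ck_on k O' g"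
      "\<And>z. z \<in> T \<times> \<kappa> ` U \<Longrightarrow> z \<in> O' \<Longrightarrow> g z = \<phi> (fst z) (inv_into U \<kappa> (snd z))"
      by blast
    obtain A1 A2 where A: "open A1" "open A2" "(t0, \<kappa> x) \<in> A1 \<times> A2" "A1 \<times> A2 \<subseteq> O'"
      using open_prod_elim[OF O'(1,2)] by blast
    obtain d where d: "d > 0" "ball t0 d \<subseteq> A1" using A(1,3) open_contains_ball by blast
    obtain e where e: "e > 0" "cball (\<kappa> x) e \<subseteq> A2" using A(2,3) open_contains_cball by blast
    define N where "N = U \<inter> \<kappa> -` ball (\<kappa> x) e"
    have oN: "open N" unfolding N_def by (rule continuous_open_preimage[OF c(4,3) open_ball])
    have bO: "ball t0 d \<times> cball (\<kappa> x) e \<subseteq> O'" using d(2) e(2) A(4) by blast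
    have "P Y" if Y: "Y \<in> sets borel" "Y \<subseteq> N" for Y
    proof -
      have im: "\<kappa> ` Y \<subseteq> cball (\<kappa> x) e" using Y(2) by (auto simp: N_def)
      have meas: "(\<lambda>y. indicator Y y * h (\<kappa> y) :: real) \<in> borel_measurable \<mu>"
        if h: "continuous_on (cball (\<kappa> x) e) h" for h
      proof -
        have "continuous_on Y (\<lambda>y. h (\<kappa> y))"
          by (rule continuous_on_compose2[OF h continuous_on_subset[OF c(4)] im])
             (use Y(2) in \<open>auto simp: N_def\<close>)
        from borel_measurable_continuous_on_indicator[OF Y(1) this]
        show ?thesis by (simp add: measurable_cong_sets[OF sets_mu refl])
      qed
      have "Ck_on k (ball t0 d) (\<lambda>t. \<integral>y. indicator Y y * g (t, \<kappa> y) \<partial>\<mu>)" for k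
        by (rule Ck_on_integral[OF O'(1,3) open_ball convex_ball bO compact_cball _ im meas])
           (use Y(1) in \<open>simp_all add: sets_mu\<close>)
      moreover have "(\<integral>y. indicator Y y * g (t, \<kappa> y) \<partial>\<mu>) = (\<integral>x. indicator Y x * \<phi> t x \<partial>\<mu>)"
        if t: "t \<in> T \<inter> ball t0 d" for t
      proof (rule Bochner_Integration.integral_cong[OF refl])
        fix y
        show "indicator Y y * g (t, \<kappa> y) = indicator Y y * \<phi> t y"
        proof (cases "y \<in> Y")
          case True
          then have yU: "y \<in> U" using Y(2) by (auto simp: N_def)
          have "(t, \<kappa> y) \<in> O'" using t im True bO by blast
          then have "g (t, \<kappa> y) = \<phi> t y"
            using O'(4)[of "(t, \<kappa> y)"] t yU c(5)[OF yU] by simp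
          then show ?thesis by simp
        qed simp
      qed
      ultimately show "P Y" unfolding P_def using Y(1) d(1) by blast
    qed
    then show ?thesis
      using oN c(2) e(1) by (intro exI[of _ N]) (auto simp: N_def)
  qed
  then obtain N where N: "\<And>x. open (N x)" "\<And>x. x \<in> N x"
    "\<And>x Y. Y \<in> sets borel \<Longrightarrow> Y \<subseteq> N x \<Longrightarrow> P Y"
    by metis
  obtain F where F: "finite F" "UNIV \<subseteq> (\<Union>x\<in>F. N x)"
    using compactE_image[OF compact_M, of UNIV N] N(1,2) by (metis UNIV_I UNIV_eq_I UN_iff subset_UNIV)
  have "P Y" if "Y \<in> sets borel" "Y \<subseteq> (\<Union>x\<in>F. N x)" for Y
    using F(1) that
  proof (induction F arbitrary: Y)
    case empty
    then have "Y \<subseteq> N undefined" by simp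
    with empty N(3) show ?case by blast
  next
    case (insert x F)
    have "P (Y \<inter> N x)" using insert.prems(1) N(1) by (intro N(3)) auto
    moreover have "P (Y - N x)" using insert.prems N(1) by (intro insert.IH) auto
    ultimately have "P ((Y \<inter> N x) \<union> (Y - N x))" by (rule P_un) auto
    then show ?case by (simp add: Int_Diff_Un)
  qed
  from this[of UNIV] F(2) have "P UNIV" by simp
  then obtain d H where dH: "d > 0" "\<And>k. Ck_on k (ball t0 d) H"
    "\<And>t. t \<in> T \<inter> ball t0 d \<Longrightarrow> H t = (\<integral>x. \<phi> t x \<partial>\<mu>)"
    unfolding P_def by (auto simp del: mem_ball)
  show "\<exists>U g. open U \<and> t0 \<in> U \<and> (\<forall>k. Ck_on k U g) \<and> (\<forall>y\<in>T \<inter> U. g y = (\<integral>x. \<phi> y x \<partial>\<mu>))"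
    by (rule exI[of _ "ball t0 d"], rule exI[of _ H]) (use dH in auto)
qed

end

section \<open>The first variation of the energy\<close>

text \<open>
  The pair \<open>(EL_angular, EL_radial)\<close> is the gradient of the energy before projection to the sphere,
  with respect to the integral of \<open>\<parallel>\<delta>\<phi>\<parallel>\<^sup>2 + \<delta>r\<^sup>2\<close> over time; \<open>EL_angular\<close> is \<open>- (g1(r) \<phi>\<^sub>t)\<^sub>t\<close>
  multiplied out.
\<close>

definition EL_angular ::
  "(real \<Rightarrow> real) \<Rightarrow> real set \<Rightarrow> (real \<Rightarrow> real) \<Rightarrow> (real \<Rightarrow> 'm \<Rightarrow> real) \<Rightarrow> real \<Rightarrow> 'm \<Rightarrow> real" where
  "EL_angular g1 I r \<phi> t x =
     (- g1 (r t)) * ddtM I (ddtM I \<phi>) t x + (- (deriv g1 (r t) * ddt I r t)) * ddtM I \<phi> t x"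

definition EL_radial ::
  "'m measure \<Rightarrow> (real \<Rightarrow> real) \<Rightarrow> (real \<Rightarrow> real) \<Rightarrow> real set \<Rightarrow> (real \<Rightarrow> real) \<Rightarrow>
    (real \<Rightarrow> 'm \<Rightarrow> real) \<Rightarrow> real \<Rightarrow> real" where
  "EL_radial \<mu> g1 g2 I r \<phi> t =
     1/2 * deriv g1 (r t) * L2_ip \<mu> (ddtM I \<phi> t) (ddtM I \<phi> t)
     - 1/2 * deriv g2 (r t) * (ddt I r t)\<^sup>2 - g2 (r t) * ddt I (ddt I r) t"

lemma L2_ip_commute: "L2_ip \<mu> f g = L2_ip \<mu> g f"
  by (simp add: L2_ip_def mult.commute)

lemma has_real_derivative_compose_within:
  assumes "(f has_real_derivative f') (at t within J)" "(F has_real_derivative F') (at (f t))"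
  shows "((\<lambda>\<tau>. F (f \<tau>)) has_real_derivative F' * f') (at t within J)"
  using DERIV_chain2[OF assms(2) assms(1)] .

context compact_density
begin

lemma ip_linear_left:
  assumes "continuous_on UNIV f" "continuous_on UNIV g" "continuous_on UNIV h"
  shows "L2_ip \<mu> (\<lambda>x. c * f x + d * g x) h = c * L2_ip \<mu> f h + d * L2_ip \<mu> g h"
proof -
  have "integrable \<mu> (\<lambda>x. f x * h x)" "integrable \<mu> (\<lambda>x. g x * h x)"
    using assms by (auto intro!: continuous_integrable continuous_on_mult)
  then have "(\<integral>x. c * (f x * h x) + d * (g x * h x) \<partial>\<mu>) = c * L2_ip \<mu> f h + d * L2_ip \<mu> g h"
    by (simp add: L2_ip_def)
  then show ?thesis by (simp add: L2_ip_def algebra_simps)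
qed

lemma ip_linear_right:
  assumes "continuous_on UNIV f" "continuous_on UNIV g" "continuous_on UNIV h"
  shows "L2_ip \<mu> h (\<lambda>x. c * f x + d * g x) = c * L2_ip \<mu> h f + d * L2_ip \<mu> h g"
  using ip_linear_left[OF assms] by (simp add: L2_ip_commute)

lemma ip_family_continuous:
  fixes \<phi> :: "'p::euclidean_space \<Rightarrow> 'm \<Rightarrow> real"
  assumes "smooth_family \<A> T \<phi>" "smooth_family \<A> T \<psi>"
  shows "continuous_on T (\<lambda>p. L2_ip \<mu> (\<phi> p) (\<psi> p))"
  unfolding L2_ip_def by (rule integral_family_continuous[OF smooth_family_mult[OF assms]])

lemma ip_family_smooth:
  fixes \<phi> :: "real \<Rightarrow> 'm \<Rightarrow> real"
  assumes "smooth_family \<A> T \<phi>" "smooth_family \<A> T \<psi>"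
  shows "smooth_on T (\<lambda>p. L2_ip \<mu> (\<phi> p) (\<psi> p))"
  unfolding L2_ip_def by (rule integral_family_smooth[OF smooth_family_mult[OF assms]])

lemma ip_has_derivative:
  assumes "smooth_family \<A> J \<phi>" "smooth_family \<A> J \<psi>" "nontrivial_interval J" "t \<in> J"
  shows "((\<lambda>t. L2_ip \<mu> (\<phi> t) (\<psi> t)) has_real_derivative
           L2_ip \<mu> (ddtM J \<phi> t) (\<psi> t) + L2_ip \<mu> (\<phi> t) (ddtM J \<psi> t)) (at t within J)"
proof -
  have e: "ddtM J (\<lambda>t x. \<phi> t x * \<psi> t x) t = (\<lambda>x. ddtM J \<phi> t x * \<psi> t x + \<phi> t x * ddtM J \<psi> t x)"
  proof
    fix x
    show "ddtM J (\<lambda>t x. \<phi> t x * \<psi> t x) t x = ddtM J \<phi> t x * \<psi> t x + \<phi> t x * ddtM J \<psi> t x"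
      unfolding ddtM_def[of J "\<lambda>t x. \<phi> t x * \<psi> t x"]
      by (rule ddt_eq[OF assms(3,4)])
         (use DERIV_mult[OF family_has_derivative[OF assms(1,3,4), of x]
            family_has_derivative[OF assms(2,3,4), of x]] in \<open>simp add: algebra_simps\<close>)
  qed
  note c = family_slice_continuous[OF assms(1,4)] family_slice_continuous[OF assms(2,4)]
    family_slice_continuous[OF smooth_family_ddtM[OF assms(1,3)] assms(4)]
    family_slice_continuous[OF smooth_family_ddtM[OF assms(2,3)] assms(4)]
  have "(\<integral>x. ddtM J \<phi> t x * \<psi> t x + \<phi> t x * ddtM J \<psi> t x \<partial>\<mu>)
      = L2_ip \<mu> (ddtM J \<phi> t) (\<psi> t) + L2_ip \<mu> (\<phi> t) (ddtM J \<psi> t)"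
    unfolding L2_ip_def using c
    by (intro Bochner_Integration.integral_add) (auto intro!: continuous_integrable continuous_on_mult)
  with integral_family_has_derivative[OF smooth_family_mult[OF assms(1,2)] assms(3,4)]
  show ?thesis by (simp add: e L2_ip_def)
qed

lemma sphere_orthogonal:
  assumes "smooth_family \<A> J \<phi>" "nontrivial_interval J" "t \<in> J"
    "\<And>t. t \<in> J \<Longrightarrow> \<phi> t \<in> smooth_sphere \<A> \<mu>"
  shows "L2_ip \<mu> (\<phi> t) (ddtM J \<phi> t) = 0"
proof -
  have "((\<lambda>t. L2_ip \<mu> (\<phi> t) (\<phi> t)) has_real_derivative 0) (at t within J)"
    by (rule has_real_derivative_cong_on[OF assms(3), of _ "\<lambda>_. 1"])
       (use assms(4) in \<open>auto simp: smooth_sphere_def L2_ip_def power2_eq_square\<close>)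
  from ddt_eq[OF assms(2,3) this] ddt_eq[OF assms(2,3) ip_has_derivative[OF assms(1,1,2,3)]]
  show ?thesis by (simp add: L2_ip_commute)
qed

lemma sphere_unit: "f \<in> smooth_sphere \<A> \<mu> \<Longrightarrow> L2_ip \<mu> f f = 1"
  by (simp add: smooth_sphere_def L2_ip_def power2_eq_square)

text \<open>
  Against tangent vectors only the tangential part of a direction is seen.
\<close>

lemma ip_proj:
  assumes "f \<in> smooth_sphere \<A> \<mu>" "continuous_on UNIV h" "continuous_on UNIV k"
    "L2_ip \<mu> f k = 0"
  shows "L2_ip \<mu> (sphere_proj \<mu> f h) k = L2_ip \<mu> h k"
proof -
  have "continuous_on UNIV f" using assms(1) smooth_fun_continuous by (simp add: smooth_sphere_def)
  from ip_linear_left[OF assms(2) this assms(3), of 1 "- L2_ip \<mu> f h"] show ?thesis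
    by (simp add: sphere_proj_def assms(4))
qed

lemma ip_proj_orthogonal:
  assumes "f \<in> smooth_sphere \<A> \<mu>" "continuous_on UNIV h"
  shows "L2_ip \<mu> f (sphere_proj \<mu> f h) = 0"
proof -
  have "continuous_on UNIV f" using assms(1) smooth_fun_continuous by (simp add: smooth_sphere_def)
  from ip_linear_right[OF assms(2) this this, of 1 "- L2_ip \<mu> f h"] show ?thesis
    by (simp add: sphere_proj_def sphere_unit[OF assms(1)])
qed

lemma EL_angular_smooth:
  assumes "smooth_polar \<A> \<mu> I r \<phi>" "nontrivial_interval I" "smooth_on {0<..} g1"
  shows "smooth_family \<A> I (EL_angular g1 I r \<phi>)"
proof -
  have r: "smooth_on I r" "\<And>t. t \<in> I \<Longrightarrow> r t \<in> {0<..}" and \<phi>: "smooth_family \<A> I \<phi>"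
    using assms(1) by (auto simp: smooth_polar_def)
  have g: "smooth_on I (\<lambda>t. g1 (r t))" "smooth_on I (\<lambda>t. deriv g1 (r t))"
    using smooth_on_compose[OF assms(3) r] smooth_on_compose[OF smooth_on_deriv(1)[OF assms(3)] r]
    by auto
  note \<phi>t = smooth_family_ddtM[OF \<phi> assms(2)]
  note m = smooth_on_mult[OF smooth_on_const[of I "-1"]]
  have "smooth_on I (\<lambda>t. - g1 (r t))" "smooth_on I (\<lambda>t. - (deriv g1 (r t) * ddt I r t))"
    using m[OF g(1)] m[OF smooth_on_mult[OF g(2) smooth_on_real_ddt(1)[OF r(1) assms(2)]]] by auto
  from smooth_family_add[OF smooth_family_mult[OF smooth_family_param[OF this(1)] smooth_family_ddtM[OF \<phi>t assms(2)]]
      smooth_family_mult[OF smooth_family_param[OF this(2)] \<phi>t]]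
  show ?thesis by (rule smooth_family_cong[rotated]) (simp add: EL_angular_def)
qed

lemma EL_radial_smooth:
  assumes "smooth_polar \<A> \<mu> I r \<phi>" "nontrivial_interval I"
    "smooth_on {0<..} g1" "smooth_on {0<..} g2"
  shows "smooth_on I (EL_radial \<mu> g1 g2 I r \<phi>)"
proof -
  have r: "smooth_on I r" "\<And>t. t \<in> I \<Longrightarrow> r t \<in> {0<..}" and \<phi>: "smooth_family \<A> I \<phi>"
    using assms(1) by (auto simp: smooth_polar_def)
  have g: "smooth_on I (\<lambda>t. g2 (r t))" "smooth_on I (\<lambda>t. deriv g1 (r t))" "smooth_on I (\<lambda>t. deriv g2 (r t))"
    using smooth_on_compose[OF assms(4) r] smooth_on_compose[OF smooth_on_deriv(1)[OF assms(3)] r]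
      smooth_on_compose[OF smooth_on_deriv(1)[OF assms(4)] r]
    by auto
  note \<phi>t = smooth_family_ddtM[OF \<phi> assms(2)]
  note rt = smooth_on_real_ddt(1)[OF r(1) assms(2)]
  note c = smooth_on_const[of I]
  have "smooth_on I (\<lambda>t. (1/2 * deriv g1 (r t)) * L2_ip \<mu> (ddtM I \<phi> t) (ddtM I \<phi> t)
     + ((- 1/2) * deriv g2 (r t) * (ddt I r t * ddt I r t) + (-1) * (g2 (r t) * ddt I (ddt I r) t)))"
    by (intro smooth_on_add smooth_on_mult c g rt ip_family_smooth \<phi>t
        smooth_on_real_ddt(1)[OF rt assms(2)])
  then show ?thesis
    by (rule smooth_on_cong[THEN iffD1, rotated]) (simp add: EL_radial_def power2_eq_square)
qed

text \<open>
  The derivative \<open>F'\<close> of the energy integrand still contains time derivatives of the variation. They are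
  removed by subtracting the time derivative of the boundary term
  \<open>B = g1(r) \<langle>\<phi>\<^sub>t, \<delta>\<phi>\<rangle> + g2(r) r\<^sub>t \<delta>r\<close>, which vanishes at \<open>a\<close> and \<open>b\<close>.
\<close>

lemma first_variation:
  assumes g1: "smooth_on {0<..} g1" and g2: "smooth_on {0<..} g2"
    and I: "nontrivial_interval I" and ab: "a < b" "{a..b} \<subseteq> I" and \<delta>: "0 < \<delta>"
    and curve: "smooth_polar \<A> \<mu> I r \<phi>"
    and var: "smooth_polar \<A> \<mu> ({-\<delta><..<\<delta>} \<times> {a..b}) rv \<phi>v"
    and base: "\<And>t. t \<in> {a..b} \<Longrightarrow> rv (0, t) = r t \<and> \<phi>v (0, t) = \<phi> t"
    and ends: "\<And>\<epsilon> t. \<epsilon> \<in> {-\<delta><..<\<delta>} \<Longrightarrow> t \<in> {a, b} \<Longrightarrow> rv (\<epsilon>, t) = r t \<and> \<phi>v (\<epsilon>, t) = \<phi> t"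
  shows "((\<lambda>\<epsilon>. energy \<mu> g1 g2 a b (\<lambda>t. rv (\<epsilon>, t)) (\<lambda>t. \<phi>v (\<epsilon>, t))) has_real_derivative
      integral {a..b} (\<lambda>t.
        L2_ip \<mu> (EL_angular g1 I r \<phi> t) (ddtM {-\<delta><..<\<delta>} (\<lambda>\<epsilon>. \<phi>v (\<epsilon>, t)) 0) +
        EL_radial \<mu> g1 g2 I r \<phi> t * ddt {-\<delta><..<\<delta>} (\<lambda>\<epsilon>. rv (\<epsilon>, t)) 0)) (at 0)"
proof -
  define D where "D = {-\<delta><..<\<delta>}"
  define K where "K = {a..b}"
  have D: "nontrivial_interval D" "0 \<in> D" "open D"
    using \<delta> by (auto simp: D_def intro!: nontrivial_interval_Ioo)
  have K: "nontrivial_interval K" "K \<subseteq> I" "a \<in> K" "b \<in> K"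
    using ab by (auto simp: K_def intro!: nontrivial_interval_Icc)
  have rv: "smooth_on (D \<times> K) rv" "\<And>z. z \<in> D \<times> K \<Longrightarrow> rv z \<in> {0<..}"
    and \<phi>v: "smooth_family \<A> (D \<times> K) \<phi>v"
    using var by (auto simp: smooth_polar_def D_def K_def)
  have r: "smooth_on I r" "\<And>t. t \<in> I \<Longrightarrow> r t \<in> {0<..}" and \<phi>: "smooth_family \<A> I \<phi>"
    using curve by (auto simp: smooth_polar_def)
  define rt where "rt = (\<lambda>z. ddt K (\<lambda>t. rv (fst z, t)) (snd z))"
  define re where "re = (\<lambda>z. ddt D (\<lambda>e. rv (e, snd z)) (fst z))"
  define rte where "rte = (\<lambda>z. ddt D (\<lambda>e. rt (e, snd z)) (fst z))"
  define \<phi>t where "\<phi>t = (\<lambda>z. ddtM K (\<lambda>t. \<phi>v (fst z, t)) (snd z))"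
  define \<phi>e where "\<phi>e = (\<lambda>z. ddtM D (\<lambda>e. \<phi>v (e, snd z)) (fst z))"
  define \<phi>te where "\<phi>te = (\<lambda>z. ddtM D (\<lambda>e. \<phi>t (e, snd z)) (fst z))"
  have srt: "smooth_on (D \<times> K) rt"
    unfolding rt_def by (rule smooth_on_real_rectangle(2)[OF rv(1) K(1)])
  have sre: "smooth_on (D \<times> K) re"
    unfolding re_def by (rule smooth_on_real_rectangle(1)[OF rv(1) D(1)])
  have srte: "smooth_on (D \<times> K) rte"
    unfolding rte_def by (rule smooth_on_real_rectangle(1)[OF srt D(1)])
  have s\<phi>t: "smooth_family \<A> (D \<times> K) \<phi>t"
    unfolding \<phi>t_def by (rule smooth_family_rectangle(2)[OF \<phi>v K(1)])
  have s\<phi>e: "smooth_family \<A> (D \<times> K) \<phi>e"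
    unfolding \<phi>e_def by (rule smooth_family_rectangle(1)[OF \<phi>v D(1)])
  have s\<phi>te: "smooth_family \<A> (D \<times> K) \<phi>te"
    unfolding \<phi>te_def by (rule smooth_family_rectangle(1)[OF s\<phi>t D(1)])

  define N where "N = (\<lambda>z. L2_ip \<mu> (\<phi>t z) (\<phi>t z))"
  define F where "F = (\<lambda>z. 1/2 * g1 (rv z) * N z + 1/2 * g2 (rv z) * (rt z)\<^sup>2)"
  define F' where "F' = (\<lambda>z. 1/2 * (deriv g1 (rv z) * re z) * N z
      + 1/2 * g1 (rv z) * (2 * L2_ip \<mu> (\<phi>t z) (\<phi>te z))
      + (1/2 * (deriv g2 (rv z) * re z) * (rt z)\<^sup>2 + 1/2 * g2 (rv z) * (2 * rt z * rte z)))"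
  have dre: "((\<lambda>e. rv (e, t)) has_real_derivative re (e, t)) (at e within D)"
    and drte: "((\<lambda>e. rt (e, t)) has_real_derivative rte (e, t)) (at e within D)"
    if "e \<in> D" "t \<in> K" for e t
    using smooth_on_real_ddt(2)[OF smooth_on_rectangle_slice(1)[OF rv(1) that(2)] D(1) that(1)]
      smooth_on_real_ddt(2)[OF smooth_on_rectangle_slice(1)[OF srt that(2)] D(1) that(1)]
    by (simp_all add: re_def rte_def)
  have dN: "((\<lambda>e. N (e, t)) has_real_derivative 2 * L2_ip \<mu> (\<phi>t (e, t)) (\<phi>te (e, t))) (at e within D)"
    if "e \<in> D" "t \<in> K" for e t
  proof -
    note s = smooth_family_rectangle_slice(1)[OF s\<phi>t that(2)]
    have "ddtM D (\<lambda>e. \<phi>t (e, t)) e = \<phi>te (e, t)" by (simp add: \<phi>te_def)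
    with ip_has_derivative[OF s s D(1) that(1)] show ?thesis
      by (simp add: N_def L2_ip_commute)
  qed
  have dF: "((\<lambda>e. F (e, t)) has_real_derivative F' (e, t)) (at e within D)"
    if "e \<in> D" "t \<in> K" for e t
  proof -
    have p: "rv (e, t) \<in> {0<..}" using rv(2) that by simp
    note d1 = has_real_derivative_compose_within[OF dre[OF that] smooth_on_deriv(2)[OF g1 open_greaterThan p]]
    note d2 = has_real_derivative_compose_within[OF dre[OF that] smooth_on_deriv(2)[OF g2 open_greaterThan p]]
    show ?thesis unfolding F_def F'_def
      by (rule derivative_eq_intros d1 d2 dN[OF that] drte[OF that] refl)+
         (simp add: algebra_simps power2_eq_square)
  qed
  have cF': "continuous_on (D \<times> K) F'" "continuous_on (D \<times> K) F"
  proof -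
    have c: "continuous_on (D \<times> K) (\<lambda>z. G (rv z))" if "smooth_on {0<..} G" for G :: "real \<Rightarrow> real"
      by (rule smooth_on_continuous[OF smooth_on_compose[OF that rv]])
    have "continuous_on (D \<times> K) (\<lambda>z. g1 (rv z))" "continuous_on (D \<times> K) (\<lambda>z. g2 (rv z))"
      "continuous_on (D \<times> K) (\<lambda>z. deriv g1 (rv z))" "continuous_on (D \<times> K) (\<lambda>z. deriv g2 (rv z))"
      using g1 g2 smooth_on_deriv(1)[OF g1] smooth_on_deriv(1)[OF g2] by (auto intro!: c)
    moreover have "continuous_on (D \<times> K) N" "continuous_on (D \<times> K) (\<lambda>z. L2_ip \<mu> (\<phi>t z) (\<phi>te z))"
      unfolding N_def by (rule ip_family_continuous[OF s\<phi>t s\<phi>t] ip_family_continuous[OF s\<phi>t s\<phi>te])+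
    moreover note smooth_on_continuous[OF srt] smooth_on_continuous[OF sre] smooth_on_continuous[OF srte]
    ultimately show "continuous_on (D \<times> K) F'" "continuous_on (D \<times> K) F"
      unfolding F_def F'_def
      by (auto intro!: continuous_on_add continuous_on_mult continuous_on_power continuous_on_divide)
  qed
  have slice: "continuous_on K (\<lambda>t. G (e, t))" if "continuous_on (D \<times> K) G" "e \<in> D" for G e
    by (rule continuous_on_compose2[OF that(1)]) (use that(2) in \<open>auto intro!: continuous_intros\<close>)
  have "((\<lambda>e. integral (cbox a b) (\<lambda>t. F (e, t))) has_real_derivative
      integral (cbox a b) (\<lambda>t. F' (0, t))) (at 0 within D)"
  proof (rule leibniz_rule_field_derivative[OF _ _ _ D(2) nontrivial_interval_convex[OF D(1)]])
    show "((\<lambda>e. F (e, t)) has_real_derivative F' (e, t)) (at e within D)"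
      if "e \<in> D" "t \<in> cbox a b" for e t using dF that by (simp add: K_def)
    show "(\<lambda>t. F (e, t)) integrable_on cbox a b" if "e \<in> D" for e
      using slice[OF cF'(2) that] by (intro integrable_continuous) (simp add: K_def)
    show "continuous_on (D \<times> cbox a b) (\<lambda>(e, t). F' (e, t))"
      using cF'(1) by (simp add: K_def)
  qed
  moreover have "energy \<mu> g1 g2 a b (\<lambda>t. rv (\<epsilon>, t)) (\<lambda>t. \<phi>v (\<epsilon>, t)) = integral (cbox a b) (\<lambda>t. F (\<epsilon>, t))" for \<epsilon>
    by (simp only: energy_def F_def N_def rt_def \<phi>t_def K_def cbox_interval fst_conv snd_conv)
  ultimately have dE: "((\<lambda>\<epsilon>. energy \<mu> g1 g2 a b (\<lambda>t. rv (\<epsilon>, t)) (\<lambda>t. \<phi>v (\<epsilon>, t)))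
      has_real_derivative integral K (\<lambda>t. F' (0, t))) (at 0)"
    by (simp only: at_within_open[OF D(2,3)] K_def cbox_interval)

  define \<psi> where "\<psi> = (\<lambda>t. \<phi>e (0, t))"
  define \<rho> where "\<rho> = (\<lambda>t. re (0, t))"
  have s\<psi>: "smooth_family \<A> K \<psi>"
    unfolding \<psi>_def by (rule smooth_family_rectangle_slice(2)[OF s\<phi>e D(2)])
  have s\<rho>: "smooth_on K \<rho>"
    unfolding \<rho>_def by (rule smooth_on_rectangle_slice(2)[OF sre D(2)])
  have \<phi>K: "smooth_family \<A> K (ddtM I \<phi>)"
    by (rule smooth_family_subset[OF smooth_family_ddtM[OF \<phi> I] K(2)])
  have at0: "rv (0, t) = r t" "rt (0, t) = ddt I r t" "\<phi>t (0, t) = ddtM I \<phi> t"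
    "rte (0, t) = ddt K \<rho> t" "\<phi>te (0, t) = ddtM K \<psi> t" if t: "t \<in> K" for t
  proof -
    have tI: "t \<in> I" using t K(2) by blast
    show "rv (0, t) = r t" using base t by (simp add: K_def)
    show "rt (0, t) = ddt I r t" unfolding rt_def fst_conv snd_conv
      by (rule ddt_cong[OF K(1) t has_field_derivative_subset[OF smooth_on_real_ddt(2)[OF r(1) I tI] K(2)]])
         (use base in \<open>simp add: K_def\<close>)
    show "\<phi>t (0, t) = ddtM I \<phi> t" unfolding \<phi>t_def fst_conv snd_conv
    proof
      fix x
      show "ddtM K (\<lambda>t. \<phi>v (0, t)) t x = ddtM I \<phi> t x" unfolding ddtM_def[of K]
        by (rule ddt_cong[OF K(1) t has_field_derivative_subset[OF family_has_derivative[OF \<phi> I tI] K(2)]])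
           (use base in \<open>simp add: K_def\<close>)
    qed
    show "rte (0, t) = ddt K \<rho> t"
      using mixed_partials[OF rv(1)[unfolded K_def] D(1) ab(1) D(2)] t
      by (simp add: rte_def rt_def \<rho>_def re_def K_def)
    show "\<phi>te (0, t) = ddtM K \<psi> t"
      using mixed_partials[OF family_point_smooth[OF \<phi>v, unfolded K_def] D(1) ab(1) D(2)] t
      by (simp add: \<phi>te_def \<phi>t_def \<psi>_def \<phi>e_def K_def ddtM_def)
  qed
  define B where "B = (\<lambda>t. g1 (r t) * L2_ip \<mu> (ddtM I \<phi> t) (\<psi> t) + g2 (r t) * (ddt I r t * \<rho> t))"
  define EL where "EL = (\<lambda>t. L2_ip \<mu> (EL_angular g1 I r \<phi> t) (\<psi> t) + EL_radial \<mu> g1 g2 I r \<phi> t * \<rho> t)"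
  have dB: "(B has_real_derivative F' (0, t) - EL t) (at t within K)" if t: "t \<in> K" for t
  proof -
    have tI: "t \<in> I" using t K(2) by blast
    note sub = has_field_derivative_subset[OF _ K(2)]
    note p = r(2)[OF tI]
    note dr = sub[OF smooth_on_real_ddt(2)[OF r(1) I tI]]
    note drt = sub[OF smooth_on_real_ddt(2)[OF smooth_on_real_ddt(1)[OF r(1) I] I tI]]
    note d1 = has_real_derivative_compose_within[OF dr smooth_on_deriv(2)[OF g1 open_greaterThan p]]
    note d2 = has_real_derivative_compose_within[OF dr smooth_on_deriv(2)[OF g2 open_greaterThan p]]
    note d\<rho> = smooth_on_real_ddt(2)[OF s\<rho> K(1) t]
    have e: "ddtM K (ddtM I \<phi>) t = ddtM I (ddtM I \<phi>) t"
      unfolding ddtM_def[of K]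
      by (rule ext, rule ddt_eq[OF K(1) t sub[OF family_has_derivative[OF smooth_family_ddtM[OF \<phi> I] I tI]]])
    note dip = ip_has_derivative[OF \<phi>K s\<psi> K(1) t, unfolded e]
    have "L2_ip \<mu> (EL_angular g1 I r \<phi> t) (\<psi> t) =
        (- g1 (r t)) * L2_ip \<mu> (ddtM I (ddtM I \<phi>) t) (\<psi> t)
        + (- (deriv g1 (r t) * ddt I r t)) * L2_ip \<mu> (ddtM I \<phi> t) (\<psi> t)"
      unfolding EL_angular_def
      by (intro ip_linear_left family_slice_continuous[OF s\<psi> t]
          family_slice_continuous[OF smooth_family_ddtM[OF \<phi> I] tI]
          family_slice_continuous[OF smooth_family_ddtM[OF smooth_family_ddtM[OF \<phi> I] I] tI])
    then have EL: "EL t = (- g1 (r t)) * L2_ip \<mu> (ddtM I (ddtM I \<phi>) t) (\<psi> t)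
        + (- (deriv g1 (r t) * ddt I r t)) * L2_ip \<mu> (ddtM I \<phi> t) (\<psi> t)
        + EL_radial \<mu> g1 g2 I r \<phi> t * \<rho> t"
      by (simp add: EL_def)
    show ?thesis
      unfolding B_def
      by (rule derivative_eq_intros d1 d2 dip drt d\<rho> refl)+
         (simp add: F'_def N_def EL EL_radial_def at0[OF t] \<rho>_def field_simps power2_eq_square)
  qed
  have B0: "B t = 0" if t: "t \<in> {a, b}" for t
  proof -
    have "\<rho> t = 0" unfolding \<rho>_def re_def fst_conv snd_conv
      by (rule ddt_cong[OF D(1,2), of "\<lambda>_. r t"]) (use ends t in \<open>auto simp: D_def\<close>)
    moreover have "\<psi> t = (\<lambda>x. 0)" unfolding \<psi>_def \<phi>e_def fst_conv snd_conv ddtM_def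
      by (rule ext, rule ddt_cong[OF D(1,2), of "\<lambda>_. \<phi> t x" for x]) (use ends t in \<open>auto simp: D_def\<close>)
    ultimately show ?thesis by (simp add: B_def L2_ip_def)
  qed
  have 1: "((\<lambda>t. F' (0, t)) has_integral integral K (\<lambda>t. F' (0, t))) K"
    using slice[OF cF'(1) D(2)] unfolding K_def by (intro integrable_integral integrable_continuous_interval)
  have "((\<lambda>t. F' (0, t) - EL t) has_integral B b - B a) K"
    unfolding K_def
    by (rule fundamental_theorem_of_calculus)
       (use ab(1) dB in \<open>auto simp: K_def has_real_derivative_iff_has_vector_derivative\<close>)
  then have "((\<lambda>t. F' (0, t) - EL t) has_integral 0) K" using B0 by simp
  from has_integral_diff[OF 1 this] have "integral K EL = integral K (\<lambda>t. F' (0, t))"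
    by (simp add: integral_unique)
  with dE show ?thesis
    by (simp add: EL_def \<psi>_def \<phi>e_def \<rho>_def re_def D_def K_def)
qed

end

section \<open>The Euler-Lagrange equations\<close>

lemma nontrivial_interval_subinterval:
  assumes "nontrivial_interval I" "t \<in> I"
  obtains a b where "a < b" "{a..b} \<subseteq> I" "t \<in> {a..b}"
proof -
  have "t islimpt I"
    using at_within_nontrivial_interval[OF assms] by (simp add: trivial_limit_within)
  then obtain y where y: "y \<in> I" "y \<noteq> t" by (meson islimptE UNIV_I open_UNIV)
  show thesis
  proof (rule that[of "min y t" "max y t"])
    show "{min y t..max y t} \<subseteq> I"
    proof
      fix x assume "x \<in> {min y t..max y t}"
      then have "x \<in> closed_segment y t" by (auto simp: closed_segment_eq_real_ivl)
      then show "x \<in> I"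
        using closed_segment_subset[OF y(1) assms(2) nontrivial_interval_convex[OF assms(1)]] by blast
    qed
  qed (use y in auto)
qed

context compact_density
begin

text \<open>
  The variation is \<open>r + \<epsilon> q\<close> and \<open>(\<phi> + \<epsilon> p) / \<parallel>\<phi> + \<epsilon> p\<parallel>\<close>. As \<open>p\<close> is orthogonal to the unit vector
  \<open>\<phi>\<close>, the norm is \<open>sqrt (1 + \<epsilon>\<^sup>2 \<parallel>p\<parallel>\<^sup>2)\<close>, which is smooth in \<open>(\<epsilon>, t)\<close> and stationary at \<open>\<epsilon> = 0\<close>.
\<close>

lemma variation_in_direction:
  fixes a b :: real
  assumes r: "smooth_on {a..b} r" "\<And>t. t \<in> {a..b} \<Longrightarrow> 0 < r t"
    and \<phi>: "smooth_family \<A> {a..b} \<phi>" "\<And>t. t \<in> {a..b} \<Longrightarrow> \<phi> t \<in> smooth_sphere \<A> \<mu>"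
    and q: "smooth_on {a..b} q"
    and p: "smooth_family \<A> {a..b} p" "\<And>t. t \<in> {a..b} \<Longrightarrow> L2_ip \<mu> (\<phi> t) (p t) = 0"
  obtains \<delta> rv \<phi>v where "0 < \<delta>" "smooth_polar \<A> \<mu> ({-\<delta><..<\<delta>} \<times> {a..b}) rv \<phi>v"
    "\<And>t. rv (0, t) = r t" "\<And>t. \<phi>v (0, t) = \<phi> t"
    "\<And>\<epsilon> t. q t = 0 \<Longrightarrow> rv (\<epsilon>, t) = r t" "\<And>\<epsilon> t. p t = (\<lambda>x. 0) \<Longrightarrow> \<phi>v (\<epsilon>, t) = \<phi> t"
    "\<And>t. ddt {-\<delta><..<\<delta>} (\<lambda>\<epsilon>. rv (\<epsilon>, t)) 0 = q t"
    "\<And>t. ddtM {-\<delta><..<\<delta>} (\<lambda>\<epsilon>. \<phi>v (\<epsilon>, t)) 0 = p t"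
proof -
  define n where "n t = L2_ip \<mu> (p t) (p t)" for t
  have n: "smooth_on {a..b} n" "\<And>t. 0 \<le> n t"
    unfolding n_def by (rule ip_family_smooth[OF p(1) p(1)]) (simp add: L2_ip_def)
  have "continuous_on {a..b} (\<lambda>t. q t / r t)"
    using r(2) by (intro continuous_on_divide smooth_on_continuous q r(1)) force
  from compact_imp_bounded[OF compact_continuous_image[OF this compact_Icc]]
  obtain C where C: "C > 0" "\<And>t. t \<in> {a..b} \<Longrightarrow> \<bar>q t / r t\<bar> \<le> C"
    unfolding bounded_pos by auto
  \<comment> \<open>\<open>C\<close> bounds \<open>q / r\<close>, hence \<open>r + \<epsilon> q = r (1 + \<epsilon> q / r)\<close> stays positive for \<open>\<bar>\<epsilon>\<bar> < 1 / C\<close>\<close>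
  define \<delta> where "\<delta> = 1 / C"
  have \<delta>: "0 < \<delta>" using C by (simp add: \<delta>_def)
  define rv where "rv = (\<lambda>z. r (snd z) + fst z * q (snd z))"
  define s where "s z = 1 + (fst z * fst z) * n (snd z)" for z :: "real \<times> real"
  have s: "0 < s z" for z
    unfolding s_def using n(2)[of "snd z"] zero_le_square[of "fst z"]
    by (meson add_pos_nonneg mult_nonneg_nonneg zero_less_one)
  define \<phi>v where "\<phi>v = (\<lambda>z x. (\<phi> (snd z) x + fst z * p (snd z) x) * inverse (sqrt (s z)))"
  let ?T = "{-\<delta><..<\<delta>} \<times> {a..b}"
  have pull: "smooth_on ?T (\<lambda>z. f (snd z))" if "smooth_on {a..b} f" for f :: "real \<Rightarrow> real"
    using smooth_on_affine[OF that bounded_linear_snd, of ?T 0] by auto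
  have pullf: "smooth_family \<A> ?T (\<lambda>z. f (snd z))" if "smooth_family \<A> {a..b} f" for f
    using smooth_family_affine[OF that bounded_linear_snd, of ?T 0] by auto
  have fst: "smooth_on ?T fst" by (rule smooth_on_bounded_linear[OF bounded_linear_fst])
  have ss: "smooth_on ?T s"
    unfolding s_def by (intro smooth_on_add smooth_on_mult smooth_on_const fst pull n(1))
  have polar: "smooth_polar \<A> \<mu> ?T rv \<phi>v"
    unfolding smooth_polar_def
  proof (intro conjI ballI)
    show "smooth_on ?T rv"
      unfolding rv_def by (intro smooth_on_add smooth_on_mult fst pull r(1) q)
    show f: "smooth_family \<A> ?T \<phi>v"
      unfolding \<phi>v_def
      by (intro smooth_family_mult smooth_family_add pullf \<phi>(1) p(1) smooth_family_param
          smooth_on_inverse smooth_on_sqrt ss fst) (use s in simp_all)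
    fix z assume z: "z \<in> ?T"
    then have t: "snd z \<in> {a..b}" and e: "\<bar>fst z\<bar> < \<delta>" by auto
    have "\<bar>fst z * (q (snd z) / r (snd z))\<bar> < \<delta> * C"
    proof -
      have "\<bar>fst z * (q (snd z) / r (snd z))\<bar> \<le> \<bar>fst z\<bar> * C"
        unfolding abs_mult using C(2)[OF t] by (intro mult_left_mono) auto
      also have "\<dots> < \<delta> * C" using e C(1) by simp
      finally show ?thesis .
    qed
    also have "\<delta> * C = 1" using C(1) by (simp add: \<delta>_def)
    finally have "0 < 1 + fst z * (q (snd z) / r (snd z))" by linarith
    with r(2)[OF t] have "0 < r (snd z) * (1 + fst z * (q (snd z) / r (snd z)))"
      by (rule mult_pos_pos)
    then show "0 < rv z" using r(2)[OF t] by (simp add: rv_def algebra_simps)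
    have c: "continuous_on UNIV (\<phi> (snd z))" "continuous_on UNIV (p (snd z))"
      using family_slice_continuous[OF \<phi>(1) t] family_slice_continuous[OF p(1) t] by auto
    let ?u = "\<lambda>x. 1 * \<phi> (snd z) x + fst z * p (snd z) x"
    have cu: "continuous_on UNIV ?u" by (intro continuous_on_add continuous_on_mult continuous_on_const c)
    have "L2_ip \<mu> ?u ?u = s z"
      using ip_linear_left[OF c cu, of 1 "fst z"] ip_linear_right[OF c c(1), of 1 "fst z"]
        ip_linear_right[OF c c(2), of 1 "fst z"] p(2)[OF t] sphere_unit[OF \<phi>(2)[OF t]]
      by (simp add: s_def n_def L2_ip_commute[of \<mu> "p (snd z)" "\<phi> (snd z)"])
    moreover have "(\<phi>v z x)\<^sup>2 = inverse (s z) * (?u x * ?u x)" for x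
      using s[of z] by (simp add: \<phi>v_def power2_eq_square field_simps)
    ultimately have "(\<integral>x. (\<phi>v z x)\<^sup>2 \<partial>\<mu>) = inverse (s z) * s z"
      by (simp add: L2_ip_def)
    also have "\<dots> = 1" using s[of z] by simp
    finally show "\<phi>v z \<in> smooth_sphere \<A> \<mu>"
      using smooth_family_smooth_fun[OF f z] by (simp add: smooth_sphere_def)
  qed
  have D: "nontrivial_interval {-\<delta><..<\<delta>}" "0 \<in> {-\<delta><..<\<delta>}"
    using \<delta> by (auto intro!: nontrivial_interval_Ioo)
  show thesis
  proof (rule that[OF \<delta> polar])
    show "rv (0, t) = r t" for t by (simp add: rv_def)
    show "\<phi>v (0, t) = \<phi> t" for t by (simp add: \<phi>v_def s_def)
    show "rv (\<epsilon>, t) = r t" if "q t = 0" for \<epsilon> t using that by (simp add: rv_def)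
    show "\<phi>v (\<epsilon>, t) = \<phi> t" if "p t = (\<lambda>x. 0)" for \<epsilon> t
      using that by (simp add: \<phi>v_def s_def n_def L2_ip_def)
    show "ddt {-\<delta><..<\<delta>} (\<lambda>\<epsilon>. rv (\<epsilon>, t)) 0 = q t" for t
      by (rule ddt_eq[OF D]) (auto simp: rv_def intro!: derivative_eq_intros)
    show "ddtM {-\<delta><..<\<delta>} (\<lambda>\<epsilon>. \<phi>v (\<epsilon>, t)) 0 = p t" for t
    proof
      fix x
      have "((\<lambda>\<epsilon>. s (\<epsilon>, t)) has_real_derivative 0) (at 0 within {-\<delta><..<\<delta>})"
        unfolding s_def by (auto intro!: derivative_eq_intros)
      from has_real_derivative_compose_within[OF this DERIV_real_sqrt[OF s]]
      have 1: "((\<lambda>\<epsilon>. sqrt (s (\<epsilon>, t))) has_real_derivative 0) (at 0 within {-\<delta><..<\<delta>})"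
        by simp
      have 2: "s (0, t) = 1" by (simp add: s_def)
      show "ddtM {-\<delta><..<\<delta>} (\<lambda>\<epsilon>. \<phi>v (\<epsilon>, t)) 0 x = p t x"
        unfolding ddtM_def \<phi>v_def fst_conv snd_conv
        by (rule ddt_eq[OF D]) (rule derivative_eq_intros 1 refl | simp add: 2)+
    qed
  qed
qed

text \<open>
  For necessity the first variation is tested with the Euler-Lagrange expressions themselves, weighted by a
  polynomial that vanishes at the endpoints. This gives their vanishing inside every \<open>[a, b]\<close>, and at
  endpoints of \<open>I\<close> by continuity.
\<close>

lemma geodesic_iff_Euler_Lagrange:
  assumes g1: "smooth_on {0<..} g1" and g2: "smooth_on {0<..} g2"
    and I: "nontrivial_interval I" and curve: "smooth_polar \<A> \<mu> I r \<phi>"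
  shows "geodesic \<A> \<mu> g1 g2 I r \<phi> \<longleftrightarrow>
    (\<forall>t\<in>I. sphere_proj \<mu> (\<phi> t) (EL_angular g1 I r \<phi> t) = (\<lambda>x. 0) \<and> EL_radial \<mu> g1 g2 I r \<phi> t = 0)"
    (is "_ \<longleftrightarrow> (\<forall>t\<in>I. ?p t = _ \<and> ?q t = 0)")
proof
  let ?P = "EL_angular g1 I r \<phi>"
  have P: "smooth_family \<A> I ?P" by (rule EL_angular_smooth[OF curve I g1])
  have \<phi>: "smooth_family \<A> I \<phi>" "\<And>t. t \<in> I \<Longrightarrow> \<phi> t \<in> smooth_sphere \<A> \<mu>"
    and r: "smooth_on I r" "\<And>t. t \<in> I \<Longrightarrow> 0 < r t"
    using curve by (auto simp: smooth_polar_def)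
  have c\<phi>: "continuous_on UNIV (\<phi> t)" and cP: "continuous_on UNIV (?P t)" if "t \<in> I" for t
    using family_slice_continuous[OF \<phi>(1) that] family_slice_continuous[OF P that] by auto
  {
    assume geo: "geodesic \<A> \<mu> g1 g2 I r \<phi>"
    have Q: "smooth_on I ?q" by (rule EL_radial_smooth[OF curve I g1 g2])
    have p: "smooth_family \<A> I ?p"
    proof -
      have "smooth_on I (\<lambda>t. -1 * L2_ip \<mu> (\<phi> t) (?P t))"
        by (intro smooth_on_mult smooth_on_const ip_family_smooth \<phi>(1) P)
      from smooth_family_add[OF P smooth_family_mult[OF smooth_family_param[OF this] \<phi>(1)]]
      show ?thesis by (rule smooth_family_cong[rotated]) (simp add: sphere_proj_def)
    qed
    define n where "n t = L2_ip \<mu> (?p t) (?p t)" for t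
    have cn: "continuous_on I n" unfolding n_def by (rule ip_family_continuous[OF p p])
    have cQ: "continuous_on I ?q" by (rule smooth_on_continuous[OF Q])
    have n0: "0 \<le> n t" for t by (simp add: n_def L2_ip_def)
    have main: "n t + (?q t)\<^sup>2 = 0" if t: "t \<in> I" for t
    proof -
      obtain a b where ab: "a < b" "{a..b} \<subseteq> I" "t \<in> {a..b}"
        using nontrivial_interval_subinterval[OF I t] by blast
      define \<zeta> where "\<zeta> = (\<lambda>t. (t + - a) * (b + (-1) * t))"
      have \<zeta>: "smooth_on {a..b} \<zeta>" unfolding \<zeta>_def
        by (intro smooth_on_add smooth_on_mult smooth_on_const smooth_on_bounded_linear bounded_linear_ident)
      note sub = smooth_family_subset[OF _ ab(2)] smooth_on_subset[OF _ ab(2)]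
      have orth: "L2_ip \<mu> (\<phi> t) (?p t) = 0" if "t \<in> I" for t
        by (rule ip_proj_orthogonal[OF \<phi>(2)[OF that] cP[OF that]])
      have cp: "continuous_on UNIV (?p t)" if "t \<in> I" for t
        by (rule family_slice_continuous[OF p that])
      obtain \<delta> rv \<phi>v where v: "0 < \<delta>" "smooth_polar \<A> \<mu> ({-\<delta><..<\<delta>} \<times> {a..b}) rv \<phi>v"
        "\<And>t. rv (0, t) = r t" "\<And>t. \<phi>v (0, t) = \<phi> t"
        "\<And>\<epsilon> t. \<zeta> t * ?q t = 0 \<Longrightarrow> rv (\<epsilon>, t) = r t"
        "\<And>\<epsilon> t. (\<lambda>x. \<zeta> t * ?p t x) = (\<lambda>x. 0) \<Longrightarrow> \<phi>v (\<epsilon>, t) = \<phi> t"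
        "\<And>t. ddt {-\<delta><..<\<delta>} (\<lambda>\<epsilon>. rv (\<epsilon>, t)) 0 = \<zeta> t * ?q t"
        "\<And>t. ddtM {-\<delta><..<\<delta>} (\<lambda>\<epsilon>. \<phi>v (\<epsilon>, t)) 0 = (\<lambda>x. \<zeta> t * ?p t x)"
      proof (rule variation_in_direction[of a b r \<phi> "\<lambda>t. \<zeta> t * ?q t" "\<lambda>t x. \<zeta> t * ?p t x"])
        show "L2_ip \<mu> (\<phi> t) (\<lambda>x. \<zeta> t * ?p t x) = 0" if "t \<in> {a..b}" for t
        proof -
          have tI: "t \<in> I" using that ab(2) by blast
          from ip_linear_right[OF cp[OF tI] cp[OF tI] c\<phi>[OF tI], of "\<zeta> t" 0] orth[OF tI]
          show ?thesis by simp
        qed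
        show "smooth_on {a..b} (\<lambda>t. \<zeta> t * ?q t)" by (intro smooth_on_mult \<zeta> sub Q)
        show "smooth_family \<A> {a..b} (\<lambda>t x. \<zeta> t * ?p t x)"
          by (intro smooth_family_mult smooth_family_param \<zeta> sub p)
      qed (use r(2) \<phi>(2) ab(2) in \<open>auto intro: sub r(1) \<phi>(1)\<close>)
      have \<zeta>0: "\<zeta> t = 0" if "t \<in> {a, b}" for t using that by (auto simp: \<zeta>_def)
      have ends: "rv (\<epsilon>, t) = r t \<and> \<phi>v (\<epsilon>, t) = \<phi> t" if "t \<in> {a, b}" for \<epsilon> t
        using v(5,6) \<zeta>0[OF that] by simp
      have "((\<lambda>\<epsilon>. energy \<mu> g1 g2 a b (\<lambda>t. rv (\<epsilon>, t)) (\<lambda>t. \<phi>v (\<epsilon>, t)))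
             has_real_derivative 0) (at 0)"
        using geo ab(1,2) v(1-4) ends unfolding geodesic_def by simp
      moreover have "((\<lambda>\<epsilon>. energy \<mu> g1 g2 a b (\<lambda>t. rv (\<epsilon>, t)) (\<lambda>t. \<phi>v (\<epsilon>, t)))
        has_real_derivative integral {a..b} (\<lambda>t. L2_ip \<mu> (?P t) (\<lambda>x. \<zeta> t * ?p t x) + ?q t * (\<zeta> t * ?q t))) (at 0)"
        using first_variation[OF g1 g2 I ab(1,2) v(1) curve v(2)] v(3,4) ends
        by (simp add: v(7,8))
      ultimately have int0: "integral {a..b} (\<lambda>t. L2_ip \<mu> (?P t) (\<lambda>x. \<zeta> t * ?p t x) + ?q t * (\<zeta> t * ?q t)) = 0"
        using DERIV_unique by blast
      have integrand: "L2_ip \<mu> (?P t) (\<lambda>x. \<zeta> t * ?p t x) + ?q t * (\<zeta> t * ?q t) = \<zeta> t * (n t + (?q t)\<^sup>2)"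
        if "t \<in> {a..b}" for t
      proof -
        have tI: "t \<in> I" using that ab(2) by blast
        have "L2_ip \<mu> (?P t) (\<lambda>x. \<zeta> t * ?p t x) = \<zeta> t * L2_ip \<mu> (?P t) (?p t)"
          using ip_linear_right[OF cp[OF tI] cp[OF tI] cP[OF tI], of "\<zeta> t" 0] by simp
        also have "L2_ip \<mu> (?P t) (?p t) = n t"
          unfolding n_def using ip_proj[OF \<phi>(2)[OF tI] cP[OF tI] cp[OF tI] orth[OF tI]] by simp
        finally show ?thesis by (simp add: power2_eq_square algebra_simps)
      qed
      have "integral {a..b} (\<lambda>t. \<zeta> t * (n t + (?q t)\<^sup>2)) = 0"
        using int0 integral_cong[of "{a..b}", OF integrand] by simp
      moreover have "continuous_on {a..b} (\<lambda>t. n t + (?q t)\<^sup>2)"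
        by (intro continuous_on_add continuous_on_power continuous_on_subset[OF cn ab(2)]
            continuous_on_subset[OF cQ ab(2)])
      note cnq = this
      moreover have "0 \<le> \<zeta> t" if "t \<in> {a..b}" for t
        using that by (auto simp: \<zeta>_def)
      ultimately have z: "\<zeta> t * (n t + (?q t)\<^sup>2) = 0" if "t \<in> {a..b}" for t
        using integral_eq_0_iff[of a b "\<lambda>t. \<zeta> t * (n t + (?q t)\<^sup>2)"] ab(1) that n0
          continuous_on_mult[OF smooth_on_continuous[OF \<zeta>] cnq]
        by (simp add: add_nonneg_nonneg)
      have "n t + (?q t)\<^sup>2 = 0" if "t \<in> {a<..<b}" for t
        using z[of t] that by (auto simp: \<zeta>_def)
      then show "n t + (?q t)\<^sup>2 = 0"
        using continuous_constant_on_closure[of "{a<..<b}" "\<lambda>t. n t + (?q t)\<^sup>2" 0 t] cnq ab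
        by (simp add: closure_greaterThanLessThan)
    qed
    show "\<forall>t\<in>I. ?p t = (\<lambda>x. 0) \<and> ?q t = 0"
    proof
      fix t assume t: "t \<in> I"
      have "n t = 0" "(?q t)\<^sup>2 = 0" using main[OF t] n0[of t] zero_le_power2[of "?q t"] by linarith+
      moreover have "?p t x * ?p t x = 0" if "n t = 0" for x
        by (rule integral_nonneg_eq_0D[of "\<lambda>x. ?p t x * ?p t x"])
           (use that family_slice_continuous[OF p t] in \<open>auto simp: n_def L2_ip_def intro!: continuous_on_mult\<close>)
      ultimately show "?p t = (\<lambda>x. 0) \<and> ?q t = 0" by auto
    qed
  next
    assume EL: "\<forall>t\<in>I. ?p t = (\<lambda>x. 0) \<and> ?q t = 0"
    show "geodesic \<A> \<mu> g1 g2 I r \<phi>"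
      unfolding geodesic_def
    proof (intro conjI allI impI, rule curve)
      fix a b \<delta> :: real and rv \<phi>v
      assume ab: "a < b \<and> {a..b} \<subseteq> I" and \<delta>: "0 < \<delta>"
      assume v: "smooth_polar \<A> \<mu> ({-\<delta><..<\<delta>} \<times> {a..b}) rv \<phi>v \<and>
          (\<forall>t\<in>{a..b}. rv (0, t) = r t \<and> \<phi>v (0, t) = \<phi> t) \<and>
          (\<forall>\<epsilon>\<in>{-\<delta><..<\<delta>}. \<forall>t\<in>{a, b}. rv (\<epsilon>, t) = r t \<and> \<phi>v (\<epsilon>, t) = \<phi> t)"
      let ?D = "{-\<delta><..<\<delta>}"
      have D: "nontrivial_interval ?D" "0 \<in> ?D" using \<delta> by (auto intro!: nontrivial_interval_Ioo)
      have zero: "L2_ip \<mu> (?P t) (ddtM ?D (\<lambda>\<epsilon>. \<phi>v (\<epsilon>, t)) 0) + ?q t * ddt ?D (\<lambda>\<epsilon>. rv (\<epsilon>, t)) 0 = 0"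
        if t: "t \<in> {a..b}" for t
      proof -
        have tI: "t \<in> I" using t ab by blast
        have f: "smooth_family \<A> ?D (\<lambda>\<epsilon>. \<phi>v (\<epsilon>, t))"
          using v t by (auto simp: smooth_polar_def intro: smooth_family_rectangle_slice)
        let ?\<psi> = "ddtM ?D (\<lambda>\<epsilon>. \<phi>v (\<epsilon>, t)) 0"
        have "L2_ip \<mu> (\<phi>v (0, t)) ?\<psi> = 0"
          by (rule sphere_orthogonal[OF f D]) (use v t in \<open>auto simp: smooth_polar_def\<close>)
        then have "L2_ip \<mu> (\<phi> t) ?\<psi> = 0" using v t by simp
        from ip_proj[OF \<phi>(2)[OF tI] cP[OF tI] family_slice_continuous[OF smooth_family_ddtM[OF f D(1)] D(2)] this]
        have "L2_ip \<mu> (?P t) ?\<psi> = L2_ip \<mu> (?p t) ?\<psi>" by simp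
        also have "\<dots> = 0" using EL tI by (simp add: L2_ip_def)
        finally show ?thesis using EL tI by simp
      qed
      have "integral {a..b} (\<lambda>t. L2_ip \<mu> (?P t) (ddtM ?D (\<lambda>\<epsilon>. \<phi>v (\<epsilon>, t)) 0)
          + ?q t * ddt ?D (\<lambda>\<epsilon>. rv (\<epsilon>, t)) 0) = 0"
        using integral_cong[of "{a..b}", OF zero] by simp
      with first_variation[OF g1 g2 I _ _ \<delta> curve, of a b rv \<phi>v] ab v
      show "((\<lambda>\<epsilon>. energy \<mu> g1 g2 a b (\<lambda>t. rv (\<epsilon>, t)) (\<lambda>t. \<phi>v (\<epsilon>, t)))
             has_real_derivative 0) (at 0)"
        by simp
    qed
  }
qed

end

section \<open>Polar coordinates, geodesic equation and great circles\<close>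

lemma ddt_ln:
  assumes g: "smooth_on {0<..} g" "\<And>r. 0 < r \<Longrightarrow> 0 < g r"
    and I: "nontrivial_interval I" "t \<in> I" and r: "smooth_on I r" "0 < r t"
  shows "ddt I (\<lambda>\<tau>. ln (g (r \<tau>))) t = deriv g (r t) * ddt I r t / g (r t)"
proof (rule ddt_eq[OF I])
  have "((\<lambda>\<tau>. g (r \<tau>)) has_real_derivative deriv g (r t) * ddt I r t) (at t within I)"
    by (rule has_real_derivative_compose_within[OF smooth_on_real_ddt(2)[OF r(1) I]
          smooth_on_deriv(2)[OF g(1)]]) (use r(2) in auto)
  from has_real_derivative_compose_within[OF this DERIV_ln[OF g(2)[OF r(2)]]]
  show "((\<lambda>\<tau>. ln (g (r \<tau>))) has_real_derivative deriv g (r t) * ddt I r t / g (r t)) (at t within I)"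
    by (simp add: divide_inverse mult.commute)
qed

context compact_density
begin

lemma smooth_fun_iff_family: "smooth_fun \<A> f \<longleftrightarrow> smooth_family \<A> (UNIV :: real set) (\<lambda>_. f)"
  using smooth_fun_family smooth_family_smooth_fun[of \<A> UNIV "\<lambda>_. f"] by auto

lemma integral_pos:
  fixes h :: "'m \<Rightarrow> real"
  assumes "continuous_on UNIV h" "\<And>x. 0 < h x"
  shows "0 < (\<integral>x. h x \<partial>\<mu>)"
proof -
  have "0 \<le> (\<integral>x. h x \<partial>\<mu>)" by (rule Bochner_Integration.integral_nonneg) (simp add: assms(2) less_imp_le)
  moreover have "(\<integral>x. h x \<partial>\<mu>) \<noteq> 0"
    using integral_nonneg_eq_0D[OF assms(1)] assms(2) by (metis less_imp_le less_irrefl)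
  ultimately show ?thesis by simp
qed

lemma polar_coordinates:
  assumes "\<And>x. 0 < h x"
  shows "Phi_map \<mu> (R_map h) = (sqrt (\<integral>x. h x \<partial>\<mu>), \<lambda>x. sqrt (h x) / sqrt (\<integral>x. h x \<partial>\<mu>))"
  using assms by (simp add: Phi_map_def R_map_def L2_nrm_def L2_ip_def less_imp_le)

lemma polar_family:
  assumes h: "smooth_family \<A> T h" "\<And>t x. t \<in> T \<Longrightarrow> 0 < h t x"
    and r: "\<And>t. t \<in> T \<Longrightarrow> r t = sqrt (\<integral>x. h t x \<partial>\<mu>)"
    and \<phi>: "\<And>t x. t \<in> T \<Longrightarrow> \<phi> t x = sqrt (h t x) / r t"
  shows "smooth_polar \<A> \<mu> (T :: real set) r \<phi>"
    and "\<And>t x. t \<in> T \<Longrightarrow> 0 < \<phi> t x"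
    and "\<And>t x. t \<in> T \<Longrightarrow> h t x = (r t * \<phi> t x)\<^sup>2"
proof -
  have m: "0 < (\<integral>x. h t x \<partial>\<mu>)" if "t \<in> T" for t
    by (rule integral_pos[OF family_slice_continuous[OF h(1) that] h(2)[OF that]])
  have rpos: "0 < r t" if "t \<in> T" for t using m[OF that] r[OF that] by simp
  have sr: "smooth_on T r"
    by (rule smooth_on_cong[THEN iffD1, OF _ smooth_on_sqrt[OF integral_family_smooth[OF h(1)] m]])
       (simp add: r)
  have s\<phi>: "smooth_family \<A> T \<phi>"
    by (rule smooth_family_cong[OF _ smooth_family_mult[OF smooth_family_sqrt[OF h]
            smooth_family_param[OF smooth_on_inverse[OF sr rpos]]]])
       (simp_all add: \<phi> divide_inverse)
  show pos: "0 < \<phi> t x" if "t \<in> T" for t x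
    using rpos[OF that] h(2)[OF that] by (simp add: \<phi>[OF that])
  show sq: "h t x = (r t * \<phi> t x)\<^sup>2" if "t \<in> T" for t x
    using rpos[OF that] h(2)[OF that, of x] by (simp add: \<phi>[OF that])
  have "(\<integral>x. (\<phi> t x)\<^sup>2 \<partial>\<mu>) = 1" if t: "t \<in> T" for t
  proof -
    have "(\<phi> t x)\<^sup>2 = inverse ((r t)\<^sup>2) * h t x" for x
      using rpos[OF t] by (simp add: sq[OF t] power_mult_distrib)
    then have "(\<integral>x. (\<phi> t x)\<^sup>2 \<partial>\<mu>) = inverse ((r t)\<^sup>2) * (\<integral>x. h t x \<partial>\<mu>)" by simp
    also have "(\<integral>x. h t x \<partial>\<mu>) = (r t)\<^sup>2" using m[OF t] by (simp add: r[OF t])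
    finally show ?thesis using rpos[OF t] by simp
  qed
  then show "smooth_polar \<A> \<mu> T r \<phi>"
    using sr s\<phi> rpos smooth_family_smooth_fun[OF s\<phi>] by (simp add: smooth_polar_def smooth_sphere_def)
qed

text \<open>
  The inverse map is \<open>(r, \<phi>) \<mapsto> (r \<phi>)\<^sup>2\<close>. A single density is treated as a constant family.
\<close>

lemma polar_bij:
  "bij_betw (\<lambda>h. Phi_map \<mu> (R_map h)) {h. smooth_fun \<A> h \<and> (\<forall>x. 0 < h x)}
     {(r, \<phi>). 0 < r \<and> \<phi> \<in> smooth_sphere \<A> \<mu> \<and> (\<forall>x. 0 < \<phi> x)}"
proof (rule bij_betw_byWitness[where f' = "\<lambda>(r, \<phi>) x. (r * \<phi> x)\<^sup>2"])
  let ?H = "{h. smooth_fun \<A> h \<and> (\<forall>x. 0 < h x)}"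
  let ?P = "{(r, \<phi>). 0 < r \<and> \<phi> \<in> smooth_sphere \<A> \<mu> \<and> (\<forall>x. 0 < \<phi> x)}"
  have *: "smooth_polar \<A> \<mu> (UNIV :: real set) (\<lambda>_. fst (Phi_map \<mu> (R_map h))) (\<lambda>_. snd (Phi_map \<mu> (R_map h)))"
    "0 < snd (Phi_map \<mu> (R_map h)) x"
    "h x = (fst (Phi_map \<mu> (R_map h)) * snd (Phi_map \<mu> (R_map h)) x)\<^sup>2"
    if "h \<in> ?H" for h x
  proof -
    have f: "smooth_family \<A> (UNIV :: real set) (\<lambda>_. h)" and pos: "\<And>x. 0 < h x"
      using that by (auto simp: smooth_fun_iff_family)
    note polar = polar_coordinates[of h, OF pos]
    have "fst (Phi_map \<mu> (R_map h)) = sqrt (\<integral>x. h x \<partial>\<mu>)"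
      "\<And>x. snd (Phi_map \<mu> (R_map h)) x = sqrt (h x) / fst (Phi_map \<mu> (R_map h))"
      unfolding polar by simp_all
    note pf = polar_family[OF f pos this]
    show "smooth_polar \<A> \<mu> (UNIV :: real set) (\<lambda>_. fst (Phi_map \<mu> (R_map h))) (\<lambda>_. snd (Phi_map \<mu> (R_map h)))"
      by (rule pf(1))
    show "0 < snd (Phi_map \<mu> (R_map h)) x"
      "h x = (fst (Phi_map \<mu> (R_map h)) * snd (Phi_map \<mu> (R_map h)) x)\<^sup>2"
      by (rule pf(2)[OF UNIV_I] pf(3)[OF UNIV_I])+
  qed
  show "\<forall>h\<in>?H. (case Phi_map \<mu> (R_map h) of (r, \<phi>) \<Rightarrow> \<lambda>x. (r * \<phi> x)\<^sup>2) = h"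
  proof
    fix h assume "h \<in> ?H"
    note e = *(3)[OF this, symmetric]
    show "(case Phi_map \<mu> (R_map h) of (r, \<phi>) \<Rightarrow> \<lambda>x. (r * \<phi> x)\<^sup>2) = h"
      unfolding case_prod_beta by (rule ext) (rule e)
  qed
  show "(\<lambda>h. Phi_map \<mu> (R_map h)) ` ?H \<subseteq> ?P"
  proof
    fix z assume "z \<in> (\<lambda>h. Phi_map \<mu> (R_map h)) ` ?H"
    then obtain h where h: "h \<in> ?H" and z: "z = Phi_map \<mu> (R_map h)" by blast
    show "z \<in> ?P" unfolding z mem_Collect_eq case_prod_beta
      using *(1,2)[OF h] by (simp add: smooth_polar_def)
  qed
  show "\<forall>z\<in>?P. Phi_map \<mu> (R_map (case z of (r, \<phi>) \<Rightarrow> \<lambda>x. (r * \<phi> x)\<^sup>2)) = z"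
  proof safe
    fix r \<phi> assume r: "0 < (r::real)" and \<phi>: "\<phi> \<in> smooth_sphere \<A> \<mu>" "\<forall>x. 0 < \<phi> x"
    have "(\<integral>x. (r * \<phi> x)\<^sup>2 \<partial>\<mu>) = r\<^sup>2"
      using \<phi>(1) by (simp add: power_mult_distrib smooth_sphere_def)
    moreover have pos: "0 < (r * \<phi> x)\<^sup>2" "0 \<le> r * \<phi> x" for x
      using r \<phi>(2) by (simp_all add: less_imp_le order_less_imp_not_eq2)
    ultimately show "Phi_map \<mu> (R_map (\<lambda>x. (r * \<phi> x)\<^sup>2)) = (r, \<phi>)"
      using r by (simp add: polar_coordinates[OF pos(1)])
  qed
  show "(\<lambda>(r, \<phi>) x. (r * \<phi> x)\<^sup>2) ` ?P \<subseteq> ?H"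
  proof safe
    fix r \<phi> assume r: "0 < (r::real)" and \<phi>: "\<phi> \<in> smooth_sphere \<A> \<mu>" "\<forall>x. 0 < \<phi> x"
    have f: "smooth_family \<A> UNIV (\<lambda>(_::real). \<phi>)"
      using \<phi>(1) by (simp add: smooth_sphere_def smooth_fun_iff_family)
    note rf = smooth_family_mult[OF smooth_family_param[OF smooth_on_const[of UNIV r]] f]
    show "smooth_fun \<A> (\<lambda>x. (r * \<phi> x)\<^sup>2)"
      unfolding smooth_fun_iff_family power2_eq_square by (rule smooth_family_mult[OF rf rf])
    show "0 < (r * \<phi> x)\<^sup>2" for x
      using r \<phi>(2)[rule_format, of x] by simp
  qed
qed

text \<open>
  With \<open>u = (r \<phi>)\<^sub>t = r\<^sub>t \<phi> + r \<phi>\<^sub>t\<close> one has \<open>h\<^sub>t = 2 r \<phi> u\<close>. Hence the first integral in \<open>G\<close> is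
  \<open>4 \<parallel>u\<parallel>\<^sup>2 = 4 (r\<^sub>t\<^sup>2 + r\<^sup>2 \<parallel>\<phi>\<^sub>t\<parallel>\<^sup>2)\<close>, the second is \<open>2 r \<langle>\<phi>, u\<rangle> = 2 r r\<^sub>t\<close>, and the total mass
  is \<open>r\<^sup>2\<close>.
\<close>

lemma polar_isometry:
  fixes C1 C2 :: "real \<Rightarrow> real"
  assumes I: "nontrivial_interval I" and curve: "smooth_polar \<A> \<mu> I r \<phi>"
    and pos: "\<And>t x. t \<in> I \<Longrightarrow> 0 < \<phi> t x"
    and h: "\<And>t x. t \<in> I \<Longrightarrow> h t x = (r t * \<phi> t x)\<^sup>2" and t: "t \<in> I"
  shows "G_metric C1 C2 (density \<mu> (\<lambda>x. ennreal (h t x)))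
      (\<lambda>x. ddtM I h t x / h t x) (\<lambda>x. ddtM I h t x / h t x) =
    polar_metric \<mu> (\<lambda>r. 4 * C1 (r\<^sup>2) * r\<^sup>2) (\<lambda>r. 4 * (C1 (r\<^sup>2) + C2 (r\<^sup>2) * r\<^sup>2)) (r t)
      (ddt I r t, ddtM I \<phi> t) (ddt I r t, ddtM I \<phi> t)"
proof -
  have r: "smooth_on I r" "0 < r t" and \<phi>: "smooth_family \<A> I \<phi>" "\<And>t. t \<in> I \<Longrightarrow> \<phi> t \<in> smooth_sphere \<A> \<mu>"
    using curve t by (auto simp: smooth_polar_def)
  define \<rho> where "\<rho> = ddt I r t"
  define \<psi> where "\<psi> = ddtM I \<phi> t"
  have c: "continuous_on UNIV (\<phi> t)" "continuous_on UNIV \<psi>"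
    using family_slice_continuous[OF \<phi>(1) t] family_slice_continuous[OF smooth_family_ddtM[OF \<phi>(1) I] t]
    by (auto simp: \<psi>_def)
  define u where "u x = \<rho> * \<phi> t x + r t * \<psi> x" for x
  have cu: "continuous_on UNIV u"
    unfolding u_def by (intro continuous_on_add continuous_on_mult continuous_on_const c)
  have ht: "ddtM I h t x = 2 * (r t * \<phi> t x) * u x" for x
    unfolding ddtM_def
  proof (rule ddt_cong[OF I t _ h])
    have "((\<lambda>\<tau>. r \<tau> * \<phi> \<tau> x) has_real_derivative u x) (at t within I)"
      using DERIV_mult[OF smooth_on_real_ddt(2)[OF r(1) I t] family_has_derivative[OF \<phi>(1) I t, of x]]
      by (simp add: u_def \<rho>_def \<psi>_def algebra_simps)
    from DERIV_power[OF this, of 2]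
    show "((\<lambda>\<tau>. (r \<tau> * \<phi> \<tau> x)\<^sup>2) has_real_derivative 2 * (r t * \<phi> t x) * u x) (at t within I)"
      by (simp add: mult.commute mult.left_commute)
  qed
  have ne: "r t * \<phi> t x \<noteq> 0" for x using r(2) pos[OF t, of x] by simp
  define a where "a x = ddtM I h t x / h t x" for x
  have a: "h t x * a x = 2 * (r t * \<phi> t x) * u x" "h t x * (a x * a x) = 4 * (u x * u x)" for x
    using ne[of x] by (simp_all add: a_def ht h[OF t] power2_eq_square)
  have "a x = 2 * u x / (r t * \<phi> t x)" for x
    using ne[of x] by (simp add: a_def ht h[OF t] power2_eq_square)
  then have "a = (\<lambda>x. 2 * u x / (r t * \<phi> t x))" by auto
  then have ca: "continuous_on UNIV a"
    using ne by (auto intro!: continuous_on_divide continuous_on_mult continuous_on_const c cu)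
  have ch: "continuous_on UNIV (h t)"
    using continuous_on_cong[THEN iffD2, of UNIV UNIV "h t" "\<lambda>x. (r t * \<phi> t x)\<^sup>2"] h[OF t] c
    by (auto intro!: continuous_on_power continuous_on_mult continuous_on_const)
  have dens: "(\<integral>x. f x \<partial>(density \<mu> (\<lambda>x. ennreal (h t x)))) = (\<integral>x. h t x * f x \<partial>\<mu>)"
    if "continuous_on UNIV f" for f :: "'m \<Rightarrow> real"
    using integral_density[of f \<mu> "h t"] that ch h[OF t]
    by (simp add: measurable_cong_sets[OF sets_mu refl] borel_measurable_continuous_onI)
  have u_fun: "(\<lambda>x. \<rho> * \<phi> t x + r t * \<psi> x) = u" by (rule ext) (simp add: u_def)
  note lin = ip_linear_left[OF c cu, of \<rho> "r t", unfolded u_fun]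
    ip_linear_right[OF c c(1), of \<rho> "r t", unfolded u_fun]
    ip_linear_right[OF c c(2), of \<rho> "r t", unfolded u_fun]
  have unit: "L2_ip \<mu> (\<phi> t) (\<phi> t) = 1" by (rule sphere_unit[OF \<phi>(2)[OF t]])
  have orth: "L2_ip \<mu> (\<phi> t) \<psi> = 0" "L2_ip \<mu> \<psi> (\<phi> t) = 0"
    using sphere_orthogonal[OF \<phi>(1) I t \<phi>(2)] by (simp_all add: \<psi>_def L2_ip_commute)
  have u\<phi>: "L2_ip \<mu> (\<phi> t) u = \<rho>" "L2_ip \<mu> \<psi> u = r t * L2_ip \<mu> \<psi> \<psi>"
    using lin(2,3) unit orth by simp_all
  have uu: "L2_ip \<mu> u u = \<rho>\<^sup>2 + (r t)\<^sup>2 * L2_ip \<mu> \<psi> \<psi>"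
    using lin(1) u\<phi> by (simp add: power2_eq_square)
  have mass: "measure (density \<mu> (\<lambda>x. ennreal (h t x))) (space (density \<mu> (\<lambda>x. ennreal (h t x)))) = (r t)\<^sup>2"
  proof -
    have "(\<integral>x. h t x \<partial>\<mu>) = (\<integral>x. (r t)\<^sup>2 * (\<phi> t x * \<phi> t x) \<partial>\<mu>)"
      by (intro Bochner_Integration.integral_cong refl) (simp add: h[OF t] power2_eq_square)
    also have "\<dots> = (r t)\<^sup>2" using unit by (simp add: L2_ip_def)
    finally show ?thesis using dens[of "\<lambda>_. 1"] by simp
  qed
  have "(\<integral>x. a x * a x \<partial>(density \<mu> (\<lambda>x. ennreal (h t x)))) = 4 * L2_ip \<mu> u u"
    using dens[OF continuous_on_mult[OF ca ca]] by (simp add: a(2) L2_ip_def)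
  moreover have "(\<integral>x. a x \<partial>(density \<mu> (\<lambda>x. ennreal (h t x)))) = 2 * r t * \<rho>"
  proof -
    have "(\<integral>x. h t x * a x \<partial>\<mu>) = (\<integral>x. 2 * r t * (\<phi> t x * u x) \<partial>\<mu>)"
      by (simp add: a(1) mult.assoc)
    also have "\<dots> = 2 * r t * L2_ip \<mu> (\<phi> t) u"
      unfolding L2_ip_def by (rule integral_mult_right_zero)
    finally show ?thesis using dens[OF ca] u\<phi>(1) by simp
  qed
  ultimately show ?thesis
    unfolding G_metric_def mass a_def[symmetric] polar_metric_def fst_conv snd_conv
      \<rho>_def[symmetric] \<psi>_def[symmetric]
    by (simp add: uu power2_eq_square algebra_simps)
qed

text \<open>
  Up to the positive factors \<open>g1\<close> and \<open>g2\<close>, the two equations say that the tangential part of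
  \<open>EL_angular\<close> and \<open>EL_radial\<close> vanish.
\<close>

lemma geodesic_equation:
  assumes g1: "smooth_on {0<..} g1" "\<And>r. 0 < r \<Longrightarrow> 0 < g1 r"
    and g2: "smooth_on {0<..} g2" "\<And>r. 0 < r \<Longrightarrow> 0 < g2 r"
    and I: "nontrivial_interval I" and curve: "smooth_polar \<A> \<mu> I r \<phi>"
  shows "geodesic \<A> \<mu> g1 g2 I r \<phi> \<longleftrightarrow>
    (\<forall>t\<in>I. (\<forall>x. sphere_cov_deriv \<mu> I \<phi> (ddtM I \<phi>) t x
                  = - ddt I (\<lambda>\<tau>. ln (g1 (r \<tau>))) t * ddtM I \<phi> t x) \<and>
            ddt I (ddt I r) t
              = 1/2 * (deriv g1 (r t) / g2 (r t)) * L2_ip \<mu> (ddtM I \<phi> t) (ddtM I \<phi> t)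
                - 1/2 * ddt I (\<lambda>\<tau>. ln (g2 (r \<tau>))) t * ddt I r t)"
proof -
  have r: "smooth_on I r" "\<And>t. t \<in> I \<Longrightarrow> 0 < r t"
    and \<phi>: "smooth_family \<A> I \<phi>" "\<And>t. t \<in> I \<Longrightarrow> \<phi> t \<in> smooth_sphere \<A> \<mu>"
    using curve by (auto simp: smooth_polar_def)
  note \<phi>t = smooth_family_ddtM[OF \<phi>(1) I]
  have 1: "sphere_proj \<mu> (\<phi> t) (EL_angular g1 I r \<phi> t) = (\<lambda>x. 0) \<longleftrightarrow>
      (\<forall>x. sphere_cov_deriv \<mu> I \<phi> (ddtM I \<phi>) t x = - ddt I (\<lambda>\<tau>. ln (g1 (r \<tau>))) t * ddtM I \<phi> t x)"
    if t: "t \<in> I" for t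
  proof -
    have g: "0 < g1 (r t)" using g1(2) r(2)[OF t] by blast
    note c = family_slice_continuous[OF \<phi>(1) t] family_slice_continuous[OF \<phi>t t]
      family_slice_continuous[OF smooth_family_ddtM[OF \<phi>t I] t]
    have "L2_ip \<mu> (\<phi> t) (EL_angular g1 I r \<phi> t) = - g1 (r t) * L2_ip \<mu> (\<phi> t) (ddtM I (ddtM I \<phi>) t)"
      using ip_linear_right[OF c(3,2,1), of "- g1 (r t)" "- (deriv g1 (r t) * ddt I r t)"]
        sphere_orthogonal[OF \<phi>(1) I t \<phi>(2)]
      by (simp add: EL_angular_def[abs_def])
    then have e: "sphere_proj \<mu> (\<phi> t) (EL_angular g1 I r \<phi> t) x =
        - g1 (r t) * (sphere_cov_deriv \<mu> I \<phi> (ddtM I \<phi>) t x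
          + ddt I (\<lambda>\<tau>. ln (g1 (r \<tau>))) t * ddtM I \<phi> t x)" for x
      using g ddt_ln[OF g1 I t r(1) r(2)[OF t]]
      by (simp add: sphere_proj_def sphere_cov_deriv_def EL_angular_def field_simps)
    show ?thesis unfolding fun_eq_iff e using g by (simp add: eq_neg_iff_add_eq_0)
  qed
  have 2: "EL_radial \<mu> g1 g2 I r \<phi> t = 0 \<longleftrightarrow>
      ddt I (ddt I r) t = 1/2 * (deriv g1 (r t) / g2 (r t)) * L2_ip \<mu> (ddtM I \<phi> t) (ddtM I \<phi> t)
                - 1/2 * ddt I (\<lambda>\<tau>. ln (g2 (r \<tau>))) t * ddt I r t" if t: "t \<in> I" for t
  proof -
    have g: "0 < g2 (r t)" using g2(2) r(2)[OF t] by blast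
    have "EL_radial \<mu> g1 g2 I r \<phi> t = - g2 (r t) * (ddt I (ddt I r) t
        - (1/2 * (deriv g1 (r t) / g2 (r t)) * L2_ip \<mu> (ddtM I \<phi> t) (ddtM I \<phi> t)
                - 1/2 * ddt I (\<lambda>\<tau>. ln (g2 (r \<tau>))) t * ddt I r t))"
    proof -
      have L: "ddt I (\<lambda>\<tau>. ln (g2 (r \<tau>))) t = deriv g2 (r t) * ddt I r t / g2 (r t)"
        by (rule ddt_ln[OF g2 I t r(1) r(2)[OF t]])
      show ?thesis unfolding L using g by (simp add: EL_radial_def power2_eq_square field_simps)
    qed
    then show ?thesis using g by simp
  qed
  show ?thesis
    unfolding geodesic_iff_Euler_Lagrange[OF g1(1) g2(1) I curve] using 1 2 by simp
qed

text \<open>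
  As \<open>\<phi>\<^sub>t\<close> is tangential, the covariant derivative may replace \<open>\<phi>\<^sub>t\<^sub>t\<close> in \<open>\<langle>\<phi>\<^sub>t\<^sub>t, \<phi>\<^sub>t\<rangle>\<close>. The equation
  turns this into \<open>- (log g1(r))\<^sub>t \<parallel>\<phi>\<^sub>t\<parallel>\<^sup>2\<close>, which compensates the growth of \<open>g1(r)\<^sup>2\<close>.
\<close>

lemma geodesic_speed_constant:
  assumes g1: "smooth_on {0<..} g1" "\<And>r. 0 < r \<Longrightarrow> 0 < g1 r"
    and I: "nontrivial_interval I" and curve: "smooth_polar \<A> \<mu> I r \<phi>"
    and eq: "\<And>t x. t \<in> I \<Longrightarrow> sphere_cov_deriv \<mu> I \<phi> (ddtM I \<phi>) t x
                  = - ddt I (\<lambda>\<tau>. ln (g1 (r \<tau>))) t * ddtM I \<phi> t x"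
  obtains A0 where "\<And>t. t \<in> I \<Longrightarrow> g1 (r t) * L2_nrm \<mu> (ddtM I \<phi> t) = A0"
proof -
  have r: "smooth_on I r" "\<And>t. t \<in> I \<Longrightarrow> 0 < r t"
    and \<phi>: "smooth_family \<A> I \<phi>" "\<And>t. t \<in> I \<Longrightarrow> \<phi> t \<in> smooth_sphere \<A> \<mu>"
    using curve by (auto simp: smooth_polar_def)
  note \<phi>t = smooth_family_ddtM[OF \<phi>(1) I]
  let ?n = "\<lambda>t. L2_ip \<mu> (ddtM I \<phi> t) (ddtM I \<phi> t)"
  have n0: "0 \<le> ?n t" for t by (simp add: L2_ip_def)
  have "((\<lambda>t. (g1 (r t))\<^sup>2 * ?n t) has_real_derivative 0) (at t within I)" if t: "t \<in> I" for t
  proof -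
    note c = family_slice_continuous[OF \<phi>(1) t] family_slice_continuous[OF \<phi>t t]
      family_slice_continuous[OF smooth_family_ddtM[OF \<phi>t I] t]
    have g: "0 < g1 (r t)" using g1(2) r(2)[OF t] by blast
    define k where "k = ddt I (\<lambda>\<tau>. ln (g1 (r \<tau>))) t"
    have "L2_ip \<mu> (ddtM I (ddtM I \<phi>) t) (ddtM I \<phi> t)
        = L2_ip \<mu> (sphere_proj \<mu> (\<phi> t) (ddtM I (ddtM I \<phi>) t)) (ddtM I \<phi> t)"
      using ip_proj[OF \<phi>(2)[OF t] c(3,2) sphere_orthogonal[OF \<phi>(1) I t \<phi>(2)]] by simp
    also have "sphere_proj \<mu> (\<phi> t) (ddtM I (ddtM I \<phi>) t) = (\<lambda>x. (- k) * ddtM I \<phi> t x)"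
      using eq[OF t] by (auto simp: sphere_cov_deriv_def k_def)
    also have "L2_ip \<mu> \<dots> (ddtM I \<phi> t) = - k * ?n t"
      using ip_linear_left[OF c(2,2,2), of "- k" 0] by simp
    finally have e: "L2_ip \<mu> (ddtM I (ddtM I \<phi>) t) (ddtM I \<phi> t) = - k * ?n t" .
    have dg: "((\<lambda>\<tau>. g1 (r \<tau>)) has_real_derivative deriv g1 (r t) * ddt I r t) (at t within I)"
      by (rule has_real_derivative_compose_within[OF smooth_on_real_ddt(2)[OF r(1) I t]
            smooth_on_deriv(2)[OF g1(1)]]) (use r(2)[OF t] in auto)
    note dn = ip_has_derivative[OF \<phi>t \<phi>t I t]
    have k: "deriv g1 (r t) * ddt I r t = k * g1 (r t)"
      using g by (simp add: k_def ddt_ln[OF g1 I t r(1) r(2)[OF t]])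
    have "((\<lambda>t. (g1 (r t))\<^sup>2 * ?n t) has_real_derivative
        2 * g1 (r t) * (k * g1 (r t)) * ?n t + (g1 (r t))\<^sup>2 * (- k * ?n t + - k * ?n t)) (at t within I)"
      using DERIV_mult[OF DERIV_power[OF dg, of 2] dn] unfolding k e
        L2_ip_commute[of \<mu> "ddtM I \<phi> t" "ddtM I (ddtM I \<phi>) t"]
      by (simp add: mult.commute mult.left_commute add.commute)
    then show ?thesis by (simp add: power2_eq_square algebra_simps)
  qed
  then obtain c where c: "\<And>t. t \<in> I \<Longrightarrow> (g1 (r t))\<^sup>2 * ?n t = c"
    using has_field_derivative_zero_constant[OF nontrivial_interval_convex[OF I],
        of "\<lambda>t. (g1 (r t))\<^sup>2 * ?n t"] by blast
  have "g1 (r t) * L2_nrm \<mu> (ddtM I \<phi> t) = sqrt c" if t: "t \<in> I" for t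
  proof -
    have "sqrt c = sqrt ((g1 (r t))\<^sup>2) * sqrt (?n t)"
      unfolding c[OF t, symmetric] by (rule real_sqrt_mult)
    then show ?thesis using g1(2)[OF r(2)[OF t]] by (simp add: L2_nrm_def)
  qed
  then show thesis using that by blast
qed

text \<open>
  The equation prescribes only the tangential part of \<open>\<phi>\<^sub>t\<^sub>t\<close>; its normal part is \<open>- \<parallel>\<phi>\<^sub>t\<parallel>\<^sup>2 \<phi>\<close>, from
  differentiating \<open>\<langle>\<phi>, \<phi>\<^sub>t\<rangle> = 0\<close>. Together they give \<open>(g1(r) \<phi>\<^sub>t)\<^sub>t = - g1(r) \<parallel>\<phi>\<^sub>t\<parallel>\<^sup>2 \<phi>\<close>, so at
  each point \<open>x\<close> the values of \<open>\<phi>\<close> and \<open>w\<close> rotate with angular speed \<open>A0 / g1(r)\<close>, and the combinations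
  \<open>u\<close> and \<open>v\<close> that rotate them back are constant.
\<close>

lemma geodesic_great_circle:
  assumes g1: "smooth_on {0<..} g1" "\<And>r. 0 < r \<Longrightarrow> 0 < g1 r"
    and I: "nontrivial_interval I" and curve: "smooth_polar \<A> \<mu> I r \<phi>"
    and eq: "\<And>t x. t \<in> I \<Longrightarrow> sphere_cov_deriv \<mu> I \<phi> (ddtM I \<phi>) t x
                  = - ddt I (\<lambda>\<tau>. ln (g1 (r \<tau>))) t * ddtM I \<phi> t x"
    and A0: "\<And>t. t \<in> I \<Longrightarrow> g1 (r t) * L2_nrm \<mu> (ddtM I \<phi> t) = A0"
    and t: "0 \<in> I" "t \<in> I" and nz: "ddtM I \<phi> 0 \<noteq> (\<lambda>x. 0)"
  defines "\<omega> \<equiv> L2_nrm \<mu> (ddtM I \<phi> 0)"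
    and "\<alpha> \<equiv> \<lambda>t. g1 (r 0) * (LBINT \<tau>=0..ereal t. 1 / g1 (r \<tau>))"
  shows "\<phi> t x = cos (\<omega> * \<alpha> t) * \<phi> 0 x + sin (\<omega> * \<alpha> t) * (ddtM I \<phi> 0 x / \<omega>)"
proof -
  have r: "smooth_on I r" "\<And>t. t \<in> I \<Longrightarrow> 0 < r t"
    and \<phi>: "smooth_family \<A> I \<phi>" "\<And>t. t \<in> I \<Longrightarrow> \<phi> t \<in> smooth_sphere \<A> \<mu>"
    using curve by (auto simp: smooth_polar_def)
  note \<phi>t = smooth_family_ddtM[OF \<phi>(1) I]
  have gpos: "0 < g1 (r \<tau>)" if "\<tau> \<in> I" for \<tau> using g1(2) r(2)[OF that] by blast
  have \<omega>: "0 < \<omega>"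
  proof -
    have c: "continuous_on UNIV (ddtM I \<phi> 0)" by (rule family_slice_continuous[OF \<phi>t t(1)])
    have "0 \<le> \<omega>" by (simp add: \<omega>_def L2_nrm_def L2_ip_def)
    moreover have "\<omega> \<noteq> 0"
    proof
      assume "\<omega> = 0"
      then have "(\<integral>x. ddtM I \<phi> 0 x * ddtM I \<phi> 0 x \<partial>\<mu>) = 0"
        by (simp add: \<omega>_def L2_nrm_def L2_ip_def)
      from integral_nonneg_eq_0D[OF continuous_on_mult[OF c c] _ this]
      have "ddtM I \<phi> 0 x = 0" for x by simp
      with nz show False by auto
    qed
    ultimately show ?thesis by simp
  qed
  have A0\<omega>: "A0 = g1 (r 0) * \<omega>" using A0[OF t(1)] by (simp add: \<omega>_def)
  have A0pos: "0 < A0" using gpos[OF t(1)] \<omega> by (simp add: A0\<omega>)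
  \<comment> \<open>\<open>t\<close> may be negative, and the fundamental theorem needs a compact interval containing \<open>0\<close> and \<open>t\<close>\<close>
  define K where "K = {min 0 t..max 0 t}"
  have K: "K \<subseteq> I" "0 \<in> K" "t \<in> K" "convex K"
  proof -
    have "K = closed_segment 0 t" by (auto simp: K_def closed_segment_eq_real_ivl)
    then show "K \<subseteq> I"
      using closed_segment_subset[OF t nontrivial_interval_convex[OF I]] by simp
  qed (auto simp: K_def)
  define \<theta> where "\<theta> \<tau> = \<omega> * \<alpha> \<tau>" for \<tau>
  have d\<theta>: "(\<theta> has_real_derivative A0 / g1 (r \<tau>)) (at \<tau> within K)" if \<tau>: "\<tau> \<in> K" for \<tau>
  proof -
    have "continuous_on I (\<lambda>\<tau>. g1 (r \<tau>))"
      by (rule smooth_on_continuous[OF smooth_on_compose[OF g1(1) r(1)]]) (use r(2) in auto)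
    from continuous_on_subset[OF this K(1)] have "continuous_on K (\<lambda>\<tau>. 1 / g1 (r \<tau>))"
      by (rule continuous_on_divide[OF continuous_on_const]) (use K(1) gpos in fastforce)
    from interval_integral_FTC2[of "min 0 t" 0 "max 0 t", OF _ _ this[unfolded K_def], of \<tau>] \<tau>
    have "((\<lambda>u. LBINT \<tau>=0..ereal u. 1 / g1 (r \<tau>)) has_real_derivative 1 / g1 (r \<tau>)) (at \<tau> within K)"
      by (simp add: K_def has_real_derivative_iff_has_vector_derivative zero_ereal_def)
    from DERIV_cmult[OF this, of "\<omega> * g1 (r 0)"] show ?thesis
      by (simp add: \<theta>_def[abs_def] \<alpha>_def A0\<omega> mult.assoc mult.commute mult.left_commute)
  qed
  define w where "w \<tau> = g1 (r \<tau>) * ddtM I \<phi> \<tau> x / A0" for \<tau>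
  have d\<phi>: "((\<lambda>\<tau>. \<phi> \<tau> x) has_real_derivative A0 / g1 (r \<tau>) * w \<tau>) (at \<tau> within K)"
    if \<tau>: "\<tau> \<in> K" for \<tau>
  proof -
    have \<tau>I: "\<tau> \<in> I" using \<tau> K(1) by blast
    have "A0 / g1 (r \<tau>) * w \<tau> = ddtM I \<phi> \<tau> x"
      using A0pos gpos[OF \<tau>I] by (simp add: w_def)
    then show ?thesis
      using has_field_derivative_subset[OF family_has_derivative[OF \<phi>(1) I \<tau>I] K(1)] by simp
  qed
  have dw: "(w has_real_derivative - (A0 / g1 (r \<tau>)) * \<phi> \<tau> x) (at \<tau> within K)"
    if \<tau>: "\<tau> \<in> K" for \<tau>
  proof -
    have \<tau>I: "\<tau> \<in> I" using \<tau> K(1) by blast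
    have g: "0 < g1 (r \<tau>)" by (rule gpos[OF \<tau>I])
    note c = family_slice_continuous[OF \<phi>(1) \<tau>I] family_slice_continuous[OF \<phi>t \<tau>I]
      family_slice_continuous[OF smooth_family_ddtM[OF \<phi>t I] \<tau>I]
    define n where "n = L2_ip \<mu> (ddtM I \<phi> \<tau>) (ddtM I \<phi> \<tau>)"
    have n: "(g1 (r \<tau>))\<^sup>2 * n = A0\<^sup>2"
      using A0[OF \<tau>I, symmetric] by (simp add: L2_nrm_def n_def power_mult_distrib L2_ip_def)
    have orth: "((\<lambda>\<tau>. L2_ip \<mu> (\<phi> \<tau>) (ddtM I \<phi> \<tau>)) has_real_derivative 0) (at \<tau> within I)"
      by (rule has_real_derivative_cong_on[OF \<tau>I, of _ "\<lambda>_. 0"])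
         (use sphere_orthogonal[OF \<phi>(1) I _ \<phi>(2)] in auto)
    have "L2_ip \<mu> (\<phi> \<tau>) (ddtM I (ddtM I \<phi>) \<tau>) = - n"
      using ddt_eq[OF I \<tau>I orth] ddt_eq[OF I \<tau>I ip_has_derivative[OF \<phi>(1) \<phi>t I \<tau>I]]
      by (simp add: n_def)
    then have acc: "ddtM I (ddtM I \<phi>) \<tau> x
        = - n * \<phi> \<tau> x - ddt I (\<lambda>\<tau>. ln (g1 (r \<tau>))) \<tau> * ddtM I \<phi> \<tau> x"
      using eq[OF \<tau>I, of x] by (simp add: sphere_cov_deriv_def sphere_proj_def)
    have dg: "((\<lambda>\<tau>. g1 (r \<tau>)) has_real_derivative deriv g1 (r \<tau>) * ddt I r \<tau>) (at \<tau> within I)"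
      by (rule has_real_derivative_compose_within[OF smooth_on_real_ddt(2)[OF r(1) I \<tau>I]
            smooth_on_deriv(2)[OF g1(1)]]) (use r(2)[OF \<tau>I] in auto)
    have "(w has_real_derivative (deriv g1 (r \<tau>) * ddt I r \<tau> * ddtM I \<phi> \<tau> x
        + g1 (r \<tau>) * ddtM I (ddtM I \<phi>) \<tau> x) / A0) (at \<tau> within I)"
      unfolding w_def[abs_def]
      using DERIV_cdivide[OF DERIV_mult[OF dg family_has_derivative[OF \<phi>t I \<tau>I, of x]], of A0]
      by (simp add: mult.commute)
    moreover have "(deriv g1 (r \<tau>) * ddt I r \<tau> * ddtM I \<phi> \<tau> x
        + g1 (r \<tau>) * ddtM I (ddtM I \<phi>) \<tau> x) / A0 = - (A0 / g1 (r \<tau>)) * \<phi> \<tau> x"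
    proof -
      have "g1 (r \<tau>) * ddt I (\<lambda>\<tau>. ln (g1 (r \<tau>))) \<tau> = deriv g1 (r \<tau>) * ddt I r \<tau>"
        using g by (simp add: ddt_ln[OF g1 I \<tau>I r(1) r(2)[OF \<tau>I]])
      then have "deriv g1 (r \<tau>) * ddt I r \<tau> * ddtM I \<phi> \<tau> x
        + g1 (r \<tau>) * ddtM I (ddtM I \<phi>) \<tau> x = - (g1 (r \<tau>) * n) * \<phi> \<tau> x"
        unfolding acc by (simp add: right_diff_distrib mult.assoc[symmetric])
      also have "g1 (r \<tau>) * n = A0 * (A0 / g1 (r \<tau>))"
        using n g by (simp add: power2_eq_square field_simps)
      finally show ?thesis using A0pos by simp
    qed
    ultimately show ?thesis using has_field_derivative_subset[OF _ K(1)] by simp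
  qed
  define u where "u \<tau> = cos (\<theta> \<tau>) * \<phi> \<tau> x - sin (\<theta> \<tau>) * w \<tau>" for \<tau>
  define v where "v \<tau> = sin (\<theta> \<tau>) * \<phi> \<tau> x + cos (\<theta> \<tau>) * w \<tau>" for \<tau>
  have "(u has_real_derivative 0) (at \<tau> within K)" "(v has_real_derivative 0) (at \<tau> within K)"
    if \<tau>: "\<tau> \<in> K" for \<tau>
    unfolding u_def[abs_def] v_def[abs_def]
    by (rule derivative_eq_intros d\<theta>[OF \<tau>] d\<phi>[OF \<tau>] dw[OF \<tau>] refl | simp add: algebra_simps; fail)+
  then have "u t = u 0" "v t = v 0"
    using has_field_derivative_zero_constant[OF K(4), of u] has_field_derivative_zero_constant[OF K(4), of v] K(2,3)
    by metis+
  moreover have "\<theta> 0 = 0" by (simp add: \<theta>_def \<alpha>_def zero_ereal_def)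
  moreover have "w 0 = ddtM I \<phi> 0 x / \<omega>"
    using gpos[OF t(1)] by (simp add: w_def A0\<omega>)
  ultimately have uv: "u t = \<phi> 0 x" "v t = ddtM I \<phi> 0 x / \<omega>"
    by (simp_all add: u_def v_def)
  have "cos (\<theta> t) * cos (\<theta> t) + sin (\<theta> t) * sin (\<theta> t) = 1"
    by (simp add: power2_eq_square[symmetric])
  then have "\<phi> t x = (cos (\<theta> t) * cos (\<theta> t) + sin (\<theta> t) * sin (\<theta> t)) * \<phi> t x"
    by (simp only: mult_1_left)
  also have "\<dots> = cos (\<theta> t) * u t + sin (\<theta> t) * v t"
    unfolding u_def v_def by algebra
  finally show ?thesis by (simp add: uv \<theta>_def)
qed

end

section \<open>The arc length coordinate and the theorem\<close>

text \<open>
  The base point \<open>1\<close> may lie on either side of \<open>r\<close>, whence the interval from below to above both.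
\<close>

lemma arclength_has_derivative:
  fixes g2 :: "real \<Rightarrow> real"
  assumes "continuous_on {0<..} g2" "0 < r"
  shows "((\<lambda>r. LBINT \<rho>=1..ereal r. sqrt (g2 \<rho>)) has_real_derivative sqrt (g2 r)) (at r)"
proof -
  \<comment> \<open>strict inequalities around \<open>r\<close> make the derivative two-sided, and \<open>l > 0\<close> keeps \<open>g2\<close> continuous\<close>
  define l u where "l = min r 1 / 2" and "u = max r 1 + 1"
  have lu: "0 < l" "l < r" "r < u" "l \<le> 1" "1 \<le> u" using assms(2) by (auto simp: l_def u_def)
  have "continuous_on {l..u} (\<lambda>\<rho>. sqrt (g2 \<rho>))"
    using lu by (intro continuous_on_real_sqrt continuous_on_subset[OF assms(1)]) auto
  from interval_integral_FTC2[OF lu(4,5) this, of r] lu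
  have "((\<lambda>r. LBINT \<rho>=ereal 1..ereal r. sqrt (g2 \<rho>)) has_vector_derivative sqrt (g2 r)) (at r within {l..u})"
    by simp
  then show ?thesis
    by (simp add: at_within_Icc_at[OF lu(2,3)] has_real_derivative_iff_has_vector_derivative one_ereal_def)
qed

lemma smooth_on_antiderivative:
  fixes f g :: "real \<Rightarrow> real"
  assumes "open S" "smooth_on S g" "\<And>x. x \<in> S \<Longrightarrow> (f has_real_derivative g x) (at x)"
  shows "smooth_on S f"
proof (rule smooth_onI)
  fix x assume x: "x \<in> S"
  obtain U h where U: "open U" "x \<in> U" "\<And>k. Ck_on k U h" "\<And>y. y \<in> S \<Longrightarrow> y \<in> U \<Longrightarrow> h y = g y"
    using smooth_onE[OF assms(2) x] by blast
  let ?O = "U \<inter> S"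
  have "open ?O" using U(1) assms(1) by blast
  have "Ck_on k ?O g" for k
    by (rule Ck_on_cong[OF \<open>open ?O\<close> _ Ck_on_subset[OF U(3)]]) (use U(4) in auto)
  then have "Ck_on (Suc k) ?O f" for k
    by (intro Ck_on_SucI_real[of _ f g]) (use assms(3) in auto)
  then have "Ck_on k ?O f" for k by (rule Ck_on_SucD)
  then show "\<exists>U g. open U \<and> x \<in> U \<and> (\<forall>k. Ck_on k U g) \<and> (\<forall>y\<in>S \<inter> U. g y = f y)"
    using \<open>open ?O\<close> U(2) x by (intro exI[of _ ?O] exI[of _ f]) auto
qed

lemma inj_on_pos_derivative:
  fixes W :: "real \<Rightarrow> real"
  assumes "\<And>r. 0 < r \<Longrightarrow> (W has_real_derivative w r) (at r)" "\<And>r. 0 < r \<Longrightarrow> 0 < w r"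
  shows "inj_on W {0<..}"
proof (rule linorder_inj_onI')
  fix x y :: real assume "x \<in> {0<..}" "y \<in> {0<..}" "x < y"
  have "W x < W y"
  proof (rule DERIV_pos_imp_increasing[OF \<open>x < y\<close>])
    show "\<exists>d. (W has_real_derivative d) (at z) \<and> 0 < d" if "x \<le> z" for z
      using assms[of z] that \<open>x \<in> {0<..}\<close> by (intro exI[of _ "w z"]) auto
  qed
  then show "W x \<noteq> W y" by simp
qed

lemma has_derivative_inv_into:
  fixes W :: "real \<Rightarrow> real"
  assumes "\<And>r. 0 < r \<Longrightarrow> (W has_real_derivative w r) (at r)" "\<And>r. 0 < r \<Longrightarrow> 0 < w r" "0 < r"
  shows "(inv_into {0<..} W has_real_derivative inverse (w r)) (at (W r))"
  unfolding has_field_derivative_def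
proof (rule has_derivative_inverse_strong[of "{0<..}" r W _ "(*) (w r)"])
  show "continuous_on {0<..} W"
    using assms(1) by (intro continuous_at_imp_continuous_on ballI) (auto dest: DERIV_isCont)
  show "inv_into {0<..} W (W x) = x" if "x \<in> {0<..}" for x
    by (rule inv_into_f_f[OF inj_on_pos_derivative[OF assms(1,2)] that])
  show "(W has_derivative (*) (w r)) (at r)"
    using assms(1)[OF assms(3)] by (simp add: has_field_derivative_def)
  show "(*) (w r) \<circ> (*) (inverse (w r)) = id"
    using assms(2)[OF assms(3)] by (auto simp: fun_eq_iff)
qed (use assms(3) in auto)

text \<open>
  Since \<open>s\<^sub>t = sqrt (g2(r)) r\<^sub>t\<close>, the derivative of the factor \<open>sqrt (g2(r))\<close> cancels the logarithmic
  derivative of \<open>g2\<close> in the equation for \<open>r\<close>.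
\<close>

lemma arclength_equation:
  fixes g1 g2 W a r :: "real \<Rightarrow> real"
  assumes g1: "smooth_on {0<..} g1" "\<And>r. 0 < r \<Longrightarrow> 0 < g1 r"
    and g2: "smooth_on {0<..} g2" "\<And>r. 0 < r \<Longrightarrow> 0 < g2 r"
    and I: "nontrivial_interval I" and r: "smooth_on I r" "\<And>t. t \<in> I \<Longrightarrow> 0 < r t"
    and W: "\<And>r. 0 < r \<Longrightarrow> (W has_real_derivative sqrt (g2 r)) (at r)"
    and a: "\<And>r. 0 < r \<Longrightarrow> a (W r) = g1 r" "\<And>r. 0 < r \<Longrightarrow> deriv a (W r) = deriv g1 r / sqrt (g2 r)"
    and eq: "\<And>t. t \<in> I \<Longrightarrow> ddt I (ddt I r) t
      = A0\<^sup>2 / 2 * (deriv g1 (r t) / ((g1 (r t))\<^sup>2 * g2 (r t)))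
        - 1/2 * ddt I (\<lambda>\<tau>. ln (g2 (r \<tau>))) t * ddt I r t"
  defines "s \<equiv> \<lambda>t. W (r t)"
  shows "\<And>t. t \<in> I \<Longrightarrow> ddt I (ddt I s) t = A0\<^sup>2 / 2 * (deriv a (s t) / (a (s t))\<^sup>2)"
    and "\<exists>A1. \<forall>t\<in>I. (ddt I s t)\<^sup>2 = - A0\<^sup>2 / a (s t) + A1"
proof -
  define w where "w t = sqrt (g2 (r t))" for t
  have w: "0 < w t" "g2 (r t) = (w t)\<^sup>2" if "t \<in> I" for t
    using g2(2)[OF r(2)[OF that]] by (simp_all add: w_def)
  have gpos: "0 < g1 (r t)" if "t \<in> I" for t using g1(2) r(2)[OF that] by blast
  have dr: "(r has_real_derivative ddt I r t) (at t within I)"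
    and drt: "(ddt I r has_real_derivative ddt I (ddt I r) t) (at t within I)" if "t \<in> I" for t
    using smooth_on_real_ddt(2)[OF r(1) I that]
      smooth_on_real_ddt(2)[OF smooth_on_real_ddt(1)[OF r(1) I] I that] by auto
  have dg: "((\<lambda>\<tau>. G (r \<tau>)) has_real_derivative deriv G (r t) * ddt I r t) (at t within I)"
    if "smooth_on {0<..} G" "t \<in> I" for G t
    by (rule has_real_derivative_compose_within[OF dr[OF that(2)] smooth_on_deriv(2)[OF that(1)]])
       (use r(2)[OF that(2)] in auto)
  have st: "ddt I s t = w t * ddt I r t" if t: "t \<in> I" for t
    unfolding s_def w_def
    by (rule ddt_eq[OF I t has_real_derivative_compose_within[OF dr[OF t] W[OF r(2)[OF t]]]])
  have dw: "(w has_real_derivative inverse (w t) / 2 * (deriv g2 (r t) * ddt I r t)) (at t within I)"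
    if t: "t \<in> I" for t
    unfolding w_def[abs_def]
    by (rule has_real_derivative_compose_within[OF dg[OF g2(1) t] DERIV_real_sqrt[OF g2(2)[OF r(2)[OF t]]]])
  define S where "S t = A0\<^sup>2 / 2 * ((deriv g1 (r t) / w t) / (g1 (r t))\<^sup>2)" for t
  have dst: "(ddt I s has_real_derivative S t) (at t within I)" if t: "t \<in> I" for t
  proof (rule has_real_derivative_cong_on[OF t st])
    have "x / 2 * (d * v) * v + (A / 2 * (e / (g\<^sup>2 * y\<^sup>2)) - 1/2 * (d * v / y\<^sup>2) * v) * y
        = A / 2 * ((e / y) / g\<^sup>2)" if "x = inverse y" "y \<noteq> 0" "g \<noteq> 0" for x d v A e g y :: real
      using that by (simp add: field_simps power2_eq_square)
    from this[OF refl, of "w t" "g1 (r t)" "deriv g2 (r t)" "ddt I r t" "A0\<^sup>2" "deriv g1 (r t)"]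
    have e: "inverse (w t) / 2 * (deriv g2 (r t) * ddt I r t) * ddt I r t + ddt I (ddt I r) t * w t = S t"
      using w[OF t] gpos[OF t] by (simp add: S_def eq[OF t] ddt_ln[OF g2 I t r(1) r(2)[OF t]])
    show "((\<lambda>t. w t * ddt I r t) has_real_derivative S t) (at t within I)"
      using DERIV_mult[OF dw[OF t] drt[OF t]] unfolding e .
  qed
  have as: "a (s t) = g1 (r t)" "deriv a (s t) = deriv g1 (r t) / w t" if "t \<in> I" for t
    using a[OF r(2)[OF that]] by (simp_all add: s_def w_def)
  show "ddt I (ddt I s) t = A0\<^sup>2 / 2 * (deriv a (s t) / (a (s t))\<^sup>2)" if t: "t \<in> I" for t
    using ddt_eq[OF I t dst[OF t]] by (simp add: S_def as[OF t])
  have "((\<lambda>t. (ddt I s t)\<^sup>2 + A0\<^sup>2 / g1 (r t)) has_real_derivative 0) (at t within I)" if t: "t \<in> I" for t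
  proof -
    have g0: "g1 (r t) \<noteq> 0" and w0: "w t \<noteq> 0" using gpos[OF t] w(1)[OF t] by auto
    have "((\<lambda>t. (ddt I s t)\<^sup>2 + A0\<^sup>2 * inverse (g1 (r t))) has_real_derivative
        2 * (S t * ddt I s t)
        + A0\<^sup>2 * (- (inverse (g1 (r t)) * (deriv g1 (r t) * ddt I r t) * inverse (g1 (r t)))))
        (at t within I)"
      using DERIV_add[OF DERIV_power[OF dst[OF t], of 2] DERIV_cmult[OF DERIV_inverse'[OF dg[OF g1(1) t] g0], of "A0\<^sup>2"]]
      by simp
    moreover have "2 * (S t * ddt I s t)
        + A0\<^sup>2 * (- (inverse (g1 (r t)) * (deriv g1 (r t) * ddt I r t) * inverse (g1 (r t)))) = 0"
      using g0 w0 by (simp add: st[OF t] S_def field_simps power2_eq_square)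
    ultimately show ?thesis by (simp add: divide_inverse)
  qed
  then obtain A1 where A1: "\<forall>t\<in>I. (ddt I s t)\<^sup>2 + A0\<^sup>2 / g1 (r t) = A1"
    using has_field_derivative_zero_constant[OF nontrivial_interval_convex[OF I],
        of "\<lambda>t. (ddt I s t)\<^sup>2 + A0\<^sup>2 / g1 (r t)"] by blast
  show "\<exists>A1. \<forall>t\<in>I. (ddt I s t)\<^sup>2 = - A0\<^sup>2 / a (s t) + A1"
  proof (intro exI[of _ A1] ballI)
    fix t assume t: "t \<in> I"
    from A1[rule_format, OF t] show "(ddt I s t)\<^sup>2 = - A0\<^sup>2 / a (s t) + A1"
      unfolding as(1)[OF t] by simp
  qed
qed

theorem mainTheorem1:
  fixes \<A> :: "('m::{t2_space,second_countable_topology}, 'e::euclidean_space) chart set"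
    and \<mu>0 :: "'m measure"
    and C1 C2 g1 g2 W a :: "real \<Rightarrow> real"
    and I :: "real set"
  assumes M: "compact_manifold_with_corners \<A>"
    and \<mu>0: "smooth_positive_density \<A> \<mu>0" "emeasure \<mu>0 UNIV = 1"
    and C_smooth: "smooth_on {0<..} C1" "smooth_on {0<..} C2"
    and C1_pos: "\<And>m. m > 0 \<Longrightarrow> C1 m > 0"
    and C2_bound: "\<And>m. m > 0 \<Longrightarrow> C2 m > - (1 / m) * C1 m"
    and g1: "g1 = (\<lambda>r. 4 * C1 (r\<^sup>2) * r\<^sup>2)"
    and g2: "g2 = (\<lambda>r. 4 * (C1 (r\<^sup>2) + C2 (r\<^sup>2) * r\<^sup>2))"
    and W: "W = (\<lambda>r. LBINT \<rho>=1..ereal r. sqrt (g2 \<rho>))"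
    and a: "a = (\<lambda>s. let r = inv_into {0<..} W s in 4 * C1 (r\<^sup>2) * r\<^sup>2)"
    and I: "is_interval I" "0 \<in> I" "interior I \<noteq> {}"
  shows
    \<comment> \<open>polar representation of the metric on positive densities\<close>
    "bij_betw (\<lambda>h. Phi_map \<mu>0 (R_map h))
       {h. smooth_fun \<A> h \<and> (\<forall>x. 0 < h x)}
       {(r, \<phi>). 0 < r \<and> \<phi> \<in> smooth_sphere \<A> \<mu>0 \<and> (\<forall>x. 0 < \<phi> x)} \<and>
     (\<forall>h. smooth_family \<A> I h \<and> (\<forall>t\<in>I. \<forall>x. 0 < h t x) \<longrightarrow>
       (let \<mu> = (\<lambda>t. density \<mu>0 (\<lambda>x. ennreal (h t x)));
            \<mu>\<^sub>t = (\<lambda>t x. ddtM I h t x / h t x);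
            r = (\<lambda>t. fst (Phi_map \<mu>0 (R_map (h t))));
            \<phi> = (\<lambda>t. snd (Phi_map \<mu>0 (R_map (h t))))
        in smooth_polar \<A> \<mu>0 I r \<phi> \<and>
           (\<forall>t\<in>I. G_metric C1 C2 (\<mu> t) (\<mu>\<^sub>t t) (\<mu>\<^sub>t t) =
              polar_metric \<mu>0 g1 g2 (r t) (ddt I r t, ddtM I \<phi> t) (ddt I r t, ddtM I \<phi> t)))) \<and>
     \<comment> \<open>geodesic equation\<close>
     (\<forall>r \<phi>. smooth_polar \<A> \<mu>0 I r \<phi> \<longrightarrow>
       (geodesic \<A> \<mu>0 g1 g2 I r \<phi> \<longleftrightarrow>
         (\<forall>t\<in>I.
            (\<forall>x. sphere_cov_deriv \<mu>0 I \<phi> (ddtM I \<phi>) t x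
                   = - ddt I (\<lambda>\<tau>. ln (g1 (r \<tau>))) t * ddtM I \<phi> t x) \<and>
            ddt I (ddt I r) t
              = 1/2 * (deriv g1 (r t) / g2 (r t)) * L2_ip \<mu>0 (ddtM I \<phi> t) (ddtM I \<phi> t)
                - 1/2 * ddt I (\<lambda>\<tau>. ln (g2 (r \<tau>))) t * ddt I r t))) \<and>
     \<comment> \<open>the coordinate s\<close>
     (smooth_on {0<..} W \<and> inj_on W {0<..} \<and>
       (\<forall>r>0. \<exists>w>0. (W has_real_derivative w) (at r) \<and>
          (\<forall>\<rho> \<sigma> \<psi> \<zeta>. polar_metric \<mu>0 g1 g2 r (\<rho>, \<psi>) (\<sigma>, \<zeta>)
                      = a (W r) * L2_ip \<mu>0 \<psi> \<zeta> + (w * \<rho>) * (w * \<sigma>)))) \<and>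
     \<comment> \<open>properties of geodesics\<close>
     (\<forall>r \<phi>. geodesic \<A> \<mu>0 g1 g2 I r \<phi> \<longrightarrow>
       (\<exists>A0.
          (\<forall>t\<in>I. g1 (r t) * L2_nrm \<mu>0 (ddtM I \<phi> t) = A0) \<and>
          (\<forall>t\<in>I. ddt I (ddt I r) t
             = A0\<^sup>2 / 2 * (deriv g1 (r t) / ((g1 (r t))\<^sup>2 * g2 (r t)))
               - 1/2 * ddt I (\<lambda>\<tau>. ln (g2 (r \<tau>))) t * ddt I r t) \<and>
          (let s = (\<lambda>t. W (r t)) in
             (\<forall>t\<in>I. A0 = a (s t) * L2_nrm \<mu>0 (ddtM I \<phi> t)) \<and>
             (\<forall>t\<in>I. ddt I (ddt I s) t = A0\<^sup>2 / 2 * (deriv a (s t) / (a (s t))\<^sup>2)) \<and>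
             (\<exists>A1. \<forall>t\<in>I. (ddt I s t)\<^sup>2 = - A0\<^sup>2 / a (s t) + A1))) \<and>
       (\<forall>\<phi>0 \<psi>0. \<phi> 0 = \<phi>0 \<and> ddtM I \<phi> 0 = \<psi>0 \<and> \<psi>0 \<noteq> (\<lambda>x. 0) \<longrightarrow>
          (let \<alpha> = (\<lambda>t. g1 (r 0) * (LBINT \<tau>=0..ereal t. 1 / g1 (r \<tau>))) in
             \<forall>t\<in>I. \<forall>x. \<phi> t x
               = cos (L2_nrm \<mu>0 \<psi>0 * \<alpha> t) * \<phi>0 x
                 + sin (L2_nrm \<mu>0 \<psi>0 * \<alpha> t) * (\<psi>0 x / L2_nrm \<mu>0 \<psi>0))))"
proof -
  interpret compact_density \<A> \<mu>0
    by (rule compact_density.intro[OF M \<mu>0])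
  have J: "nontrivial_interval I" using I(1,3) by (simp add: nontrivial_interval_def)
  have sq: "smooth_on {0<..} (\<lambda>r::real. r\<^sup>2)"
    unfolding power2_eq_square
    by (intro smooth_on_mult smooth_on_bounded_linear bounded_linear_ident)
  have sC: "smooth_on {0<..} (\<lambda>r::real. C1 (r\<^sup>2))" "smooth_on {0<..} (\<lambda>r::real. C2 (r\<^sup>2))"
    by (rule smooth_on_compose[OF C_smooth(1) sq] smooth_on_compose[OF C_smooth(2) sq]; simp)+
  have sg1: "smooth_on {0<..} g1" unfolding g1
    by (intro smooth_on_mult smooth_on_const sC sq)
  have sg2: "smooth_on {0<..} g2" unfolding g2
    by (intro smooth_on_mult smooth_on_add smooth_on_const sC sq)
  have pg1: "0 < g1 r" if "0 < r" for r
    using C1_pos[of "r\<^sup>2"] that by (simp add: g1)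
  have pg2: "0 < g2 r" if "0 < r" for r
  proof -
    have p: "0 < r\<^sup>2" using that by simp
    from C2_bound[OF p] p have "- C1 (r\<^sup>2) < C2 (r\<^sup>2) * r\<^sup>2"
      by (simp add: field_simps)
    then show ?thesis by (simp add: g2)
  qed
  have dW: "(W has_real_derivative sqrt (g2 r)) (at r)" if "0 < r" for r
    unfolding W by (rule arclength_has_derivative[OF smooth_on_continuous[OF sg2] that])
  have pw: "0 < sqrt (g2 r)" if "0 < r" for r using pg2[OF that] by simp
  have injW: "inj_on W {0<..}" by (rule inj_on_pos_derivative[OF dW pw])
  have a': "a = (\<lambda>s. g1 (inv_into {0<..} W s))" by (simp add: a g1 Let_def)
  have aW: "a (W r) = g1 r" if "0 < r" for r
    using inv_into_f_f[OF injW, of r] that by (simp add: a')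
  have daW: "deriv a (W r) = deriv g1 r / sqrt (g2 r)" if "0 < r" for r
  proof (rule DERIV_imp_deriv)
    have e: "inv_into {0<..} W (W r) = r" using inv_into_f_f[OF injW, of r] that by simp
    have "(g1 has_real_derivative deriv g1 r) (at (inv_into {0<..} W (W r)))"
      unfolding e by (rule smooth_on_deriv(2)[OF sg1]) (use that in auto)
    from DERIV_chain2[OF this has_derivative_inv_into[OF dW pw that]]
    show "(a has_real_derivative deriv g1 r / sqrt (g2 r)) (at (W r))"
      by (simp add: a' divide_inverse)
  qed
  have sW: "smooth_on {0<..} W"
  proof (rule smooth_on_antiderivative[of "{0<..}" "\<lambda>r. sqrt (g2 r)"])
    show "smooth_on {0<..} (\<lambda>r. sqrt (g2 r))"
      by (rule smooth_on_sqrt[OF sg2]) (use pg2 in auto)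
  qed (use dW in auto)
  have geq: "geodesic \<A> \<mu>0 g1 g2 I r \<phi> \<longleftrightarrow>
         (\<forall>t\<in>I.
            (\<forall>x. sphere_cov_deriv \<mu>0 I \<phi> (ddtM I \<phi>) t x
                   = - ddt I (\<lambda>\<tau>. ln (g1 (r \<tau>))) t * ddtM I \<phi> t x) \<and>
            ddt I (ddt I r) t
              = 1/2 * (deriv g1 (r t) / g2 (r t)) * L2_ip \<mu>0 (ddtM I \<phi> t) (ddtM I \<phi> t)
                - 1/2 * ddt I (\<lambda>\<tau>. ln (g2 (r \<tau>))) t * ddt I r t)"
    if "smooth_polar \<A> \<mu>0 I r \<phi>" for r \<phi>
    by (rule geodesic_equation[OF sg1 pg1 sg2 pg2 J that])

  have polar: "\<forall>h. smooth_family \<A> I h \<and> (\<forall>t\<in>I. \<forall>x. 0 < h t x) \<longrightarrow>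
       (let \<mu> = (\<lambda>t. density \<mu>0 (\<lambda>x. ennreal (h t x)));
            \<mu>\<^sub>t = (\<lambda>t x. ddtM I h t x / h t x);
            r = (\<lambda>t. fst (Phi_map \<mu>0 (R_map (h t))));
            \<phi> = (\<lambda>t. snd (Phi_map \<mu>0 (R_map (h t))))
        in smooth_polar \<A> \<mu>0 I r \<phi> \<and>
           (\<forall>t\<in>I. G_metric C1 C2 (\<mu> t) (\<mu>\<^sub>t t) (\<mu>\<^sub>t t) =
              polar_metric \<mu>0 g1 g2 (r t) (ddt I r t, ddtM I \<phi> t) (ddt I r t, ddtM I \<phi> t)))"
    unfolding Let_def
  proof (intro allI impI, elim conjE)
    fix h assume h: "smooth_family \<A> I h" "\<forall>t\<in>I. \<forall>x. 0 < h t x"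
    let ?r = "\<lambda>t. fst (Phi_map \<mu>0 (R_map (h t)))"
    let ?\<phi> = "\<lambda>t. snd (Phi_map \<mu>0 (R_map (h t)))"
    have hp: "\<And>t x. t \<in> I \<Longrightarrow> 0 < h t x" using h(2) by blast
    have r: "?r t = sqrt (\<integral>x. h t x \<partial>\<mu>0)" and \<phi>: "\<And>x. ?\<phi> t x = sqrt (h t x) / ?r t"
      if "t \<in> I" for t
      using polar_coordinates[of "h t", OF hp[OF that]] by simp_all
    note pf = polar_family[OF h(1) hp r \<phi>]
    show "smooth_polar \<A> \<mu>0 I ?r ?\<phi> \<and>
       (\<forall>t\<in>I. G_metric C1 C2 (density \<mu>0 (\<lambda>x. ennreal (h t x))) (\<lambda>x. ddtM I h t x / h t x)
              (\<lambda>x. ddtM I h t x / h t x) =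
            polar_metric \<mu>0 g1 g2 (?r t) (ddt I ?r t, ddtM I ?\<phi> t) (ddt I ?r t, ddtM I ?\<phi> t))"
    proof (intro conjI ballI)
      show sp: "smooth_polar \<A> \<mu>0 I ?r ?\<phi>" by (rule pf(1))
      fix t assume t: "t \<in> I"
      show "G_metric C1 C2 (density \<mu>0 (\<lambda>x. ennreal (h t x))) (\<lambda>x. ddtM I h t x / h t x)
              (\<lambda>x. ddtM I h t x / h t x) =
            polar_metric \<mu>0 g1 g2 (?r t) (ddt I ?r t, ddtM I ?\<phi> t) (ddt I ?r t, ddtM I ?\<phi> t)"
        unfolding g1 g2 by (rule polar_isometry[OF J sp pf(2) pf(3) t])
    qed
  qed

  have coordinate: "smooth_on {0<..} W \<and> inj_on W {0<..} \<and>
       (\<forall>r>0. \<exists>w>0. (W has_real_derivative w) (at r) \<and>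
          (\<forall>\<rho> \<sigma> \<psi> \<zeta>. polar_metric \<mu>0 g1 g2 r (\<rho>, \<psi>) (\<sigma>, \<zeta>)
                      = a (W r) * L2_ip \<mu>0 \<psi> \<zeta> + (w * \<rho>) * (w * \<sigma>)))"
  proof (intro conjI sW injW allI impI)
    fix r :: real assume r: "0 < r"
    have "sqrt (g2 r) * sqrt (g2 r) = g2 r" using pg2[OF r] by simp
    then have "polar_metric \<mu>0 g1 g2 r (\<rho>, \<psi>) (\<sigma>, \<zeta>)
        = a (W r) * L2_ip \<mu>0 \<psi> \<zeta> + (sqrt (g2 r) * \<rho>) * (sqrt (g2 r) * \<sigma>)" for \<rho> \<sigma> \<psi> \<zeta>
      by (simp add: polar_metric_def aW[OF r] mult.assoc mult.left_commute)
    with dW[OF r] pw[OF r]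
    show "\<exists>w>0. (W has_real_derivative w) (at r) \<and>
          (\<forall>\<rho> \<sigma> \<psi> \<zeta>. polar_metric \<mu>0 g1 g2 r (\<rho>, \<psi>) (\<sigma>, \<zeta>)
                      = a (W r) * L2_ip \<mu>0 \<psi> \<zeta> + (w * \<rho>) * (w * \<sigma>))"
      by blast
  qed

  have properties: "(\<exists>A0.
          (\<forall>t\<in>I. g1 (r t) * L2_nrm \<mu>0 (ddtM I \<phi> t) = A0) \<and>
          (\<forall>t\<in>I. ddt I (ddt I r) t
             = A0\<^sup>2 / 2 * (deriv g1 (r t) / ((g1 (r t))\<^sup>2 * g2 (r t)))
               - 1/2 * ddt I (\<lambda>\<tau>. ln (g2 (r \<tau>))) t * ddt I r t) \<and>
          (let s = (\<lambda>t. W (r t)) in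
             (\<forall>t\<in>I. A0 = a (s t) * L2_nrm \<mu>0 (ddtM I \<phi> t)) \<and>
             (\<forall>t\<in>I. ddt I (ddt I s) t = A0\<^sup>2 / 2 * (deriv a (s t) / (a (s t))\<^sup>2)) \<and>
             (\<exists>A1. \<forall>t\<in>I. (ddt I s t)\<^sup>2 = - A0\<^sup>2 / a (s t) + A1))) \<and>
       (\<forall>\<phi>0 \<psi>0. \<phi> 0 = \<phi>0 \<and> ddtM I \<phi> 0 = \<psi>0 \<and> \<psi>0 \<noteq> (\<lambda>x. 0) \<longrightarrow>
          (let \<alpha> = (\<lambda>t. g1 (r 0) * (LBINT \<tau>=0..ereal t. 1 / g1 (r \<tau>))) in
             \<forall>t\<in>I. \<forall>x. \<phi> t x
               = cos (L2_nrm \<mu>0 \<psi>0 * \<alpha> t) * \<phi>0 x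
                 + sin (L2_nrm \<mu>0 \<psi>0 * \<alpha> t) * (\<psi>0 x / L2_nrm \<mu>0 \<psi>0)))"
    if geo: "geodesic \<A> \<mu>0 g1 g2 I r \<phi>" for r \<phi>
  proof -
    have curve: "smooth_polar \<A> \<mu>0 I r \<phi>" using geo by (simp add: geodesic_def)
    then have r: "smooth_on I r" "\<And>t. t \<in> I \<Longrightarrow> 0 < r t" by (auto simp: smooth_polar_def)
    from geo[unfolded geq[OF curve]]
    have eq1: "\<And>t x. t \<in> I \<Longrightarrow> sphere_cov_deriv \<mu>0 I \<phi> (ddtM I \<phi>) t x
                   = - ddt I (\<lambda>\<tau>. ln (g1 (r \<tau>))) t * ddtM I \<phi> t x"
      and eq2: "\<And>t. t \<in> I \<Longrightarrow> ddt I (ddt I r) t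
              = 1/2 * (deriv g1 (r t) / g2 (r t)) * L2_ip \<mu>0 (ddtM I \<phi> t) (ddtM I \<phi> t)
                - 1/2 * ddt I (\<lambda>\<tau>. ln (g2 (r \<tau>))) t * ddt I r t"
      by blast+
    obtain A0 where A0: "\<And>t. t \<in> I \<Longrightarrow> g1 (r t) * L2_nrm \<mu>0 (ddtM I \<phi> t) = A0"
      using geodesic_speed_constant[OF sg1 pg1 J curve eq1] by blast
    have eq3: "ddt I (ddt I r) t
             = A0\<^sup>2 / 2 * (deriv g1 (r t) / ((g1 (r t))\<^sup>2 * g2 (r t)))
               - 1/2 * ddt I (\<lambda>\<tau>. ln (g2 (r \<tau>))) t * ddt I r t" if t: "t \<in> I" for t
    proof -
      have "A0\<^sup>2 = (g1 (r t))\<^sup>2 * L2_ip \<mu>0 (ddtM I \<phi> t) (ddtM I \<phi> t)"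
        unfolding A0[OF t, symmetric] by (simp add: power_mult_distrib L2_nrm_def L2_ip_def)
      then show ?thesis
        unfolding eq2[OF t] using pg1[OF r(2)[OF t]] by simp
    qed
    have arc: "ddt I (ddt I (\<lambda>t. W (r t))) t = A0\<^sup>2 / 2 * (deriv a (W (r t)) / (a (W (r t)))\<^sup>2)"
      if "t \<in> I" for t
      by (rule arclength_equation(1)[OF sg1 pg1 sg2 pg2 J r dW aW daW eq3 that])
    have arc_energy: "\<exists>A1. \<forall>t\<in>I. (ddt I (\<lambda>t. W (r t)) t)\<^sup>2 = - A0\<^sup>2 / a (W (r t)) + A1"
      by (rule arclength_equation(2)[OF sg1 pg1 sg2 pg2 J r dW aW daW eq3])
    have "A0 = a (W (r t)) * L2_nrm \<mu>0 (ddtM I \<phi> t)" if "t \<in> I" for t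
      using A0[OF that] aW[OF r(2)[OF that]] by simp
    moreover have "\<phi> t x = cos (L2_nrm \<mu>0 (ddtM I \<phi> 0) * (g1 (r 0) * (LBINT \<tau>=0..ereal t. 1 / g1 (r \<tau>)))) * \<phi> 0 x
        + sin (L2_nrm \<mu>0 (ddtM I \<phi> 0) * (g1 (r 0) * (LBINT \<tau>=0..ereal t. 1 / g1 (r \<tau>))))
          * (ddtM I \<phi> 0 x / L2_nrm \<mu>0 (ddtM I \<phi> 0))"
      if "ddtM I \<phi> 0 \<noteq> (\<lambda>x. 0)" "t \<in> I" for t x
      by (rule geodesic_great_circle[OF sg1 pg1 J curve eq1 A0 I(2) that(2,1)])
    ultimately show ?thesis
      unfolding Let_def
      by (intro conjI exI[of _ A0] allI impI ballI arc arc_energy eq3 A0) auto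
  qed
  show ?thesis
    by (rule conjI[OF polar_bij conjI[OF polar conjI[OF _ conjI[OF coordinate]]]];
        intro allI impI; (rule geq | rule properties); assumption)
qed

end
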